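(* Let $I\subseteq\overline{\mathbb R}[x_0,\dots,x_n]$ be a homogeneous tropical ideal. There is a finite $\mathbb R$-rational polyhedral complex $\Sigma(I)$ in $\overline{\mathbb R}^{n+1}$, whose support is all of $\overline{\mathbb R}^{n+1}$, such that for any $\sigma\subseteq\{0,\dots,n\}$ and any $\mathbf w,\mathbf w'\in\overline{\mathbb R}^{n+1}_\sigma$, the vectors $\mathbf w$ and $\mathbf w'$ lie in the same cell of $\Sigma(I)$ if and only if $\mathrm{in}_{\mathbf w}(I)=\mathrm{in}_{\mathbf w'}(I)$.
   Context: $\overline{\mathbb R}=(\mathbb R\cup\{\infty\},\oplus=\min,\odot=+)$ is the tropical semiring and $\mathbb B=\{0,\infty\}\subseteq\overline{\mathbb R}$ the Boolean subsemiring. Polynomials are formal. An ideal of a semiring is a nonempty subset closed under addition and under multiplication by elements of the semiring. Homogeneous tropical ideal: a homogeneous ideal $I\subseteq\overline{\mathbb R}[x_0,\dots,x_n]$ such that for each $d\ge0$ the degree-$d$ part $I_d$ is the set of vectors of a valuated matroid on the set of monomials of degree $d$; equivalently, for any $f,g\in I_d$ and any monomial $\mathbf x^{\mathbf u}$ at which $f$ and $g$ have the same coefficient $\neq\infty$, there is $h\in I_d$ whose coefficient at $\mathbf x^{\mathbf u}$ is $\infty$ and whose coefficient at every monomial is at least the minimum of those of $f$ and $g$, with equality whenever the latter two differ. Initial ideals: for $\mathbf w\in\overline{\mathbb R}^{n+1}$ and $f=\bigoplus a_{\mathbf u}\odot\mathbf x^{\mathbf u}$, $\mathrm{in}_{\mathbf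 w}(f)=\bigoplus_{a_{\mathbf u}+\mathbf w\cdot\mathbf u=f(\mathbf w)}\mathbf x^{\mathbf u}\in\mathbb B[x_0,\dots,x_n]$ if $f(\mathbf w)<\infty$, and $\mathrm{in}_{\mathbf w}(f)=\infty$ otherwise (convention: $\infty\cdot a=\infty$ for $a\neq0$, $\infty\cdot0=0$). $\mathrm{in}_{\mathbf w}(I)=\langle\mathrm{in}_{\mathbf w}(f):f\in I\rangle\subseteq\mathbb B[x_0,\dots,x_n]$. Polyhedral complexes in $\overline{\mathbb R}^{n+1}$: for $\sigma\subseteq\{0,\dots,n\}$, $\overline{\mathbb R}^{n+1}_\sigma=\{\mathbf w: w_i=\infty\text{ for }i\in\sigma,\ w_i\ne\infty\text{ for }i\notin\sigma\}\cong\mathbb R^{n+1-|\sigma|}$. $\overline{\mathbb R}$ has the topology with basis the open intervals of $\mathbb R$ and the sets $(a,\infty]$, and $\overline{\mathbb R}^{n+1}$ the product topology. A polyhedral complex $\Delta$ in $\overline{\mathbb R}^{n+1}$ is a collection of polyhedral complexes $\Delta_\sigma\subseteq\overline{\mathbb R}^{n+1}_\sigma$, one for each $\sigma$, such that if $\tau\subseteq\sigma$ and $P\in\Delta_\tau$ then the closure of $P$ in $\overline{\mathbb R}^{n+1}$ intersected with $\overline{\mathbb R}^{n+1}_\sigma$ is contained in a polyhedron of $\Delta_\sigma$. It is $\mathbb R$-rational if every polyhedron of each $\Delta_\sigma$ has the form $\{\mathbf x\in\mathbb R^{n+1-|\sigma|}:A\mathbf x\le\mathbf b\}$ with $A$ a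 rational matrix and $\mathbf b$ a real vector. Two vectors of $\overline{\mathbb R}^{n+1}_\sigma$ lie in the same cell if they lie in the relative interior of the same polyhedron of $\Delta_\sigma$. *)

theory Defs
  imports "HOL-Analysis.Analysis" "HOL-Library.Poly_Mapping"
begin

section \<open>The tropical semiring\<close>

text \<open>
  The tropical semiring is made an instance of the semiring classes, so the symbols change
  their meaning: the semiring zero \<open>0\<close> is \<open>Infty\<close>, the semiring one \<open>1\<close> is \<open>Fin 0\<close>,
  \<open>+\<close> is the minimum and \<open>*\<close> is the ordinary addition of real numbers extended by infinity.
  The order is the usual one, with \<open>Infty\<close> as the top element.
\<close>

datatype tropical = Fin real | Infty

instantiation tropical :: linorder
begin

fun less_eq_tropical :: "tropical \<Rightarrow> tropical \<Rightarrow> bool" where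
  "Fin a \<le> Fin b \<longleftrightarrow> a \<le> b"
| "Infty \<le> Fin b \<longleftrightarrow> False"
| "x \<le> Infty \<longleftrightarrow> True"

definition less_tropical :: "tropical \<Rightarrow> tropical \<Rightarrow> bool" where
  "x < y \<longleftrightarrow> x \<le> y \<and> \<not> y \<le> x" for x y :: tropical

instance
proof
  fix x y z :: tropical
  show "x < y \<longleftrightarrow> x \<le> y \<and> \<not> y \<le> x" by (rule less_tropical_def)
  show "x \<le> x" by (cases x) auto
  show "x \<le> y \<Longrightarrow> y \<le> z \<Longrightarrow> x \<le> z" by (cases x; cases y; cases z) auto
  show "x \<le> y \<Longrightarrow> y \<le> x \<Longrightarrow> x = y" by (cases x; cases y) auto
  show "x \<le> y \<or> y \<le> x" by (cases x; cases y) auto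
qed

end

instantiation tropical :: comm_semiring_1
begin

definition zero_tropical :: tropical where "0 = Infty"

definition one_tropical :: tropical where "1 = Fin 0"

definition plus_tropical :: "tropical \<Rightarrow> tropical \<Rightarrow> tropical" where
  "x + y = min x y" for x y :: tropical

fun times_tropical :: "tropical \<Rightarrow> tropical \<Rightarrow> tropical" where
  "Fin a * Fin b = Fin (a + b)"
| "Infty * x = Infty"
| "x * Infty = Infty"

instance
proof
  fix x y z :: tropical
  show "x + y + z = x + (y + z)" by (simp add: plus_tropical_def min.assoc)
  show "x + y = y + x" by (simp add: plus_tropical_def min.commute)
  show "0 + x = x" by (cases x) (simp_all add: plus_tropical_def zero_tropical_def min_def)
  show "x * y * z = x * (y * z)" by (cases x; cases y; cases z) simp_all
  show "x * y = y * x" by (cases x; cases y) simp_all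
  show "1 * x = x" by (cases x) (simp_all add: one_tropical_def)
  show "(x + y) * z = x * z + y * z"
    by (cases x; cases y; cases z) (simp_all add: plus_tropical_def min_def)
  show "0 * x = 0" by (simp add: zero_tropical_def)
  show "x * 0 = 0" by (cases x) (simp_all add: zero_tropical_def)
  show "(0::tropical) \<noteq> 1" by (simp add: zero_tropical_def one_tropical_def)
qed

end

text \<open>
  Vectors of length n+1 over the tropical semiring are elements of \<open>tropical ^ 'n\<close>, where
  the finite type \<open>'n\<close> has n+1 elements; the library instance of \<open>topological_space\<close> for
  \<open>vec\<close> is the product topology.
\<close>

instantiation tropical :: topological_space
begin

definition open_tropical :: "tropical set \<Rightarrow> bool" where
  "open_tropical = generate_topology
     (range (\<lambda>(a, b). Fin ` {a<..<b}) \<union> range (\<lambda>a. insert Infty (Fin ` {a<..})))"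

instance
  by standard (auto simp: open_tropical_def intro: generate_topology.intros)

end


section \<open>Polynomials and ideals\<close>

text \<open>Formal polynomials in variables indexed by \<open>'n\<close>: exponent vectors are finitely supported
  functions into the naturals, and a polynomial maps finitely many of them to coefficients
  different from infinity.\<close>

type_synonym 'n monom = "'n \<Rightarrow>\<^sub>0 nat"
type_synonym 'n tpoly = "'n monom \<Rightarrow>\<^sub>0 tropical"

abbreviation "lookup \<equiv> Poly_Mapping.lookup"
abbreviation "keys \<equiv> Poly_Mapping.keys"

definition monom_degree :: "'n::finite monom \<Rightarrow> nat" where
  "monom_degree u = (\<Sum>i\<in>UNIV. lookup u i)"

text \<open>The zero polynomial is homogeneous of every degree.\<close>

definition homogeneous_of_degree :: "nat \<Rightarrow> 'n::finite tpoly \<Rightarrow> bool" where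
  "homogeneous_of_degree d f \<longleftrightarrow> (\<forall>u\<in>keys f. monom_degree u = d)"

text \<open>Ideals of a subsemiring \<open>R\<close>; the whole ambient semiring is \<open>R = UNIV\<close>.\<close>

definition semiring_ideal :: "'a::comm_semiring_1 set \<Rightarrow> 'a set \<Rightarrow> bool" where
  "semiring_ideal R J \<longleftrightarrow> J \<subseteq> R \<and> J \<noteq> {} \<and>
     (\<forall>x\<in>J. \<forall>y\<in>J. x + y \<in> J) \<and> (\<forall>r\<in>R. \<forall>x\<in>J. r * x \<in> J)"

definition ideal_generated :: "'a::comm_semiring_1 set \<Rightarrow> 'a set \<Rightarrow> 'a set" where
  "ideal_generated R S = \<Inter>{J. semiring_ideal R J \<and> S \<subseteq> J}"

definition homogeneous_ideal :: "'n::finite tpoly set \<Rightarrow> bool" where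
  "homogeneous_ideal I \<longleftrightarrow> semiring_ideal UNIV I \<and>
     (\<exists>G. (\<forall>g\<in>G. \<exists>d. homogeneous_of_degree d g) \<and> I = ideal_generated UNIV G)"

definition degree_part :: "'n::finite tpoly set \<Rightarrow> nat \<Rightarrow> 'n tpoly set" where
  "degree_part I d = {f\<in>I. homogeneous_of_degree d f}"

text \<open>The vector elimination axiom of valuated matroids. The degree parts of an ideal are closed
  under tropical linear combinations, so this axiom says that they are sets of vectors of
  valuated matroids.\<close>

definition monomial_elimination :: "'n tpoly set \<Rightarrow> bool" where
  "monomial_elimination V \<longleftrightarrow>
     (\<forall>f\<in>V. \<forall>g\<in>V. \<forall>u. lookup f u = lookup g u \<and> lookup f u \<noteq> Infty \<longrightarrow>
        (\<exists>h\<in>V. lookup h u = Infty \<and>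
           (\<forall>v. lookup h v \<ge> min (lookup f v) (lookup g v) \<and>
                (lookup f v \<noteq> lookup g v \<longrightarrow> lookup h v = min (lookup f v) (lookup g v)))))"

definition homogeneous_tropical_ideal :: "'n::finite tpoly set \<Rightarrow> bool" where
  "homogeneous_tropical_ideal I \<longleftrightarrow>
     homogeneous_ideal I \<and> (\<forall>d. monomial_elimination (degree_part I d))"


section \<open>Initial ideals\<close>

text \<open>In the tropical semiring a product of powers of the \<open>w $ i\<close> is the dot product of \<open>w\<close> and
  the exponent vector; the convention for infinity times 0 is \<open>Infty ^ 0 = 1 = Fin 0\<close>.
  Hence \<open>term_value f w u\<close> is the real-notation value of a(u) + w.u, and \<open>poly_value f w\<close> is the
  minimum of these values.\<close>

definition term_value :: "'n::finite tpoly \<Rightarrow> tropical ^ 'n \<Rightarrow> 'n monom \<Rightarrow> tropical" where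
  "term_value f w u = lookup f u * (\<Prod>i\<in>UNIV. (w $ i) ^ lookup u i)"

definition poly_value :: "'n::finite tpoly \<Rightarrow> tropical ^ 'n \<Rightarrow> tropical" where
  "poly_value f w = (\<Sum>u\<in>keys f. term_value f w u)"

text \<open>\<open>Poly_Mapping.single u 1\<close> is the monomial with exponent \<open>u\<close>, and the polynomial \<open>0\<close> has all
  coefficients equal to infinity.\<close>

definition initial_form :: "tropical ^ 'n \<Rightarrow> 'n::finite tpoly \<Rightarrow> 'n tpoly" where
  "initial_form w f =
     (if poly_value f w \<noteq> Infty
      then (\<Sum>u\<in>{u\<in>keys f. term_value f w u = poly_value f w}. Poly_Mapping.single u 1)
      else 0)"

text \<open>The subsemiring of polynomials with coefficients in the Boolean semiring.\<close>

definition boolean_polys :: "'n tpoly set" where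
  "boolean_polys = {f. \<forall>u. lookup f u \<in> {Fin 0, Infty}}"

definition initial_ideal :: "tropical ^ 'n \<Rightarrow> 'n::finite tpoly set \<Rightarrow> 'n tpoly set" where
  "initial_ideal w I = ideal_generated boolean_polys (initial_form w ` I)"

text \<open>The family intersected in \<open>initial_ideal\<close> is nonempty by the following facts.\<close>

lemma semiring_ideal_boolean_polys: "semiring_ideal boolean_polys (boolean_polys :: 'n tpoly set)"
proof -
  have sum: "sum a A \<in> {Fin 0, Infty}" if "\<And>x. x \<in> A \<Longrightarrow> a x \<in> {Fin 0, Infty}"
    for a :: "'b \<Rightarrow> tropical" and A
    using that
    by (induction A rule: infinite_finite_induct)
       (auto simp: zero_tropical_def plus_tropical_def min_def)
  have "(\<Sum>x. a x) \<in> {Fin 0, Infty}" if "\<And>x. a x \<in> {Fin 0, Infty}" for a :: "'b \<Rightarrow> tropical"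
    using sum[of _ a] that by (auto simp: Sum_any.expand_set)
  moreover have "x * y \<in> {Fin 0, Infty}" if "x \<in> {Fin 0, Infty}" "y \<in> {Fin 0, Infty}"
    for x y :: tropical using that by auto
  moreover have "(x when P) \<in> {Fin 0, Infty}" if "x \<in> {Fin 0, Infty}" for x :: tropical and P
    using that by (cases P) (auto simp: zero_tropical_def)
  ultimately have mult: "f * g \<in> boolean_polys"
    if "f \<in> boolean_polys" "g \<in> boolean_polys" for f g :: "'n tpoly"
    using that unfolding boolean_polys_def mem_Collect_eq lookup_mult by meson
  have "(0 :: 'n tpoly) \<in> boolean_polys"
    by (simp add: boolean_polys_def zero_tropical_def)
  moreover have "f + g \<in> boolean_polys"
    if "f \<in> boolean_polys" "g \<in> boolean_polys" for f g :: "'n tpoly"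
    using that by (auto simp: boolean_polys_def lookup_add plus_tropical_def min_def)
  ultimately show ?thesis
    using mult by (auto simp: semiring_ideal_def)
qed

lemma initial_form_in_boolean_polys: "initial_form w f \<in> boolean_polys"
proof -
  have "(\<Sum>u\<in>A. Poly_Mapping.single u 1) \<in> boolean_polys" for A :: "'a monom set"
    by (induction A rule: infinite_finite_induct)
       (auto simp: boolean_polys_def lookup_add lookup_single when_def plus_tropical_def min_def
          zero_tropical_def one_tropical_def)
  moreover have "(0 :: 'a tpoly) \<in> boolean_polys"
    by (simp add: boolean_polys_def zero_tropical_def)
  ultimately show ?thesis by (simp add: initial_form_def)
qed


section \<open>Polyhedral complexes\<close>

definition stratum :: "'n set \<Rightarrow> (tropical ^ 'n) set" where
  "stratum \<sigma> = {w. \<forall>i. w $ i = Infty \<longleftrightarrow> i \<in> \<sigma>}"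

text \<open>
  The stratum of \<open>\<sigma>\<close> is a Euclidean space of dimension n+1-|\<open>\<sigma>\<close>|, which depends on \<open>\<sigma>\<close>.
  It is represented by the coordinate subspace of \<open>real ^ 'n\<close> on which the coordinates in
  \<open>\<sigma>\<close> vanish, where the library notions of polyhedra, faces and relative interiors apply.
\<close>

definition coord_subspace :: "'n set \<Rightarrow> (real ^ 'n) set" where
  "coord_subspace \<sigma> = {x. \<forall>i\<in>\<sigma>. x $ i = 0}"

definition stratum_embed :: "'n set \<Rightarrow> real ^ 'n \<Rightarrow> tropical ^ 'n" where
  "stratum_embed \<sigma> x = (\<chi> i. if i \<in> \<sigma> then Infty else Fin (x $ i))"

lemma bij_betw_stratum_embed: "bij_betw (stratum_embed \<sigma>) (coord_subspace \<sigma>) (stratum \<sigma>)"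
proof (rule bij_betwI')
  fix x y assume "x \<in> coord_subspace \<sigma>" "y \<in> coord_subspace \<sigma>"
  then show "stratum_embed \<sigma> x = stratum_embed \<sigma> y \<longleftrightarrow> x = y"
    by (auto simp: coord_subspace_def stratum_embed_def vec_eq_iff split: if_splits) metis
next
  fix x show "stratum_embed \<sigma> x \<in> stratum \<sigma>"
    by (auto simp: stratum_def stratum_embed_def)
next
  fix w assume w: "w \<in> stratum \<sigma>"
  define x where "x = (\<chi> i. case w $ i of Fin a \<Rightarrow> a | Infty \<Rightarrow> 0)"
  have inf: "w $ i = Infty" if "i \<in> \<sigma>" for i
    using w that by (simp add: stratum_def)
  have fin: "w $ i = Fin (x $ i)" if "i \<notin> \<sigma>" for i
    using w that by (cases "w $ i") (auto simp: stratum_def x_def)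
  have "x \<in> coord_subspace \<sigma>"
    by (simp add: coord_subspace_def x_def inf)
  moreover have "w = stratum_embed \<sigma> x"
    by (simp add: stratum_embed_def vec_eq_iff inf fin)
  ultimately show "\<exists>x\<in>coord_subspace \<sigma>. w = stratum_embed \<sigma> x" by blast
qed

text \<open>Faces are required to belong to the complex only if they are nonempty; whether the empty
  set is a member is left open.\<close>

definition polyhedral_complex :: "(real ^ 'n) set set \<Rightarrow> bool" where
  "polyhedral_complex C \<longleftrightarrow>
     (\<forall>P\<in>C. polyhedron P) \<and>
     (\<forall>P\<in>C. \<forall>F. F face_of P \<and> F \<noteq> {} \<longrightarrow> F \<in> C) \<and>
     (\<forall>P\<in>C. \<forall>Q\<in>C. P \<inter> Q \<noteq> {} \<longrightarrow> P \<inter> Q face_of P \<and> P \<inter> Q face_of Q)"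

definition tropical_polyhedral_complex :: "('n set \<Rightarrow> (real ^ 'n) set set) \<Rightarrow> bool" where
  "tropical_polyhedral_complex \<Delta> \<longleftrightarrow>
     (\<forall>\<sigma>. polyhedral_complex (\<Delta> \<sigma>) \<and> (\<forall>P\<in>\<Delta> \<sigma>. P \<subseteq> coord_subspace \<sigma>)) \<and>
     (\<forall>\<tau> \<sigma>. \<tau> \<subseteq> \<sigma> \<longrightarrow> (\<forall>P\<in>\<Delta> \<tau>. \<exists>Q\<in>\<Delta> \<sigma>.
        closure (stratum_embed \<tau> ` P) \<inter> stratum \<sigma> \<subseteq> stratum_embed \<sigma> ` Q))"

text \<open>\<open>A\<close> is a rational matrix with \<open>m\<close> rows. Its columns in \<open>\<sigma>\<close> are irrelevant, since the
  corresponding coordinates vanish.\<close>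

definition R_rational_polyhedron :: "'n::finite set \<Rightarrow> (real ^ 'n) set \<Rightarrow> bool" where
  "R_rational_polyhedron \<sigma> P \<longleftrightarrow>
     (\<exists>(m::nat) (A :: nat \<Rightarrow> real ^ 'n) (b :: nat \<Rightarrow> real).
        (\<forall>k<m. \<forall>i. A k $ i \<in> \<rat>) \<and>
        P = {x \<in> coord_subspace \<sigma>. \<forall>k<m. A k \<bullet> x \<le> b k})"

definition R_rational :: "('n::finite set \<Rightarrow> (real ^ 'n) set set) \<Rightarrow> bool" where
  "R_rational \<Delta> \<longleftrightarrow> (\<forall>\<sigma>. \<forall>P\<in>\<Delta> \<sigma>. R_rational_polyhedron \<sigma> P)"

definition finite_complex :: "('n set \<Rightarrow> (real ^ 'n) set set) \<Rightarrow> bool" where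
  "finite_complex \<Delta> \<longleftrightarrow> (\<forall>\<sigma>. finite (\<Delta> \<sigma>))"

definition complex_support :: "('n set \<Rightarrow> (real ^ 'n) set set) \<Rightarrow> (tropical ^ 'n) set" where
  "complex_support \<Delta> = (\<Union>\<sigma>. \<Union>P\<in>\<Delta> \<sigma>. stratum_embed \<sigma> ` P)"

definition same_cell ::
    "('n::finite set \<Rightarrow> (real ^ 'n) set set) \<Rightarrow> 'n set \<Rightarrow> tropical ^ 'n \<Rightarrow> tropical ^ 'n \<Rightarrow> bool" where
  "same_cell \<Delta> \<sigma> w w' \<longleftrightarrow>
     (\<exists>P\<in>\<Delta> \<sigma>. w \<in> stratum_embed \<sigma> ` rel_interior P \<and> w' \<in> stratum_embed \<sigma> ` rel_interior P)"

end

theory Submission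
  imports Defs
begin

text \<open>
  For a tropical linear space \<open>V\<close> and weights \<open>w\<close>, a basis of \<open>V\<close> of minimal weight has
  fundamental circuits whose initial forms contain the element that indexes them. Two weights for
  which the same basis is optimal have the same initial space iff these fundamental circuits have
  the same ties. Hence the weights for which a given basis is optimal form a rational polyhedron,
  its relatively open faces are the classes of equal initial spaces, and no valuation on the set
  of all bases is needed. For a homogeneous tropical ideal this settles any bounded
  range of degrees. A bound on the degrees that matter comes from the sets of leading monomials for
  a fixed tie-breaking order: in every degree they are complements of bases of the same
  matroid, so none properly contains another, and by Dickson's lemma all of them
  are generated in uniformly bounded degree. Equality of initial spaces then propagates from
  generators to their multiples. In the stratum of \<open>\<sigma>\<close> the same applies to the ideal with the
  variables of \<open>\<sigma>\<close> set to infinity, and the fundamental circuits restrict compatibly when a cell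
  is closed up towards a smaller stratum.
\<close>

section \<open>Initial spaces of tropical linear spaces\<close>

text \<open>Over Boolean coefficients a polynomial is its support, so initial ideals are handled as
  families of finite sets of exponents closed under union and multiplication. Homogeneity extends
  elimination from single degrees to mixed ones, so all degrees up to \<open>D\<close> form one
  linear space on a finite ground set. Three obstacles shape the argument. A single initial ideal
  has bounded generators, but infinitely many weights are compared, so the bound must not depend on
  the weight; hence the antichain condition. Equality of two initial spaces is not visibly inherited
  by multiples; it is therefore expressed through vectors that have the same leading element and the
  same minimal terms for both weights, a condition on one vector that survives multiplication and
  truncation. Finally, the polyhedra of different bases overlap without evident face-to-face
  incidence; a face is recovered from its relative interior, which is a class of weights and does
  not see the basis. One \<open>D\<close> serves all strata, so that circuits for \<tau> restrict to
  circuits for \<sigma> in the same range of degrees.\<close>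

lemma tropical_le_Infty [simp]: "x \<le> Infty" for x :: tropical
  by (cases x) auto

lemma tropical_Infty_le [simp]: "Infty \<le> x \<longleftrightarrow> x = Infty" for x :: tropical
  by (cases x) auto

lemma tropical_times_Infty [simp]: "x * Infty = Infty" for x :: tropical
  by (cases x) auto

lemma tropical_less_simps [simp]:
  "Fin a < Fin b \<longleftrightarrow> a < b" "Fin a < Infty" "\<not> Infty < x"
  by (cases x; auto simp: less_tropical_def)+

lemma tropical_times_eq_Infty [simp]: "x * y = Infty \<longleftrightarrow> x = Infty \<or> y = Infty" for x y :: tropical
  by (cases x; cases y) auto

lemma tropical_Fin_times_le [simp]: "Fin c * x \<le> Fin c * y \<longleftrightarrow> x \<le> y"
  by (cases x; cases y) auto

lemma tropical_Fin_times_eq [simp]: "Fin c * x = Fin c * y \<longleftrightarrow> x = y"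
  by (cases x; cases y) auto

lemma tropical_Fin_le_Fin_times: "Fin b \<le> Fin c * x \<longleftrightarrow> Fin (b - c) \<le> x"
  by (cases x) auto

lemma tropical_Fin_times_eq_Fin: "Fin c * x = Fin b \<longleftrightarrow> x = Fin (b - c)"
  by (cases x) auto

lemma tropical_Fin_add_le_times:
  assumes "Fin a \<le> x" "Fin b \<le> y"
  shows "Fin (a + b) \<le> x * y"
  using assms by (cases x; cases y) auto

lemma tropical_times_eq_Fin_add:
  assumes "Fin a \<le> x" "Fin b \<le> y" "x * y = Fin (a + b)"
  shows "x = Fin a" "y = Fin b"
  using assms by (cases x; cases y; auto)+

text \<open>Taking the minimum of \<open>f x + w x\<close> to be \<open>0\<close> loses no generality, since \<open>V\<close> will be closed
  under scaling; vectors whose minimum is positive contribute the empty set.\<close>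

definition initial_sets :: "('a \<Rightarrow> tropical) set \<Rightarrow> ('a \<Rightarrow> real) \<Rightarrow> 'a set set" where
  "initial_sets V w = {{x. f x = Fin (- w x)} | f. f \<in> V \<and> (\<forall>x. Fin (- w x) \<le> f x)}"

lemma initial_setsI:
  assumes "f \<in> V" "\<And>x. Fin (- w x) \<le> f x" "A = {x. f x = Fin (- w x)}"
  shows "A \<in> initial_sets V w"
  using assms by (auto simp: initial_sets_def)

lemma initial_setsE:
  assumes "A \<in> initial_sets V w"
  obtains f where "f \<in> V" "\<And>x. Fin (- w x) \<le> f x" "A = {x. f x = Fin (- w x)}"
  using assms by (auto simp: initial_sets_def)

lemma initial_sets_mono: "V \<subseteq> V' \<Longrightarrow> initial_sets V w \<subseteq> initial_sets V' w"
  by (auto simp: initial_sets_def)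

text \<open>Kept apart from elimination because no finite ground set is involved: the coefficient
  vectors of the ideal on infinitely many monomials form such a module, while the linear spaces
  below are finite.\<close>

locale tropical_module =
  fixes V :: "('a \<Rightarrow> tropical) set"
  assumes zero_mem: "(\<lambda>_. Infty) \<in> V"
    and scale_mem: "f \<in> V \<Longrightarrow> (\<lambda>x. Fin c * f x) \<in> V"
    and min_mem: "f \<in> V \<Longrightarrow> g \<in> V \<Longrightarrow> (\<lambda>x. min (f x) (g x)) \<in> V"
begin

lemma initial_sets_level:
  assumes "f \<in> V" "\<And>x. Fin (c - w x) \<le> f x"
  shows "{x. f x = Fin (c - w x)} \<in> initial_sets V w"
  by (rule initial_setsI[OF scale_mem[OF assms(1), of "- c"]])
     (use assms(2) in \<open>auto simp: tropical_Fin_le_Fin_times tropical_Fin_times_eq_Fin\<close>)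

lemma initial_sets_empty: "{} \<in> initial_sets V w"
  by (rule initial_setsI[OF zero_mem]) auto

lemma initial_sets_Un:
  assumes "A \<in> initial_sets V w" "B \<in> initial_sets V w"
  shows "A \<union> B \<in> initial_sets V w"
proof -
  obtain f where f: "f \<in> V" "\<And>x. Fin (- w x) \<le> f x" "A = {x. f x = Fin (- w x)}"
    using assms(1) by (rule initial_setsE) blast
  obtain g where g: "g \<in> V" "\<And>x. Fin (- w x) \<le> g x" "B = {x. g x = Fin (- w x)}"
    using assms(2) by (rule initial_setsE) blast
  show ?thesis
    by (rule initial_setsI[OF min_mem[OF f(1) g(1)]])
       (use f(2) g(2) in \<open>auto simp: f(3) g(3) min_def intro: antisym\<close>)
qed

lemma initial_sets_UN:
  assumes "finite K" "\<And>k. k \<in> K \<Longrightarrow> A k \<in> initial_sets V w"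
  shows "(\<Union>k\<in>K. A k) \<in> initial_sets V w"
  using assms by (induction K) (auto intro: initial_sets_empty initial_sets_Un)

text \<open>The level \<open>c\<close> is the minimum of \<open>f x + w x\<close> over the finite
  support, so it is attained. The value 0 of \<open>r\<close> outside the support is a
  dummy.\<close>

lemma initial_set_through:
  assumes "f \<in> V" "finite {x. f x \<noteq> Infty}" "f y \<noteq> Infty"
  obtains A c where "A \<in> initial_sets V w" "A \<noteq> {}" "A = {x. f x = Fin (c - w x)}"
    "\<And>x. Fin (c - w x) \<le> f x"
proof -
  define r where "r x = (case f x of Fin a \<Rightarrow> a + w x | Infty \<Rightarrow> 0)" for x
  define c where "c = Min (r ` {x. f x \<noteq> Infty})"
  have fr: "f x = Fin (r x - w x)" if "f x \<noteq> Infty" for x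
    using that by (cases "f x") (auto simp: r_def)
  have "c \<in> r ` {x. f x \<noteq> Infty}"
    unfolding c_def using assms(2,3) by (intro Min_in) auto
  then obtain z where z: "f z \<noteq> Infty" "c = r z" by auto
  have le: "Fin (c - w x) \<le> f x" for x
  proof (cases "f x = Infty")
    case False
    then have "c \<le> r x" unfolding c_def using assms(2) by (intro Min_le) auto
    then show ?thesis using fr[OF False] by simp
  qed simp
  have "z \<in> {x. f x = Fin (c - w x)}" using fr[OF z(1)] z(2) by simp
  then show ?thesis using that initial_sets_level[OF assms(1) le] le by blast
qed

end

locale tropical_linear_space = tropical_module V
  for V :: "('a \<Rightarrow> tropical) set" +
  fixes E :: "'a set"
  assumes finite_E: "finite E"
    and support: "f \<in> V \<Longrightarrow> f x \<noteq> Infty \<Longrightarrow> x \<in> E"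
    and elim: "f \<in> V \<Longrightarrow> g \<in> V \<Longrightarrow> f u = g u \<Longrightarrow> f u \<noteq> Infty \<Longrightarrow>
      \<exists>h\<in>V. h u = Infty \<and>
        (\<forall>x. min (f x) (g x) \<le> h x \<and> (f x \<noteq> g x \<longrightarrow> h x = min (f x) (g x)))"
begin

lemma finite_support: "f \<in> V \<Longrightarrow> finite {x. f x \<noteq> Infty}"
  by (rule finite_subset[OF _ finite_E]) (auto dest: support)

text \<open>\<open>M\<close> is the complement of a basis of the valuated matroid with vectors \<open>V\<close>, and \<open>C e\<close> is the
  fundamental circuit of \<open>e\<close>.\<close>

definition basis :: "'a set \<Rightarrow> ('a \<Rightarrow> 'a \<Rightarrow> tropical) \<Rightarrow> bool" where
  "basis M C \<longleftrightarrow>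
     (\<forall>e\<in>M. C e \<in> V \<and> C e e = Fin 0 \<and> (\<forall>e'\<in>M. e' \<noteq> e \<longrightarrow> C e e' = Infty)) \<and>
     (\<forall>f\<in>V. (\<forall>e\<in>M. f e = Infty) \<longrightarrow> (\<forall>x. f x = Infty))"

lemma basisD:
  assumes "basis M C"
  shows "e \<in> M \<Longrightarrow> C e \<in> V" "e \<in> M \<Longrightarrow> C e e = Fin 0"
    "e \<in> M \<Longrightarrow> e' \<in> M \<Longrightarrow> e' \<noteq> e \<Longrightarrow> C e e' = Infty"
    "f \<in> V \<Longrightarrow> (\<And>e. e \<in> M \<Longrightarrow> f e = Infty) \<Longrightarrow> f x = Infty"
  using assms by (auto simp: basis_def)

lemma basis_subset: "basis M C \<Longrightarrow> M \<subseteq> E"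
  using support by (fastforce simp: basis_def)

text \<open>Eliminating \<open>e\<close> between \<open>f\<close> and \<open>C e\<close> gives a
  vector that is \<open>Infty\<close> on \<open>M\<close>, hence everywhere, whereas at a point of
  difference it would be a finite minimum. Thus \<open>M\<close> alone determines the circuits,
  which later bounds the number of inequality systems.\<close>

lemma basis_unique:
  assumes b: "basis M C" and e: "e \<in> M" and f: "f \<in> V" "f e = Fin 0"
    "\<And>e'. e' \<in> M \<Longrightarrow> e' \<noteq> e \<Longrightarrow> f e' = Infty"
  shows "f = C e"
proof (rule ccontr)
  assume "f \<noteq> C e"
  then obtain x where x: "f x \<noteq> C e x" by auto
  obtain h where h: "h \<in> V" "h e = Infty" "\<And>x. min (f x) (C e x) \<le> h x"
    "\<And>x. f x \<noteq> C e x \<Longrightarrow> h x = min (f x) (C e x)"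
    using elim[OF f(1) basisD(1)[OF b e], of e] basisD(2)[OF b e] f(2) by auto
  have "h e' = Infty" if "e' \<in> M" for e'
    using h(2) h(3)[of e'] f(3)[OF that] basisD(3)[OF b e that] by (cases "e' = e") auto
  then have "h x = Infty" using basisD(4)[OF b h(1)] by blast
  with h(4)[OF x] x show False by (auto simp: min_def split: if_splits)
qed

text \<open>The coordinates in \<open>R\<close> are cleared one by one with multiples of their
  circuits. As \<open>C u\<close> is \<open>Infty\<close> on the rest of \<open>M\<close>, no other
  coordinate of \<open>M\<close> changes, so the multiplier of \<open>C e\<close> is still the
  original \<open>f e\<close>. Off \<open>M\<close> ties make the result uncertain, hence a lower
  bound by one of the summands in general and an exact value only where \<open>f\<close> is strictly
  smallest.\<close>

lemma basis_eliminate: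
  assumes b: "basis M C" and f: "f \<in> V" and "finite R" "R \<subseteq> M"
  shows "\<exists>h\<in>V. (\<forall>e\<in>R. h e = Infty) \<and> (\<forall>e\<in>M - R. h e = f e) \<and>
    (\<forall>x. x \<notin> M \<longrightarrow> (f x \<le> h x \<or> (\<exists>e\<in>R. f e * C e x \<le> h x)) \<and>
       ((\<forall>e\<in>R. f x < f e * C e x) \<longrightarrow> h x = f x))"
  using assms(3,4)
proof (induction R rule: finite_induct)
  case empty
  then show ?case using f by (intro bexI[of _ f]) auto
next
  case (insert u R)
  then obtain h where h: "h \<in> V" "\<And>e. e \<in> R \<Longrightarrow> h e = Infty" "\<And>e. e \<in> M - R \<Longrightarrow> h e = f e"
    "\<And>x. x \<notin> M \<Longrightarrow> f x \<le> h x \<or> (\<exists>e\<in>R. f e * C e x \<le> h x)"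
    "\<And>x. x \<notin> M \<Longrightarrow> (\<forall>e\<in>R. f x < f e * C e x) \<Longrightarrow> h x = f x"
    by auto
  have u: "u \<in> M" and hu: "h u = f u" using insert h(3)[of u] by auto
  show ?case
  proof (cases "f u")
    case Infty
    then show ?thesis using h hu by (intro bexI[of _ h]) auto
  next
    case (Fin a)
    define g where "g = (\<lambda>x. Fin a * C u x)"
    have g: "g \<in> V" "g u = h u" "h u \<noteq> Infty"
      unfolding g_def using scale_mem[OF basisD(1)[OF b u]] basisD(2)[OF b u] hu Fin by auto
    then obtain k where k: "k \<in> V" "k u = Infty" "\<And>x. min (h x) (g x) \<le> k x"
      "\<And>x. h x \<noteq> g x \<Longrightarrow> k x = min (h x) (g x)"
      using elim[OF h(1) g(1), of u] by auto
    have gM: "g e = Infty" if "e \<in> M" "e \<noteq> u" for e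
      unfolding g_def using basisD(3)[OF b u that] by simp
    show ?thesis
    proof (intro bexI[OF _ k(1)] conjI ballI allI impI)
      fix e assume "e \<in> insert u R"
      then show "k e = Infty"
        using k(2) k(3)[of e] gM[of e] h(2)[of e] insert by (cases "e = u") auto
    next
      fix e assume e: "e \<in> M - insert u R"
      then have "h e = f e" "g e = Infty" using h(3)[of e] gM[of e] by auto
      then show "k e = f e" using k(3)[of e] k(4)[of e] by (cases "f e") auto
    next
      fix x assume x: "x \<notin> M"
      have "h x \<le> k x \<or> f u * C u x \<le> k x"
        using k(3)[of x] Fin by (auto simp: g_def min_def split: if_splits)
      then show "f x \<le> k x \<or> (\<exists>e\<in>insert u R. f e * C e x \<le> k x)"
        using h(4)[OF x] by (meson insert_iff order_trans)
    next
      fix x assume x: "x \<notin> M" "\<forall>e\<in>insert u R. f x < f e * C e x"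
      then have "h x = f x" "f x < g x" using h(5)[of x] Fin by (auto simp: g_def)
      then show "k x = f x" using k(4)[of x] by (auto simp: min_def)
    qed
  qed
qed

text \<open>Clearing all of \<open>M\<close> annihilates \<open>f\<close>; if \<open>f x\<close>
  were strictly below every \<open>f e * C e x\<close>, it would survive.\<close>

lemma basis_dominates:
  assumes b: "basis M C" and f: "f \<in> V" and x: "x \<notin> M" "f x \<noteq> Infty"
  shows "\<exists>e\<in>M. f e * C e x \<le> f x"
proof (rule ccontr)
  assume "\<not> ?thesis"
  then have lt: "\<forall>e\<in>M. f x < f e * C e x" by auto
  have "finite M" using basis_subset[OF b] finite_E finite_subset by blast
  with basis_eliminate[OF b f, of M] obtain h
    where "h \<in> V" "\<And>e. e \<in> M \<Longrightarrow> h e = Infty" "h x = f x"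
    using lt x(1) by auto
  with basisD(4)[OF b, of h x] x(2) show False by auto
qed

text \<open>In the form \<open>w e \<le> C e x + w x\<close> this says that \<open>e\<close> is a
  minimal term of its own circuit. For fixed \<open>M\<close> and \<open>C\<close> these conditions
  are linear inequalities in \<open>w\<close>, and \<open>same_ties\<close> compares which of them
  are equalities.\<close>

definition optimal :: "'a set \<Rightarrow> ('a \<Rightarrow> 'a \<Rightarrow> tropical) \<Rightarrow> ('a \<Rightarrow> real) \<Rightarrow> bool" where
  "optimal M C w \<longleftrightarrow> (\<forall>e\<in>M. \<forall>x. Fin (w e - w x) \<le> C e x)"

definition same_ties ::
    "'a set \<Rightarrow> ('a \<Rightarrow> 'a \<Rightarrow> tropical) \<Rightarrow> ('a \<Rightarrow> real) \<Rightarrow> ('a \<Rightarrow> real) \<Rightarrow> bool" where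
  "same_ties M C w v \<longleftrightarrow>
     (\<forall>e\<in>M. \<forall>x. C e x = Fin (w e - w x) \<longleftrightarrow> C e x = Fin (v e - v x))"

text \<open>On \<open>A\<close> one has \<open>f x + v x = v x - w x\<close>, which need not be
  constant, so \<open>A\<close> is cut into the pieces where this difference is some
  \<open>c\<close>. Each piece is an initial set for \<open>v\<close>, and \<open>A\<close> is their
  finite union.\<close>

lemma initial_sets_subset_of_same_ties:
  assumes b: "basis M C" and w: "optimal M C w" and v: "optimal M C v" and s: "same_ties M C w v"
  shows "initial_sets V w \<subseteq> initial_sets V v"
proof
  fix A assume "A \<in> initial_sets V w"
  then obtain f where f: "f \<in> V" "\<And>x. Fin (- w x) \<le> f x" and A: "A = {x. f x = Fin (- w x)}"
    by (rule initial_setsE) blast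
  have wC: "Fin (w e - w x) \<le> C e x" and vC: "Fin (v e - v x) \<le> C e x"
    and tie: "C e x = Fin (w e - w x) \<longleftrightarrow> C e x = Fin (v e - v x)" if "e \<in> M" for e x
    using that w v s by (auto simp: optimal_def same_ties_def)
  have finM: "finite M" using basis_subset[OF b] finite_E finite_subset by blast
  have "finite A" by (rule finite_subset[OF _ finite_support[OF f(1)]]) (auto simp: A)
  have part: "{x \<in> A. v x - w x = c} \<in> initial_sets V v" for c
  proof -
    \<comment> \<open>Clearing \<open>R\<close> leaves on \<open>M\<close> exactly the elements of
      the wanted piece. By \<open>basis_dominates\<close> the values on \<open>M\<close> then
      control the whole vector \<open>h\<close>.\<close>
    define R where "R = {e \<in> M. \<not> (e \<in> A \<and> v e - w e = c)}"
    have fR: "finite R" "R \<subseteq> M" using finM by (auto simp: R_def)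
    obtain h where h: "h \<in> V" "\<And>e. e \<in> R \<Longrightarrow> h e = Infty" "\<And>e. e \<in> M - R \<Longrightarrow> h e = f e"
      "\<And>x. x \<notin> M \<Longrightarrow> f x \<le> h x \<or> (\<exists>e\<in>R. f e * C e x \<le> h x)"
      "\<And>x. x \<notin> M \<Longrightarrow> (\<forall>e\<in>R. f x < f e * C e x) \<Longrightarrow> h x = f x"
      using basis_eliminate[OF b f(1) fR] by auto
    have hM: "h e = Fin (c - v e)" if "e \<in> M - R" for e
      using h(3)[OF that] that by (auto simp: R_def A)
    \<comment> \<open>A tie between \<open>e\<close> and \<open>x\<close> for \<open>w\<close> would
      also be a tie for \<open>v\<close>, so \<open>v - w\<close> would agree at \<open>e\<close>
      and \<open>x\<close> and \<open>e\<close> would belong to the piece. Hence the circuits used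
      for clearing never reach the level of \<open>f\<close> on the piece.\<close>
    have strict: "Fin (- w x) < f e * C e x" if "e \<in> R" "v x - w x = c" for e x
    proof (rule ccontr)
      assume n: "\<not> Fin (- w x) < f e * C e x"
      have e: "e \<in> M" using that by (auto simp: R_def)
      have "Fin (- w e + (w e - w x)) \<le> f e * C e x"
        by (intro tropical_Fin_add_le_times f wC e)
      with n have eq: "f e * C e x = Fin (- w e + (w e - w x))" by auto
      from tropical_times_eq_Fin_add[OF f(2) wC[OF e] eq]
      have "f e = Fin (- w e)" "C e x = Fin (w e - w x)" by auto
      with tie[OF e, of x] that show False by (auto simp: R_def A)
    qed
    have main: "Fin (c - v x) \<le> h x \<and> (h x = Fin (c - v x) \<longleftrightarrow> x \<in> A \<and> v x - w x = c)" for x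
    proof (cases "x \<in> M")
      case True
      then show ?thesis using hM[of x] h(2)[of x] by (cases "x \<in> R") (auto simp: R_def)
    next
      case False
      have "Fin (c - v x) \<le> h x \<and> (h x = Fin (c - v x) \<longrightarrow> x \<in> A \<and> v x - w x = c)"
      proof (cases "h x = Infty")
        case True then show ?thesis by auto
      next
        case fin: False
        obtain e where e: "e \<in> M" "h e * C e x \<le> h x"
          using basis_dominates[OF b h(1) False fin] by auto
        have "e \<notin> R" using e h(2)[of e] fin by auto
        with e have he: "h e = Fin (c - v e)" using hM by auto
        have le: "Fin ((c - v e) + (v e - v x)) \<le> h e * C e x"
          by (intro tropical_Fin_add_le_times vC e) (simp add: he)
        then have 1: "Fin (c - v x) \<le> h x" using e(2) by simp
        moreover have "x \<in> A \<and> v x - w x = c" if hx: "h x = Fin (c - v x)"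
        proof -
          have "h e * C e x = Fin ((c - v e) + (v e - v x))"
            using le e(2) hx by simp
          then have "C e x = Fin (v e - v x)"
            using tropical_times_eq_Fin_add(2)[OF _ vC[OF e(1)]] he by (metis order_refl)
          with tie[OF e(1), of x] \<open>e \<notin> R\<close> e(1) have d: "v x - w x = c" by (auto simp: R_def)
          have hx': "h x = Fin (- w x)" using hx d by (simp add: algebra_simps)
          have "f x = Fin (- w x)"
            using h(4)[OF False] strict[OF _ d] f(2)[of x] by (metis hx' antisym leD)
          then show ?thesis using d by (simp add: A)
        qed
        ultimately show ?thesis by auto
      qed
      moreover have "h x = Fin (c - v x)" if "x \<in> A" "v x - w x = c"
        using h(5)[OF False] strict[OF _ that(2)] that by (auto simp: A)
      ultimately show ?thesis by blast
    qed
    have "{x. h x = Fin (c - v x)} \<in> initial_sets V v"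
      using main by (intro initial_sets_level h) auto
    moreover have "{x. h x = Fin (c - v x)} = {x \<in> A. v x - w x = c}"
      using main by blast
    ultimately show ?thesis by simp
  qed
  have "(\<Union>c\<in>(\<lambda>x. v x - w x) ` A. {x \<in> A. v x - w x = c}) \<in> initial_sets V v"
    using \<open>finite A\<close> part by (intro initial_sets_UN) auto
  moreover have "(\<Union>c\<in>(\<lambda>x. v x - w x) ` A. {x \<in> A. v x - w x = c}) = A" by auto
  ultimately show "A \<in> initial_sets V v" by simp
qed

text \<open>A minimal term \<open>x\<close> outside \<open>M\<close> is dominated by some
  \<open>f e * C e x\<close>; optimality turns the inequalities into equalities, so \<open>e\<close>
  is a minimal term as well.\<close>

lemma initial_sets_meet_basis:
  assumes b: "basis M C" and w: "optimal M C w" and A: "A \<in> initial_sets V w" "A \<inter> M = {}"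
  shows "A = {}"
proof (rule ccontr)
  assume "A \<noteq> {}"
  then obtain x where x: "x \<in> A" by auto
  obtain f where f: "f \<in> V" "\<And>x. Fin (- w x) \<le> f x" "A = {x. f x = Fin (- w x)}"
    using A(1) by (rule initial_setsE) blast
  have fx: "f x = Fin (- w x)" "x \<notin> M" using x A(2) f(3) by auto
  then obtain e where e: "e \<in> M" "f e * C e x \<le> f x"
    using basis_dominates[OF b f(1), of x] by auto
  have "Fin (- w e + (w e - w x)) \<le> f e * C e x"
    using w e(1) by (intro tropical_Fin_add_le_times f) (auto simp: optimal_def)
  then have "f e * C e x = Fin (- w e + (w e - w x))" using e fx by auto
  then have "f e = Fin (- w e)"
    using tropical_times_eq_Fin_add(1)[OF f(2), of "w e - w x" "C e x" e] w e(1)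
    by (auto simp: optimal_def)
  then show False using A(2) e(1) f(3) by auto
qed

lemma same_ties_of_initial_sets_eq:
  assumes b: "basis M C" and w: "optimal M C w" and eq: "initial_sets V w = initial_sets V v"
  shows "optimal M C v" "same_ties M C w v"
proof -
  \<comment> \<open>The initial set of \<open>C e\<close> for \<open>v\<close> is also one for
    \<open>w\<close>, so it meets \<open>M\<close>. The support of \<open>C e\<close> meets
    \<open>M\<close> only in \<open>e\<close>, so \<open>e\<close> is a minimal term and the level
    is \<open>v e\<close>.\<close>
  have opt: "Fin (v e - v x) \<le> C e x" if e: "e \<in> M" for e x
  proof -
    obtain A c where A: "A \<in> initial_sets V v" "A \<noteq> {}" "A = {x. C e x = Fin (c - v x)}"
      "\<And>x. Fin (c - v x) \<le> C e x"
      by (rule initial_set_through[OF basisD(1)[OF b e] finite_support[OF basisD(1)[OF b e]], of e v])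
        (use basisD(2)[OF b e] in auto)
    then obtain e' where "e' \<in> A" "e' \<in> M"
      using initial_sets_meet_basis[OF b w, of A] eq by auto
    then have "e \<in> A" using basisD(3)[OF b e] A(3) by fastforce
    then have "c = v e" using A(3) basisD(2)[OF b e] by auto
    with A(4) show ?thesis by auto
  qed
  then show "optimal M C v" by (auto simp: optimal_def)
  show "same_ties M C w v"
    unfolding same_ties_def
  proof (intro ballI allI)
    fix e x assume e: "e \<in> M"
    have "{x. C e x = Fin (v e - v x)} \<in> initial_sets V w"
      unfolding eq using opt[OF e] by (intro initial_sets_level basisD(1)[OF b e])
    then obtain f' where f': "f' \<in> V" "\<And>x. Fin (- w x) \<le> f' x"
      "{x. C e x = Fin (v e - v x)} = {x. f' x = Fin (- w x)}"
      by (rule initial_setsE) blast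
    define f where "f = (\<lambda>x. Fin (w e) * f' x)"
    have f: "f \<in> V" "\<And>x. Fin (w e - w x) \<le> f x"
      "\<And>x. f x = Fin (w e - w x) \<longleftrightarrow> C e x = Fin (v e - v x)"
      using f' by (auto simp: f_def scale_mem tropical_Fin_le_Fin_times tropical_Fin_times_eq_Fin
        set_eq_iff)
    have C: "Fin (w e - w x) \<le> C e x" for x using w e by (auto simp: optimal_def)
    have "f e = Fin 0" using f(3)[of e] basisD(2)[OF b e] by simp
    then obtain h where h: "h \<in> V" "h e = Infty" "\<And>x. min (f x) (C e x) \<le> h x"
      "\<And>x. f x \<noteq> C e x \<Longrightarrow> h x = min (f x) (C e x)"
      using elim[OF f(1) basisD(1)[OF b e], of e] basisD(2)[OF b e] by auto
    \<comment> \<open>Here \<open>f\<close> realises for \<open>w\<close> the ties of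
      \<open>C e\<close> for \<open>v\<close>. If \<open>f\<close> and \<open>C e\<close> had
      different minimal terms for \<open>w\<close>, the vector \<open>h\<close> would keep one of
      them; but its terms at that level avoid \<open>M\<close>, so there are none.\<close>
    let ?A = "{x. h x = Fin (w e - w x)}"
    have "?A \<in> initial_sets V w"
      using h(3) f(2) C by (intro initial_sets_level h(1)) (meson min.boundedI order_trans)
    moreover have "?A \<inter> M = {}"
    proof (intro equals0I)
      fix e' assume e': "e' \<in> ?A \<inter> M"
      then have ne: "e' \<noteq> e" using h(2) by auto
      then have inf: "C e e' = Infty" using basisD(3)[OF b e, of e'] e' by auto
      then have "f e' = Fin (w e - w e')"
        using e' h(3)[of e'] f(2)[of e'] by (auto intro: antisym)
      then show False using f(3)[of e'] inf by auto
    qed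
    ultimately have empty: "?A = {}" by (rule initial_sets_meet_basis[OF b w])
    have "f x = Fin (w e - w x) \<longleftrightarrow> C e x = Fin (w e - w x)"
    proof -
      have "h x \<noteq> Fin (w e - w x)" using empty by auto
      then show ?thesis
        using h(4)[of x] f(2)[of x] C[of x] by (metis min_absorb1 min_absorb2)
    qed
    then show "C e x = Fin (w e - w x) \<longleftrightarrow> C e x = Fin (v e - v x)" using f(3) by simp
  qed
qed

end

section \<open>Complexes from partitions by tight inequalities\<close>

definition ineq_polyhedron :: "'v::euclidean_space set \<Rightarrow> ('v \<times> real) set \<Rightarrow> 'v set" where
  "ineq_polyhedron X J = {x \<in> X. \<forall>(a, b)\<in>J. a \<bullet> x \<le> b}"

definition tight :: "('v::euclidean_space \<times> real) set \<Rightarrow> 'v \<Rightarrow> ('v \<times> real) set" where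
  "tight J x = {(a, b) \<in> J. a \<bullet> x = b}"

definition tight_face :: "'v::euclidean_space set \<Rightarrow> ('v \<times> real) set \<Rightarrow> 'v \<Rightarrow> 'v set" where
  "tight_face X J x = {y \<in> ineq_polyhedron X J. tight J x \<subseteq> tight J y}"

lemma ineq_polyhedron_altdef: "ineq_polyhedron X J = X \<inter> (\<Inter>(a, b)\<in>J. {x. a \<bullet> x \<le> b})"
  by (auto simp: ineq_polyhedron_def)

lemma polyhedron_ineq_polyhedron:
  assumes "finite J" "polyhedron X"
  shows "polyhedron (ineq_polyhedron X J)"
  unfolding ineq_polyhedron_altdef using assms
  by (intro polyhedron_Int polyhedron_Inter) (auto simp: polyhedron_halfspace_le)

text \<open>Reversing the inequalities tight at \<open>x\<close> turns them into equations, so a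
  face is again given by a finite system whose normals are those of \<open>J\<close> up to sign.
  This yields rationality of the faces.\<close>

lemma tight_face_altdef:
  "tight_face X J x =
     ineq_polyhedron X (J \<union> (\<lambda>(a, b). (- a, - b)) ` tight J x)" (is "_ = ?Q")
proof (intro set_eqI iffI)
  fix y assume "y \<in> tight_face X J x"
  then have "y \<in> ineq_polyhedron X J" "\<And>a b. (a, b) \<in> tight J x \<Longrightarrow> a \<bullet> y = b"
    by (auto simp: tight_face_def tight_def)
  then show "y \<in> ?Q" by (auto simp: ineq_polyhedron_def)
next
  fix y assume "y \<in> ?Q"
  then have "y \<in> ineq_polyhedron X J" and "\<forall>(a, b)\<in>tight J x. (- a) \<bullet> y \<le> - b"
    by (auto simp: ineq_polyhedron_def ball_Un)
  then have "y \<in> ineq_polyhedron X J" "\<And>a b. (a, b) \<in> tight J x \<Longrightarrow> b \<le> a \<bullet> y"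
    by auto
  then show "y \<in> tight_face X J x"
    by (auto simp: tight_face_def tight_def ineq_polyhedron_def intro!: antisym)
qed

text \<open>Each inequality in \<open>T\<close> cuts out a face by a supporting hyperplane. The
  polyhedron itself is put into the intersection to cover the case of empty
  \<open>T\<close>.\<close>

lemma tight_subset_face_of:
  assumes "convex X" "T \<subseteq> J"
  shows "{y \<in> ineq_polyhedron X J. T \<subseteq> tight J y} face_of ineq_polyhedron X J"
proof -
  let ?P = "ineq_polyhedron X J"
  have conv: "convex ?P" unfolding ineq_polyhedron_altdef using assms(1)
    by (intro convex_Int convex_INT) (auto simp: convex_halfspace_le)
  have "{y \<in> ?P. T \<subseteq> tight J y} = \<Inter>(insert ?P ((\<lambda>(a, b). ?P \<inter> {y. a \<bullet> y = b}) ` T))"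
    using assms(2) by (auto simp: tight_def subset_iff)
  also have "\<dots> face_of ?P"
    using conv assms(2) by (intro face_of_Inter)
      (auto intro!: face_of_refl face_of_Int_supporting_hyperplane_le simp: ineq_polyhedron_def)
  finally show ?thesis .
qed

lemma tight_face_face_of:
  assumes "convex X"
  shows "tight_face X J x face_of ineq_polyhedron X J"
  unfolding tight_face_def by (rule tight_subset_face_of[OF assms]) (auto simp: tight_def)

lemma self_in_tight_face: "x \<in> ineq_polyhedron X J \<Longrightarrow> x \<in> tight_face X J x"
  by (auto simp: tight_face_def)

text \<open>A segment from any \<open>y\<close> of the face to \<open>x\<close> can be prolonged a
  little beyond \<open>x\<close>: inequalities tight at \<open>x\<close> are constant along it, and
  the finitely many others have positive slack.\<close>

lemma mem_rel_interior_tight_face: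
  assumes J: "finite J" and X: "subspace X" and x: "x \<in> ineq_polyhedron X J"
  shows "x \<in> rel_interior (tight_face X J x)"
proof -
  let ?F = "tight_face X J x"
  have conv: "convex ?F"
    using face_of_imp_convex[OF tight_face_face_of[OF subspace_imp_convex[OF X]]] .
  have "\<exists>e>1. (1 - e) *\<^sub>R y + e *\<^sub>R x \<in> ?F" if y: "y \<in> ?F" for y
  proof -
    have "\<exists>r>0. \<forall>s. 0 \<le> s \<and> s \<le> r \<longrightarrow> fst p \<bullet> x + s * (fst p \<bullet> x - fst p \<bullet> y) \<le> snd p"
      if p: "p \<in> J" for p
    proof (cases "p \<in> tight J x")
      case True
      then have "p \<in> tight J y" using y by (auto simp: tight_face_def)
      with True show ?thesis by (intro exI[of _ 1]) (auto simp: tight_def)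
    next
      case False
      \<comment> \<open>The step length \<open>g / h\<close> is the slack divided by a bound for the
        growth rate; the summand 1 makes \<open>h\<close> positive.\<close>
      define g where "g = snd p - fst p \<bullet> x"
      define h where "h = \<bar>fst p \<bullet> x - fst p \<bullet> y\<bar> + 1"
      have "fst p \<bullet> x \<le> snd p" "fst p \<bullet> x \<noteq> snd p"
        using False p x by (auto simp: tight_def ineq_polyhedron_def case_prod_beta)
      then have g: "g > 0" by (simp add: g_def)
      have h: "h > 0" "fst p \<bullet> x - fst p \<bullet> y \<le> h" by (auto simp: h_def)
      have "fst p \<bullet> x + s * (fst p \<bullet> x - fst p \<bullet> y) \<le> snd p" if "0 \<le> s" "s \<le> g / h" for s
      proof -
        have "s * (fst p \<bullet> x - fst p \<bullet> y) \<le> s * h" using that h by (intro mult_left_mono)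
        also have "\<dots> \<le> g" using that h by (simp add: pos_le_divide_eq)
        finally show ?thesis by (simp add: g_def)
      qed
      then show ?thesis using g h by (intro exI[of _ "g / h"]) auto
    qed
    then obtain r where r: "\<And>p. p \<in> J \<Longrightarrow> r p > 0"
      "\<And>p s. p \<in> J \<Longrightarrow> 0 \<le> s \<Longrightarrow> s \<le> r p \<Longrightarrow>
        fst p \<bullet> x + s * (fst p \<bullet> x - fst p \<bullet> y) \<le> snd p"
      by metis
    define s where "s = Min (insert 1 (r ` J))"
    have s: "s > 0" "\<And>p. p \<in> J \<Longrightarrow> s \<le> r p"
      using J r(1) by (auto simp: s_def)
    let ?z = "(1 - (1 + s)) *\<^sub>R y + (1 + s) *\<^sub>R x"
    have z: "a \<bullet> ?z = a \<bullet> x + s * (a \<bullet> x - a \<bullet> y)" for a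
      by (simp add: inner_simps algebra_simps)
    have "?z \<in> X"
      using x y X by (intro subspace_add subspace_scale)
        (auto simp: tight_face_def ineq_polyhedron_def)
    moreover have "a \<bullet> ?z \<le> b" if "(a, b) \<in> J" for a b
      unfolding z using r(2)[OF that, of s] s(1) s(2)[OF that] by simp
    moreover have "tight J x \<subseteq> tight J ?z"
    proof
      fix p assume p: "p \<in> tight J x"
      moreover from this have "p \<in> tight J y" using y by (auto simp: tight_face_def)
      ultimately show "p \<in> tight J ?z" 
        by (simp add: tight_def case_prod_beta inner_simps algebra_simps)
    qed
    ultimately have "?z \<in> ?F" by (auto simp: tight_face_def ineq_polyhedron_def)
    then show ?thesis using s(1) by (intro exI[of _ "1 + s"]) auto
  qed
  then show ?thesis
    using convex_rel_interior_iff[OF conv] self_in_tight_face[OF x] by blast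
qed

text \<open>Two faces of one convex set whose relative interiors meet are equal, so \<open>y\<close>
  in the relative interior of the tight face of \<open>x\<close> has the same tight face, hence the
  same tight inequalities.\<close>

lemma rel_interior_tight_face:
  assumes J: "finite J" and X: "subspace X" and x: "x \<in> ineq_polyhedron X J"
  shows "rel_interior (tight_face X J x) = {y \<in> ineq_polyhedron X J. tight J y = tight J x}"
proof (intro set_eqI iffI)
  fix y assume y: "y \<in> rel_interior (tight_face X J x)"
  then have yP: "y \<in> ineq_polyhedron X J"
    using rel_interior_subset by (auto simp: tight_face_def)
  have "tight_face X J x = tight_face X J y"
    using y mem_rel_interior_tight_face[OF J X yP]
    by (intro face_of_eq[of _ "ineq_polyhedron X J"]
      tight_face_face_of[OF subspace_imp_convex[OF X]]) blast
  then have "y \<in> tight_face X J x" "x \<in> tight_face X J y"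
    using self_in_tight_face x yP by blast+
  then show "y \<in> {y \<in> ineq_polyhedron X J. tight J y = tight J x}"
    by (auto simp: tight_face_def)
next
  fix y assume "y \<in> {y \<in> ineq_polyhedron X J. tight J y = tight J x}"
  then have "y \<in> ineq_polyhedron X J" "tight_face X J x = tight_face X J y"
    by (auto simp: tight_face_def)
  then show "y \<in> rel_interior (tight_face X J x)"
    using mem_rel_interior_tight_face[OF J X] by auto
qed

lemma face_of_ineq_polyhedron_eq_tight_face:
  assumes J: "finite J" and X: "subspace X" and F: "F face_of ineq_polyhedron X J" "F \<noteq> {}"
  obtains x where "x \<in> F" "x \<in> ineq_polyhedron X J" "F = tight_face X J x"
proof -
  obtain x where x: "x \<in> rel_interior F"
    using F face_of_imp_convex rel_interior_eq_empty by blast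
  then have xF: "x \<in> F" using rel_interior_subset by blast
  then have xP: "x \<in> ineq_polyhedron X J" using F(1) face_of_imp_subset by blast
  have "F = tight_face X J x"
    using x mem_rel_interior_tight_face[OF J X xP]
    by (intro face_of_eq[OF F(1)] tight_face_face_of[OF subspace_imp_convex[OF X]]) blast
  with that xF xP show ?thesis by blast
qed

text \<open>The closed cell containing \<open>x\<close> in its relative interior is the closure of the equivalence
  class of \<open>x\<close>, so it does not depend on the system \<open>J\<close> used to cut it out.\<close>

locale tight_partition =
  fixes X :: "(real ^ 'n) set" and \<J> :: "((real ^ 'n) \<times> real) set set"
    and R :: "real ^ 'n \<Rightarrow> real ^ 'n \<Rightarrow> bool"
  assumes subspace: "subspace X"
    and finite_systems: "finite \<J>" "J \<in> \<J> \<Longrightarrow> finite J"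
    and cover: "x \<in> X \<Longrightarrow> \<exists>J\<in>\<J>. x \<in> ineq_polyhedron X J"
    and class_iff: "J \<in> \<J> \<Longrightarrow> x \<in> ineq_polyhedron X J \<Longrightarrow> y \<in> X \<Longrightarrow>
      R x y \<longleftrightarrow> y \<in> ineq_polyhedron X J \<and> tight J y = tight J x"
begin

definition faces :: "(real ^ 'n) set set" where
  "faces = {F. F \<noteq> {} \<and> (\<exists>J\<in>\<J>. F face_of ineq_polyhedron X J)}"

lemma polyhedron_X: "polyhedron X"
  by (simp add: affine_imp_polyhedron subspace subspace_imp_affine)

lemma polyhedron_ineq: "J \<in> \<J> \<Longrightarrow> polyhedron (ineq_polyhedron X J)"
  using finite_systems polyhedron_X by (intro polyhedron_ineq_polyhedron)

lemma facesE:
  assumes "F \<in> faces"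
  obtains J x where "J \<in> \<J>" "x \<in> F" "x \<in> ineq_polyhedron X J" "F = tight_face X J x"
proof -
  obtain J where J: "J \<in> \<J>" "F face_of ineq_polyhedron X J" "F \<noteq> {}"
    using assms by (auto simp: faces_def)
  from face_of_ineq_polyhedron_eq_tight_face[OF finite_systems(2)[OF J(1)] subspace J(2,3)] J(1)
  show ?thesis using that by blast
qed

lemma tight_face_in_faces:
  "J \<in> \<J> \<Longrightarrow> x \<in> ineq_polyhedron X J \<Longrightarrow> tight_face X J x \<in> faces"
  unfolding faces_def
  using self_in_tight_face tight_face_face_of[OF subspace_imp_convex[OF subspace]] by blast

lemma rel_interior_eq_class:
  assumes "J \<in> \<J>" "x \<in> ineq_polyhedron X J"
  shows "rel_interior (tight_face X J x) = {y \<in> X. R x y}"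
  unfolding rel_interior_tight_face[OF finite_systems(2)[OF assms(1)] subspace assms(2)]
  using class_iff[OF assms] by (auto simp: ineq_polyhedron_def)

lemma tight_face_eq_closure:
  assumes "J \<in> \<J>" "x \<in> ineq_polyhedron X J"
  shows "tight_face X J x = closure {y \<in> X. R x y}"
proof -
  have "tight_face X J x face_of ineq_polyhedron X J"
    using tight_face_face_of[OF subspace_imp_convex[OF subspace]] .
  then have "polyhedron (tight_face X J x)"
    using face_of_polyhedron_polyhedron polyhedron_ineq[OF assms(1)] by blast
  then have "closed (tight_face X J x)" "convex (tight_face X J x)"
    by (simp_all add: polyhedron_imp_closed polyhedron_imp_convex)
  then show ?thesis
    using convex_closure_rel_interior[of "tight_face X J x"]
    by (simp add: rel_interior_eq_class[OF assms])
qed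

text \<open>Two faces, possibly from different systems, meet in the tight face of any relative
  interior point \<open>z\<close> of their intersection. By symmetry it suffices to treat one
  side.\<close>

lemma polyhedral_complex_faces: "polyhedral_complex faces"
  unfolding polyhedral_complex_def
proof (intro conjI ballI allI impI)
  fix P assume "P \<in> faces"
  then obtain J where "J \<in> \<J>" "P face_of ineq_polyhedron X J" by (auto simp: faces_def)
  then show "polyhedron P" using face_of_polyhedron_polyhedron polyhedron_ineq by blast
next
  fix P F assume F: "P \<in> faces" "F face_of P \<and> F \<noteq> {}"
  then obtain J where "J \<in> \<J>" "P face_of ineq_polyhedron X J" by (auto simp: faces_def)
  with F show "F \<in> faces" unfolding faces_def using face_of_trans by blast
next
  have key: "P \<inter> Q face_of P" if PQ: "P \<in> faces" "Q \<in> faces" "P \<inter> Q \<noteq> {}" for P Q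
  proof -
    obtain J p where J: "J \<in> \<J>" "p \<in> ineq_polyhedron X J" "P = tight_face X J p"
      using PQ(1) by (rule facesE)
    obtain K q where K: "K \<in> \<J>" "q \<in> ineq_polyhedron X K" "Q = tight_face X K q"
      using PQ(2) by (rule facesE)
    have face: "tight_face X J x face_of ineq_polyhedron X J" for J and x :: "real ^ 'n"
      using tight_face_face_of[OF subspace_imp_convex[OF subspace]] .
    have conv: "convex (P \<inter> Q)"
      unfolding J(3) K(3) by (intro convex_Int face_of_imp_convex[OF face])
    then obtain z where z: "z \<in> rel_interior (P \<inter> Q)"
      using PQ(3) rel_interior_eq_empty by blast
    then have zPQ: "z \<in> P" "z \<in> Q" using rel_interior_subset by blast+
    then have zJ: "z \<in> ineq_polyhedron X J" "tight J p \<subseteq> tight J z"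
      and zK: "z \<in> ineq_polyhedron X K" "tight K q \<subseteq> tight K z"
      using J(3) K(3) by (auto simp: tight_face_def)
    have sub: "tight_face X J z \<subseteq> P" "tight_face X K z \<subseteq> Q"
      using zJ zK by (auto simp: tight_face_def J(3) K(3))
    \<comment> \<open>Both sides are the closure of the class of \<open>z\<close>, so the two
      systems give the same set.\<close>
    have eq: "tight_face X J z = tight_face X K z"
      unfolding tight_face_eq_closure[OF J(1) zJ(1)] tight_face_eq_closure[OF K(1) zK(1)] ..
    \<comment> \<open>The segment from \<open>y\<close> to \<open>z\<close> continues inside
      \<open>P \<inter> Q\<close>. An inequality tight at \<open>z\<close> holds on both sides of
      \<open>z\<close>, so it is tight at \<open>y\<close>.\<close>
    have "P \<inter> Q \<subseteq> tight_face X J z"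
    proof
      fix y assume y: "y \<in> P \<inter> Q"
      then obtain e where e: "e > 1" "(1 - e) *\<^sub>R y + e *\<^sub>R z \<in> P \<inter> Q"
        using z convex_rel_interior_iff[OF conv] PQ(3) by blast
      let ?u = "(1 - e) *\<^sub>R y + e *\<^sub>R z"
      have yP: "y \<in> ineq_polyhedron X J" and uP: "?u \<in> ineq_polyhedron X J"
        using y e J(3) by (auto simp: tight_face_def)
      have "tight J z \<subseteq> tight J y"
      proof clarify
        fix a b assume ab: "(a, b) \<in> tight J z"
        then have "a \<bullet> y \<le> b" "a \<bullet> ?u \<le> b" "a \<bullet> z = b"
          using yP uP by (auto simp: tight_def ineq_polyhedron_def)
        then have "(1 - e) * (a \<bullet> y) + e * b \<le> b" by (simp add: inner_simps)
        then have "(1 - e) * (a \<bullet> y - b) \<le> 0" by (simp add: algebra_simps)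
        then have "b \<le> a \<bullet> y" using e(1) by (simp add: mult_le_0_iff)
        then show "(a, b) \<in> tight J y" using ab \<open>a \<bullet> y \<le> b\<close> by (auto simp: tight_def)
      qed
      then show "y \<in> tight_face X J z" using yP by (auto simp: tight_face_def)
    qed
    with sub eq have "P \<inter> Q = tight_face X J z" by blast
    moreover have "tight_face X J z face_of P"
      by (rule face_of_subset[OF face sub(1)]) (use face_of_imp_subset[OF face] J(3) in simp)
    ultimately show ?thesis by simp
  qed
  show "P \<inter> Q face_of P" "P \<inter> Q face_of Q"
    if "P \<in> faces" "Q \<in> faces" "P \<inter> Q \<noteq> {}" for P Q
    using key[of P Q] key[of Q P] that by (simp_all add: Int_commute)
qed

lemma finite_faces: "finite faces"
proof -
  have "faces \<subseteq> (\<Union>J\<in>\<J>. {F. F face_of ineq_polyhedron X J})" by (auto simp: faces_def)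
  then show ?thesis
    using finite_systems(1) finite_polyhedron_faces[OF polyhedron_ineq]
    by (auto intro: finite_subset)
qed

lemma faces_subset: "F \<in> faces \<Longrightarrow> F \<subseteq> X"
  using face_of_imp_subset by (fastforce simp: faces_def ineq_polyhedron_def)

lemma Union_faces: "\<Union>faces = X"
proof
  show "X \<subseteq> \<Union>faces" using cover tight_face_in_faces self_in_tight_face by blast
qed (use faces_subset in blast)

lemma same_rel_interior_iff:
  assumes x: "x \<in> X" and y: "y \<in> X"
  shows "(\<exists>F\<in>faces. x \<in> rel_interior F \<and> y \<in> rel_interior F) \<longleftrightarrow> R x y"
proof
  assume "\<exists>F\<in>faces. x \<in> rel_interior F \<and> y \<in> rel_interior F"
  then obtain F where F: "F \<in> faces" "x \<in> rel_interior F" "y \<in> rel_interior F" by blast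
  obtain J z where J: "J \<in> \<J>" "z \<in> ineq_polyhedron X J" "F = tight_face X J z"
    using F(1) by (rule facesE)
  have "x \<in> ineq_polyhedron X J" "tight J x = tight J z"
    "y \<in> ineq_polyhedron X J" "tight J y = tight J z"
    using F(2,3) rel_interior_tight_face[OF finite_systems(2)[OF J(1)] subspace J(2)]
    by (auto simp: J(3))
  then show "R x y" using class_iff[OF J(1), of x y] y by simp
next
  assume R: "R x y"
  obtain J where J: "J \<in> \<J>" "x \<in> ineq_polyhedron X J" using cover[OF x] by blast
  \<comment> \<open>Reflexivity is not an axiom of the locale; \<open>class_iff\<close> with
    \<open>y = x\<close> provides it.\<close>
  have "R x x" using class_iff[OF J x] J by simp
  then have "x \<in> rel_interior (tight_face X J x)" "y \<in> rel_interior (tight_face X J x)"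
    using R x y by (simp_all add: rel_interior_eq_class[OF J])
  then show "\<exists>F\<in>faces. x \<in> rel_interior F \<and> y \<in> rel_interior F"
    using tight_face_in_faces[OF J] by blast
qed

end

lemma R_rational_polyhedron_ineq_polyhedron:
  assumes "finite J" "\<And>a b i. (a, b) \<in> J \<Longrightarrow> a $ i \<in> \<rat>"
  shows "R_rational_polyhedron \<sigma> (ineq_polyhedron (coord_subspace \<sigma>) J)"
proof -
  obtain m and p :: "nat \<Rightarrow> (real ^ 'a) \<times> real" where p: "J = p ` {i. i < m}"
    using finite_imp_nat_seg_image_inj_on[OF assms(1)] by metis
  have 1: "\<forall>k<m. \<forall>i. fst (p k) $ i \<in> \<rat>"
  proof (intro allI impI)
    fix k i assume "k < m"
    then have "(fst (p k), snd (p k)) \<in> J" using p by simp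
    then show "fst (p k) $ i \<in> \<rat>" by (rule assms(2))
  qed
  have 2: "ineq_polyhedron (coord_subspace \<sigma>) J =
      {x \<in> coord_subspace \<sigma>. \<forall>k<m. fst (p k) \<bullet> x \<le> snd (p k)}"
    unfolding ineq_polyhedron_def p case_prod_beta by simp
  show ?thesis
    unfolding R_rational_polyhedron_def
    by (intro exI[of _ m] exI[of _ "\<lambda>k. fst (p k)"] exI[of _ "\<lambda>k. snd (p k)"] conjI 1 2)
qed

lemma R_rational_polyhedron_tight_face:
  assumes "finite J" "\<And>a b i. (a, b) \<in> J \<Longrightarrow> a $ i \<in> \<rat>"
  shows "R_rational_polyhedron \<sigma> (tight_face (coord_subspace \<sigma>) J x)"
  unfolding tight_face_altdef
proof (rule R_rational_polyhedron_ineq_polyhedron)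
  have "finite (tight J x)"
    by (rule finite_subset[OF _ assms(1)]) (auto simp: tight_def)
  then show "finite (J \<union> (\<lambda>(a, b). (- a, - b)) ` tight J x)" using assms(1) by simp
next
  fix a :: "real ^ 'a" and b i assume "(a, b) \<in> J \<union> (\<lambda>(a, b). (- a, - b)) ` tight J x"
  then consider "(a, b) \<in> J" | "(- a, - b) \<in> J" by (auto simp: tight_def)
  then show "a $ i \<in> \<rat>"
  proof cases
    case 2
    then show ?thesis using assms(2)[of "- a" "- b" i] Rats_minus_iff by simp
  qed (rule assms(2))
qed

section \<open>Leading forms\<close>

text \<open>One vector serves two weights: \<open>e\<close> is a minimal term for both, the minimal
  terms are the same for both, and \<open>e\<close> is the least of them. With \<open>v = w\<close>
  this is an ordinary vector with leading element \<open>e\<close>, normalised to 0 there.\<close>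

definition leading_form ::
    "('a \<Rightarrow> 'a \<Rightarrow> bool) \<Rightarrow> ('a \<Rightarrow> real) \<Rightarrow> ('a \<Rightarrow> real) \<Rightarrow> 'a \<Rightarrow> ('a \<Rightarrow> tropical) \<Rightarrow> bool" where
  "leading_form prec w v e f \<longleftrightarrow> f e = Fin 0 \<and>
     (\<forall>x. Fin (w e - w x) \<le> f x) \<and> (\<forall>x. Fin (v e - v x) \<le> f x) \<and>
     (\<forall>x. f x = Fin (w e - w x) \<longleftrightarrow> f x = Fin (v e - v x)) \<and>
     (\<forall>x. f x = Fin (w e - w x) \<longrightarrow> x = e \<or> prec e x)"

lemma leading_formD:
  assumes "leading_form prec w v e f"
  shows "f e = Fin 0" "Fin (w e - w x) \<le> f x" "Fin (v e - v x) \<le> f x"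
    "f x = Fin (w e - w x) \<longleftrightarrow> f x = Fin (v e - v x)"
    "f x = Fin (w e - w x) \<Longrightarrow> x = e \<or> prec e x"
  using assms unfolding leading_form_def by iprover+

lemma leading_formI:
  assumes "f e = Fin 0" "\<And>x. Fin (w e - w x) \<le> f x" "\<And>x. Fin (v e - v x) \<le> f x"
    "\<And>x. f x = Fin (w e - w x) \<longleftrightarrow> f x = Fin (v e - v x)"
    "\<And>x. f x = Fin (w e - w x) \<Longrightarrow> x = e \<or> prec e x"
  shows "leading_form prec w v e f"
  using assms unfolding leading_form_def by iprover

definition leading_set ::
    "('a \<Rightarrow> 'a \<Rightarrow> bool) \<Rightarrow> ('a \<Rightarrow> tropical) set \<Rightarrow> ('a \<Rightarrow> real) \<Rightarrow> 'a set" where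
  "leading_set prec V w = {e. \<exists>A\<in>initial_sets V w. e \<in> A \<and> (\<forall>x\<in>A. x = e \<or> prec e x)}"

lemma ex_least_of_total:
  assumes "finite A" "A \<noteq> {}" "transp prec" "\<And>x y. x \<noteq> y \<Longrightarrow> prec x y \<or> prec y x"
  shows "\<exists>e\<in>A. \<forall>x\<in>A. x = e \<or> prec e x"
  using assms(1,2)
proof (induction A rule: finite_ne_induct)
  case (insert a A)
  then obtain e where e: "e \<in> A" "\<And>x. x \<in> A \<Longrightarrow> x = e \<or> prec e x" by blast
  show ?case
  proof (cases "prec e a")
    case True
    with e show ?thesis by blast
  next
    case False
    then have "a = e \<or> prec a e" using assms(4) by blast
    then show ?thesis using e(2) transpD[OF assms(3)] by (intro bexI[of _ a]) blast+
  qed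
qed auto

locale ordered_tropical_linear_space = tropical_linear_space V E
  for V :: "('a \<Rightarrow> tropical) set" and E :: "'a set" +
  fixes prec :: "'a \<Rightarrow> 'a \<Rightarrow> bool"
  assumes asym: "asymp prec" and trans: "transp prec"
    and total: "x \<noteq> y \<Longrightarrow> prec x y \<or> prec y x"
begin

text \<open>The multiple of \<open>g\<close> starts no lower than \<open>f\<close>, since its
  coefficient at \<open>u\<close> is that of \<open>f\<close>. If it reaches the minimal level at
  all, then \<open>u\<close> is a minimal term of \<open>f\<close>, so everything it contributes
  comes after \<open>u\<close> and hence after \<open>e\<close>. Ties for \<open>w\<close> and
  \<open>v\<close> agree in both summands and therefore in \<open>h\<close>.\<close>

lemma leading_form_eliminate:
  assumes f: "leading_form prec w v e f" and g: "leading_form prec w v u g"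
    and ue: "u \<noteq> e" and a: "f u = Fin a"
    and h: "h u = Infty" "\<And>x. min (f x) (Fin a * g x) \<le> h x"
      "\<And>x. f x \<noteq> Fin a * g x \<Longrightarrow> h x = min (f x) (Fin a * g x)"
  shows "leading_form prec w v e h"
proof -
  have fw: "Fin (w e - w x) \<le> f x" and fv: "Fin (v e - v x) \<le> f x" and fe: "f e = Fin 0"
    and fwv: "f x = Fin (w e - w x) \<longleftrightarrow> f x = Fin (v e - v x)"
    and fl: "f x = Fin (w e - w x) \<Longrightarrow> x = e \<or> prec e x" for x
    by (rule leading_formD[OF f])+
  have gw: "Fin (w u - w x) \<le> g x" and gv: "Fin (v u - v x) \<le> g x"
    and gwv: "g x = Fin (w u - w x) \<longleftrightarrow> g x = Fin (v u - v x)"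
    and gl: "g x = Fin (w u - w x) \<Longrightarrow> x = u \<or> prec u x" for x
    by (rule leading_formD[OF g])+
  have aw: "w e - w u \<le> a" and av: "v e - v u \<le> a" using fw[of u] fv[of u] a by auto
  have awv: "a = w e - w u \<longleftrightarrow> a = v e - v u" using fwv[of u] a by simp
  have al: "prec e u" if "a = w e - w u" using fl[of u] a that ue by auto
  define k where "k x = Fin a * g x" for x
  have kw: "Fin (w e - w x) \<le> k x" and kv: "Fin (v e - v x) \<le> k x" for x
    using gw[of x] gv[of x] aw av by (cases "g x"; simp add: k_def)+
  have kw_eq: "a = w e - w u \<and> g x = Fin (w u - w x)" if "k x = Fin (w e - w x)" for x
    using that gw[of x] aw by (cases "g x") (auto simp: k_def)
  have kv_eq: "a = v e - v u \<and> g x = Fin (v u - v x)" if "k x = Fin (v e - v x)" for x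
    using that gv[of x] av by (cases "g x") (auto simp: k_def)
  have kwv: "k x = Fin (w e - w x) \<longleftrightarrow> k x = Fin (v e - v x)" for x
  proof
    assume "k x = Fin (w e - w x)"
    from kw_eq[OF this] awv gwv show "k x = Fin (v e - v x)" by (simp add: k_def)
  next
    assume "k x = Fin (v e - v x)"
    from kv_eq[OF this] awv gwv[of x] show "k x = Fin (w e - w x)" by (simp add: k_def)
  qed
  have kl: "prec e x" if "k x = Fin (w e - w x)" for x
    using kw_eq[OF that] al gl[of x] transpD[OF trans, of e u x] by auto
  have hk: "min (f x) (k x) \<le> h x" "f x \<noteq> k x \<Longrightarrow> h x = min (f x) (k x)" for x
    using h(2,3)[of x] by (auto simp: k_def)
  \<comment> \<open>Otherwise \<open>e\<close> would strictly precede itself; so the term at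
    \<open>e\<close> comes from \<open>f\<close> alone and survives.\<close>
  have "k e \<noteq> Fin 0" using kl[of e] asym by (auto dest: asympD)
  then have he: "h e = Fin 0"
    using hk(2)[of e] fe kw[of e] by (auto simp: min_def)
  have hw: "Fin (w e - w x) \<le> h x" and hv: "Fin (v e - v x) \<le> h x" for x
    using hk(1)[of x] fw[of x] kw[of x] fv[of x] kv[of x]
    by (meson min.boundedI order_trans)+
  \<comment> \<open>A minimal term of the result is one of \<open>f\<close> or of the multiple
    \<open>k\<close>, because elimination can only raise a value where the two agree.\<close>
  have src: "f x = c \<or> k x = c" if "h x = c" "c \<le> f x" "c \<le> k x" for x c
    using hk(1)[of x] that by (auto simp: min_def split: if_splits)
  have "h x = Fin (w e - w x) \<longleftrightarrow> h x = Fin (v e - v x)" for x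
  proof
    assume "h x = Fin (w e - w x)"
    moreover from src[OF this fw kw] have "Fin (w e - w x) = Fin (v e - v x)"
      using fwv kwv by metis
    ultimately show "h x = Fin (v e - v x)" by simp
  next
    assume "h x = Fin (v e - v x)"
    moreover from src[OF this fv kv] have "Fin (w e - w x) = Fin (v e - v x)"
      using fwv kwv by metis
    ultimately show "h x = Fin (w e - w x)" by simp
  qed
  moreover have "x = e \<or> prec e x" if "h x = Fin (w e - w x)" for x
    using src[OF that fw kw] fl kl by blast
  ultimately show ?thesis by (intro leading_formI he hw hv)
qed

text \<open>Eliminating in the order of increasing terms need not terminate over a valued field, so the
  columns of \<open>Q\<close> are cleared one at a time, as in Gauss-Jordan elimination.\<close>

lemma gauss_jordan:
  assumes "finite Q" "Q \<subseteq> M" and g: "\<And>e. e \<in> M \<Longrightarrow> \<exists>f\<in>V. leading_form prec w v e f"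
  shows "\<exists>C. \<forall>e\<in>M. C e \<in> V \<and> leading_form prec w v e (C e) \<and>
    (\<forall>e'\<in>Q. e' \<noteq> e \<longrightarrow> C e e' = Infty)"
  using assms(1,2)
proof (induction Q rule: finite_induct)
  case empty
  have "\<forall>e. \<exists>f. e \<in> M \<longrightarrow> f \<in> V \<and> leading_form prec w v e f" using g by blast
  then show ?case by (metis empty_iff)
next
  case (insert u Q)
  then obtain C where C: "\<And>e. e \<in> M \<Longrightarrow> C e \<in> V" "\<And>e. e \<in> M \<Longrightarrow> leading_form prec w v e (C e)"
    "\<And>e e'. e \<in> M \<Longrightarrow> e' \<in> Q \<Longrightarrow> e' \<noteq> e \<Longrightarrow> C e e' = Infty"
    by auto
  have u: "u \<in> M" using insert by simp
  have "\<exists>h\<in>V. leading_form prec w v e h \<and> (\<forall>e'\<in>insert u Q. e' \<noteq> e \<longrightarrow> h e' = Infty)"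
    if e: "e \<in> M" for e
  proof (cases "u = e \<or> C e u = Infty")
    case True
    then show ?thesis using C e by (intro bexI[of _ "C e"]) auto
  next
    case False
    then obtain a where a: "C e u = Fin a" by (cases "C e u") auto
    define k where "k = (\<lambda>x. Fin a * C u x)"
    have "C u u = Fin 0" using leading_formD(1)[OF C(2)[OF u]] .
    then have "k \<in> V" "k u = C e u" using scale_mem[OF C(1)[OF u]] a by (auto simp: k_def)
    then obtain h where h: "h \<in> V" "h u = Infty" "\<And>x. min (C e x) (k x) \<le> h x"
      "\<And>x. C e x \<noteq> k x \<Longrightarrow> h x = min (C e x) (k x)"
      using elim[OF C(1)[OF e], of k u] False by auto
    have "leading_form prec w v e h"
      by (rule leading_form_eliminate[where h = h, OF C(2)[OF e] C(2)[OF u] _ a])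
        (use h(2-4) False in \<open>auto simp: k_def\<close>)
    moreover have "h e' = Infty" if "e' \<in> insert u Q" "e' \<noteq> e" for e'
    proof (cases "e' = u")
      case False
      then have "C e e' = Infty" "k e' = Infty"
        using that C(3)[OF e, of e'] C(3)[OF u, of e'] insert(2) by (auto simp: k_def)
      then show ?thesis using h(3)[of e'] by simp
    qed (use h(2) in simp)
    ultimately show ?thesis using h(1) by blast
  qed
  then have "\<forall>e. \<exists>h. e \<in> M \<longrightarrow> h \<in> V \<and> leading_form prec w v e h \<and>
    (\<forall>e'\<in>insert u Q. e' \<noteq> e \<longrightarrow> h e' = Infty)" by blast
  then obtain C' where "\<forall>e. e \<in> M \<longrightarrow> C' e \<in> V \<and> leading_form prec w v e (C' e) \<and>
    (\<forall>e'\<in>insert u Q. e' \<noteq> e \<longrightarrow> C' e e' = Infty)" by (rule choice[THEN exE])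
  then show ?case by blast
qed

lemma leading_set_witness:
  assumes "e \<in> leading_set prec V w"
  shows "\<exists>f\<in>V. leading_form prec w w e f"
proof -
  obtain A where A: "A \<in> initial_sets V w" "e \<in> A" "\<And>x. x \<in> A \<Longrightarrow> x = e \<or> prec e x"
    using assms by (auto simp: leading_set_def)
  obtain f where f: "f \<in> V" "\<And>x. Fin (- w x) \<le> f x" "A = {x. f x = Fin (- w x)}"
    using A(1) by (rule initial_setsE) blast
  have "leading_form prec w w e (\<lambda>x. Fin (w e) * f x)"
    using A(2,3) f(2) unfolding f(3)
    by (intro leading_formI) (auto simp: tropical_Fin_le_Fin_times tropical_Fin_times_eq_Fin)
  then show ?thesis using scale_mem[OF f(1)] by blast
qed

lemma leading_set_subset: "leading_set prec V w \<subseteq> E"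
proof
  fix e assume "e \<in> leading_set prec V w"
  from leading_set_witness[OF this] obtain f where "f \<in> V" "leading_form prec w w e f"
    by (rule bexE)
  then show "e \<in> E" using support[of f e] leading_formD(1)[of prec w w e f] by simp
qed

text \<open>The least element of an initial set of \<open>f\<close> lies in the leading set and in
  the support of \<open>f\<close>.\<close>

lemma zero_on_leading_set:
  assumes "f \<in> V" "\<And>e. e \<in> leading_set prec V w \<Longrightarrow> f e = Infty"
  shows "f x = Infty"
proof (rule ccontr)
  assume "f x \<noteq> Infty"
  then obtain A c where A: "A \<in> initial_sets V w" "A \<noteq> {}" "A = {x. f x = Fin (c - w x)}"
    by (rule initial_set_through[OF assms(1) finite_support[OF assms(1)]])
  have "finite A" by (rule finite_subset[OF _ finite_support[OF assms(1)]]) (auto simp: A(3))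
  from ex_least_of_total[OF this A(2) trans total]
  obtain e where e: "e \<in> A" "\<forall>x\<in>A. x = e \<or> prec e x" by (rule bexE)
  then have "e \<in> leading_set prec V w" unfolding leading_set_def using A(1) by (intro CollectI bexI conjI)
  moreover have "f e \<noteq> Infty" using e(1) unfolding A(3) by simp
  ultimately show False using assms(2) by simp
qed

text \<open>Gauss-Jordan elimination makes the given forms mutually reduced while keeping them
  leading for both weights, so the leading set is the complement of a basis and the results are its
  circuits. Taking \<open>v = w\<close> produces an optimal basis for any weight.\<close>

lemma leading_basis:
  assumes "\<And>e. e \<in> leading_set prec V w \<Longrightarrow> \<exists>f\<in>V. leading_form prec w v e f"
  obtains C where "basis (leading_set prec V w) C"
    "\<And>e. e \<in> leading_set prec V w \<Longrightarrow> leading_form prec w v e (C e)"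
proof -
  have "finite (leading_set prec V w)" using finite_subset[OF leading_set_subset finite_E] .
  from gauss_jordan[OF this order_refl assms]
  obtain C where "\<forall>e\<in>leading_set prec V w. C e \<in> V \<and> leading_form prec w v e (C e) \<and>
    (\<forall>e'\<in>leading_set prec V w. e' \<noteq> e \<longrightarrow> C e e' = Infty)" by (rule exE)
  then have C: "C e \<in> V" "leading_form prec w v e (C e)"
    "e' \<in> leading_set prec V w \<Longrightarrow> e' \<noteq> e \<Longrightarrow> C e e' = Infty"
    if "e \<in> leading_set prec V w" for e e' using that by simp_all
  have "basis (leading_set prec V w) C"
    unfolding basis_def
  proof (intro conjI ballI allI impI)
    fix e assume e: "e \<in> leading_set prec V w"
    show "C e \<in> V" "C e e = Fin 0" using C(1)[OF e] leading_formD(1)[OF C(2)[OF e]] .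
    show "C e e' = Infty" if "e' \<in> leading_set prec V w" "e' \<noteq> e" for e' using C(3)[OF e that] .
  next
    fix f x assume "f \<in> V" "\<forall>e\<in>leading_set prec V w. f e = Infty"
    then show "f x = Infty" using zero_on_leading_set[of f w x] by simp
  qed
  then show ?thesis by (rule that) (rule C(2))
qed

lemma ex_optimal_basis: "\<exists>M C. basis M C \<and> optimal M C w"
proof -
  obtain C where C: "basis (leading_set prec V w) C"
    "\<And>e. e \<in> leading_set prec V w \<Longrightarrow> leading_form prec w w e (C e)"
    by (rule leading_basis[of w w, OF leading_set_witness]) blast+
  then have "optimal (leading_set prec V w) C w" unfolding optimal_def by (blast dest: leading_formD(2))
  with C(1) show ?thesis by blast
qed

text \<open>Forms indexed by the leading set of \<open>w\<close> alone suffice: the circuits reduced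
  from them are optimal for both weights with equal ties, which gives both inclusions.\<close>

lemma initial_sets_eq_of_leading_forms:
  assumes "\<And>e. e \<in> leading_set prec V w \<Longrightarrow> \<exists>f\<in>V. leading_form prec w v e f"
  shows "initial_sets V w = initial_sets V v"
proof -
  obtain C where C: "basis (leading_set prec V w) C"
    "\<And>e. e \<in> leading_set prec V w \<Longrightarrow> leading_form prec w v e (C e)"
    by (rule leading_basis[of w v, OF assms]) blast+
  from C(2) have "optimal (leading_set prec V w) C w" "optimal (leading_set prec V w) C v"
    "same_ties (leading_set prec V w) C w v" "same_ties (leading_set prec V w) C v w"
    unfolding optimal_def same_ties_def using leading_formD by metis+
  then show ?thesis
    using initial_sets_subset_of_same_ties[OF C(1)] by blast
qed

lemma leading_forms_of_initial_sets_eq: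
  assumes eq: "initial_sets V w = initial_sets V v" and e: "e \<in> leading_set prec V w"
  shows "\<exists>f\<in>V. leading_form prec w v e f"
proof -
  obtain C where C: "basis (leading_set prec V w) C"
    "\<And>e. e \<in> leading_set prec V w \<Longrightarrow> leading_form prec w w e (C e)"
    by (rule leading_basis[of w w, OF leading_set_witness]) blast+
  from C(2) have "optimal (leading_set prec V w) C w"
    unfolding optimal_def by (blast dest: leading_formD(2))
  note * = same_ties_of_initial_sets_eq[OF C(1) this eq] and ** = leading_formD[OF C(2)[OF e]]
  have "leading_form prec w v e (C e)"
    by (rule leading_formI) (use * ** e in \<open>auto simp: optimal_def same_ties_def\<close>)
  then show ?thesis using basisD(1)[OF C(1) e] by blast
qed

text \<open>This replaces a count of basis elements: for \<open>e\<close> in the larger set only,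
  the circuit of \<open>e\<close> would be \<open>Infty\<close> on the whole smaller set, hence
  everywhere, in spite of its value 0 at \<open>e\<close>.\<close>

lemma leading_set_antichain:
  assumes "leading_set prec V w \<subseteq> leading_set prec V v"
  shows "leading_set prec V w = leading_set prec V v"
proof (rule ccontr)
  assume "\<not> ?thesis"
  then obtain e where e: "e \<in> leading_set prec V v" "e \<notin> leading_set prec V w" using assms by blast
  obtain C where C: "basis (leading_set prec V v) C"
    by (rule leading_basis[of v v, OF leading_set_witness]) blast+
  have "C e e' = Infty" if "e' \<in> leading_set prec V w" for e'
    using basisD(3)[OF C e(1), of e'] assms that e(2) by blast
  then have "C e e = Infty" using zero_on_leading_set[OF basisD(1)[OF C e(1)]] by blast
  then show False using basisD(2)[OF C e(1)] by simp
qed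

end

section \<open>Uniform bounds on generators of monomial ideals\<close>

lemma monom_degree_add: "monom_degree (u + v) = monom_degree u + monom_degree v"
  by (simp add: monom_degree_def lookup_add sum.distrib)

lemma finite_monoms_degree_le: "finite {u :: 'n::finite monom. monom_degree u \<le> D}"
proof (rule finite_imageD)
  have "lookup u i \<le> monom_degree u" for u :: "'n monom" and i
    unfolding monom_degree_def using member_le_sum[of i UNIV "lookup u"] by simp
  then have "lookup ` {u :: 'n monom. monom_degree u \<le> D} \<subseteq> {f. \<forall>i. f i \<in> {..D}}"
    by (auto intro: order_trans)
  moreover have "finite {f :: 'n \<Rightarrow> nat. \<forall>i. f i \<in> {..D}}"
    using finite_PiE[of "UNIV :: 'n set" "\<lambda>_. {..D}"] by (simp add: PiE_def extensional_def Pi_def)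
  ultimately show "finite (lookup ` {u :: 'n monom. monom_degree u \<le> D})"
    by (rule finite_subset)
  show "inj_on lookup {u :: 'n monom. monom_degree u \<le> D}"
    by (simp add: inj_on_def)
qed

definition monom_dvd :: "'n monom \<Rightarrow> 'n monom \<Rightarrow> bool" where
  "monom_dvd u v \<longleftrightarrow> (\<forall>i. lookup u i \<le> lookup v i)"

lemma monom_dvd_refl [simp]: "monom_dvd u u"
  by (simp add: monom_dvd_def)

lemma monom_dvd_trans: "monom_dvd u v \<Longrightarrow> monom_dvd v w \<Longrightarrow> monom_dvd u w"
  unfolding monom_dvd_def using order_trans by blast

lemma monom_dvd_imp_add: "monom_dvd u v \<Longrightarrow> v = u + (v - u)"
  by (intro poly_mapping_eqI) (simp add: lookup_add lookup_minus monom_dvd_def)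

text \<open>The coordinates are treated one after another; passing to a further subsequence keeps
  the monotonicity already reached.\<close>

lemma ex_mono_subseq_on_finite:
  fixes s :: "nat \<Rightarrow> 'a \<Rightarrow> nat"
  assumes "finite A"
  shows "\<exists>r :: nat \<Rightarrow> nat. strict_mono r \<and> (\<forall>i\<in>A. mono (\<lambda>k. s (r k) i))"
  using assms
proof (induction A rule: finite_induct)
  case empty
  have "strict_mono (\<lambda>k::nat. k)" by (simp add: strict_mono_def)
  then show ?case by blast
next
  case (insert a A)
  then obtain r :: "nat \<Rightarrow> nat" where r: "strict_mono r" "\<And>i. i \<in> A \<Longrightarrow> mono (\<lambda>k. s (r k) i)" by blast
  obtain g :: "nat \<Rightarrow> nat" where g: "strict_mono g" "monoseq (\<lambda>k. s (r (g k)) a)"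
    using seq_monosub[of "\<lambda>k. s (r k) a"] by blast
  have "\<exists>h :: nat \<Rightarrow> nat. strict_mono h \<and> mono (\<lambda>k. s (r (g (h k))) a)"
  proof (cases "mono (\<lambda>k. s (r (g k)) a)")
    case True
    then show ?thesis by (intro exI[of _ "\<lambda>k::nat. k"]) (auto simp: strict_mono_def)
  next
    case False
    then have anti: "s (r (g n)) a \<le> s (r (g m)) a" if "m \<le> n" for m n
      using g(2) that by (auto simp: monoseq_def mono_def)
    \<comment> \<open>A nonincreasing sequence of naturals is constant from the index where it
      attains its minimum.\<close>
    define m where "m = (LEAST x. x \<in> range (\<lambda>k. s (r (g k)) a))"
    have "m \<in> range (\<lambda>k. s (r (g k)) a)" unfolding m_def by (rule LeastI) auto
    then obtain K where K: "m = s (r (g K)) a" by auto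
    have "m \<le> s (r (g k)) a" for k unfolding m_def by (rule Least_le) auto
    then have "s (r (g (K + k))) a = m" for k using anti[of K "K + k"] K by (simp add: antisym)
    then show ?thesis by (intro exI[of _ "\<lambda>k. K + k"]) (auto simp: strict_mono_def mono_def)
  qed
  then obtain h :: "nat \<Rightarrow> nat" where h: "strict_mono h" "mono (\<lambda>k. s (r (g (h k))) a)" by blast
  have gh: "strict_mono (\<lambda>k. g (h k))" using g(1) h(1) by (simp add: strict_mono_def)
  show ?case
  proof (intro exI[of _ "\<lambda>k. r (g (h k))"] conjI ballI)
    show "strict_mono (\<lambda>k. r (g (h k)))" using r(1) gh by (simp add: strict_mono_def)
    fix i assume "i \<in> insert a A"
    then show "mono (\<lambda>k. s (r (g (h k))) i)"
      using h(2) r(2)[of i] strict_mono_mono[OF gh] by (auto simp: mono_def)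
  qed
qed

lemma dickson:
  fixes u :: "nat \<Rightarrow> 'n::finite monom"
  shows "\<exists>i j. i < j \<and> monom_dvd (u i) (u j)"
proof -
  obtain r :: "nat \<Rightarrow> nat" where "strict_mono r" "\<And>i. mono (\<lambda>k. lookup (u (r k)) i)"
    using ex_mono_subseq_on_finite[of UNIV "\<lambda>k. lookup (u k)"] by auto
  then have "r 0 < r 1" "monom_dvd (u (r 0)) (u (r 1))"
    by (auto simp: strict_mono_def mono_def monom_dvd_def)
  then show ?thesis by blast
qed

text \<open>The exponents of a monomial ideal, in the polynomial ring whose monomials are
  \<open>E\<close>.\<close>

definition up_closed :: "'n monom set \<Rightarrow> 'n monom set \<Rightarrow> bool" where
  "up_closed E M \<longleftrightarrow> M \<subseteq> E \<and> (\<forall>u\<in>M. \<forall>v\<in>E. monom_dvd u v \<longrightarrow> v \<in> M)"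

definition generated_up_to :: "nat \<Rightarrow> 'n::finite monom set \<Rightarrow> bool" where
  "generated_up_to D M \<longleftrightarrow> (\<forall>u\<in>M. \<exists>v\<in>M. monom_degree v \<le> D \<and> monom_dvd v u)"

lemma generated_up_to_mono: "generated_up_to D M \<Longrightarrow> D \<le> D' \<Longrightarrow> generated_up_to D' M"
  unfolding generated_up_to_def by (meson order_trans)

text \<open>This is the ascending chain condition. In a strictly growing chain choose a new
  \<open>u i\<close> at every step; Dickson's lemma gives \<open>u i\<close> dividing a later
  \<open>u j\<close>, which therefore was not new.\<close>

lemma wf_up_closed:
  "wf {(J', J). up_closed E J' \<and> up_closed E (J :: 'n::finite monom set) \<and> J \<subset> J'}"
  unfolding wf_iff_no_infinite_down_chain
proof
  assume "\<exists>f. \<forall>i. (f (Suc i), f i) \<in>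
    {(J', J). up_closed E J' \<and> up_closed E (J :: 'n monom set) \<and> J \<subset> J'}"
  then obtain J :: "nat \<Rightarrow> 'n monom set" where
    J: "\<And>i. (J (Suc i), J i) \<in> {(J', J). up_closed E J' \<and> up_closed E J \<and> J \<subset> J'}" by blast
  then have up: "up_closed E (J i)" and less: "J i \<subset> J (Suc i)" for i by blast+
  have mono: "i \<le> j \<Longrightarrow> J i \<subseteq> J j" for i j
    by (rule lift_Suc_mono_le[of J]) (use less in auto)
  have "\<forall>i. \<exists>u. u \<in> J (Suc i) - J i" using less by blast
  then obtain u where u: "\<And>i. u i \<in> J (Suc i)" "\<And>i. u i \<notin> J i" by (metis DiffD1 DiffD2)
  obtain i j where ij: "i < j" "monom_dvd (u i) (u j)" using dickson by blast
  then have "u i \<in> J j" "u j \<in> E" 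
    using u(1)[of i] u(1)[of j] mono[of "Suc i" j] up[of "Suc j"] by (auto simp: up_closed_def)
  then have "u j \<in> J j" using up ij(2) by (auto simp: up_closed_def)
  then show False using u(2) by blast
qed

text \<open>The parts \<open>G D\<close> generated in degree at most \<open>D\<close> ascend with
  \<open>D\<close>, so they stabilise; every element of \<open>J\<close> lies in one of
  them.\<close>

lemma ex_generated_up_to:
  assumes "up_closed E (J :: 'n::finite monom set)"
  shows "\<exists>D. generated_up_to D J"
proof -
  define G where "G D = {u \<in> J. \<exists>v\<in>J. monom_degree v \<le> D \<and> monom_dvd v u}" for D
  have up: "up_closed E (G D)" for D
    using assms monom_dvd_trans unfolding up_closed_def G_def by blast
  have mono: "G D \<subseteq> G D'" if "D \<le> D'" for D D'
    using that order_trans[of _ D D'] unfolding G_def by blast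
  obtain D where D: "\<And>J'. (J', G D) \<in> {(J', J). up_closed E J' \<and> up_closed E J \<and> J \<subset> J'} \<Longrightarrow>
    J' \<notin> range G"
    using wfE_min[OF wf_up_closed[of E], of "G 0" "range G"] by (metis (no_types, lifting) imageE rangeI)
  have "u \<in> G D" if "u \<in> J" for u
  proof -
    let ?D = "max D (monom_degree u)"
    have "u \<in> G ?D" using that unfolding G_def by (auto intro!: bexI[of _ u])
    moreover have "G ?D = G D" using D[of "G ?D"] up mono[of D ?D] by auto
    ultimately show ?thesis by simp
  qed
  then show ?thesis by (auto simp: G_def generated_up_to_def)
qed

text \<open>Well-founded induction on \<open>J\<close>: if some member \<open>M\<close> of the family exceeds \<open>J\<close> in degrees up
  to \<open>d\<close>, then by the antichain condition every member does, so it contains one of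
  finitely many monomials outside \<open>J\<close>.\<close>

lemma uniform_generation_degree_above:
  fixes \<M> :: "'n::finite monom set set"
  assumes up: "\<And>M. M \<in> \<M> \<Longrightarrow> up_closed E M"
    and antichain: "\<And>M M' d. M \<in> \<M> \<Longrightarrow> M' \<in> \<M> \<Longrightarrow>
      {u \<in> M. monom_degree u \<le> d} \<subseteq> M' \<Longrightarrow> {u \<in> M'. monom_degree u \<le> d} \<subseteq> M"
    and J: "up_closed E J"
  shows "\<exists>D. \<forall>M\<in>\<M>. J \<subseteq> M \<longrightarrow> generated_up_to D M"
  using wf_up_closed[of E] J
proof (induction J rule: wf_induct_rule)
  case (less J)
  show ?case
  proof (cases "\<exists>M\<in>\<M>. J \<subset> M")
    case False
    then have "M = J" if "M \<in> \<M>" "J \<subseteq> M" for M using that by blast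
    moreover obtain D where "generated_up_to D J" using ex_generated_up_to[OF less.prems] ..
    ultimately show ?thesis by blast
  next
    case True
    then obtain M m where M: "M \<in> \<M>" "J \<subseteq> M" and m: "m \<in> M" "m \<notin> J" by blast
    define d where "d = monom_degree m"
    define K where "K = {u \<in> E. u \<notin> J \<and> monom_degree u \<le> d}"
    define J' where "J' u = J \<union> {v \<in> E. monom_dvd u v}" for u
    have finK: "finite K"
      by (rule finite_subset[OF _ finite_monoms_degree_le[of d]]) (auto simp: K_def)
    have "\<exists>D. \<forall>M\<in>\<M>. J' u \<subseteq> M \<longrightarrow> generated_up_to D M" if "u \<in> K" for u
    proof (rule less.IH)
      show "up_closed E (J' u)"
        using less.prems monom_dvd_trans unfolding up_closed_def J'_def by blast
      moreover have "J \<subseteq> J' u" "u \<in> J' u" "u \<notin> J" using that by (auto simp: J'_def K_def)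
      ultimately show "(J' u, J) \<in> {(J', J). up_closed E J' \<and> up_closed E J \<and> J \<subset> J'}"
        using less.prems by blast
    qed
    then obtain D where D: "\<And>u M. u \<in> K \<Longrightarrow> M \<in> \<M> \<Longrightarrow> J' u \<subseteq> M \<Longrightarrow> generated_up_to (D u) M"
      by metis
    \<comment> \<open>The sum merely provides a common upper bound for the finitely many
      \<open>D u\<close>.\<close>
    show ?thesis
    proof (intro exI[of _ "\<Sum>u\<in>K. D u"] ballI impI)
      fix M' assume M': "M' \<in> \<M>" "J \<subseteq> M'"
      have "\<exists>u\<in>M'. u \<in> K"
      proof (rule ccontr)
        assume "\<not> ?thesis"
        then have "{u \<in> M'. monom_degree u \<le> d} \<subseteq> J"
          using up[OF M'(1)] by (auto simp: K_def up_closed_def)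
        then have "{u \<in> M'. monom_degree u \<le> d} \<subseteq> M" using M(2) by blast
        from antichain[OF M'(1) M(1) this] have "m \<in> M'" using m by (auto simp: d_def)
        with \<open>{u \<in> M'. monom_degree u \<le> d} \<subseteq> J\<close> m show False by (auto simp: d_def)
      qed
      then obtain u where u: "u \<in> M'" "u \<in> K" by blast
      then have "J' u \<subseteq> M'" using M'(2) up[OF M'(1)] by (auto simp: J'_def up_closed_def)
      then have "generated_up_to (D u) M'" by (rule D[OF u(2) M'(1)])
      moreover have "D u \<le> (\<Sum>u\<in>K. D u)" using u(2) finK by (intro member_le_sum) auto
      ultimately show "generated_up_to (\<Sum>u\<in>K. D u) M'" by (rule generated_up_to_mono)
    qed
  qed
qed

section \<open>The lexicographic order for an arbitrary enumeration of the variables\<close>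

definition monom_less :: "'n::finite monom \<Rightarrow> 'n monom \<Rightarrow> bool" where
  "monom_less u v \<longleftrightarrow> (\<exists>i. lookup u i < lookup v i \<and>
     (\<forall>j. to_nat_on UNIV j < to_nat_on UNIV i \<longrightarrow> lookup u j = lookup v j))"

lemma inj_to_nat_on_finite: "inj (to_nat_on (UNIV :: 'n::finite set))"
  by (rule inj_on_to_nat_on) (simp add: countable_finite)

lemma monom_less_trans: "transp monom_less"
proof (rule transpI)
  fix u v w :: "'a monom" assume "monom_less u v" "monom_less v w"
  then obtain i j where i: "lookup u i < lookup v i"
    "\<And>k. to_nat_on UNIV k < to_nat_on UNIV i \<Longrightarrow> lookup u k = lookup v k"
    and j: "lookup v j < lookup w j"
    "\<And>k. to_nat_on UNIV k < to_nat_on UNIV j \<Longrightarrow> lookup v k = lookup w k"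
    by (auto simp: monom_less_def)
  consider "to_nat_on UNIV i < to_nat_on UNIV j" | "i = j" | "to_nat_on UNIV j < to_nat_on UNIV i"
    using inj_to_nat_on_finite by (metis injD nat_neq_iff)
  then show "monom_less u w"
  proof cases
    case 1
    then show ?thesis unfolding monom_less_def using i j by (intro exI[of _ i]) auto
  next
    case 2
    then show ?thesis unfolding monom_less_def using i j by (intro exI[of _ i]) auto
  next
    case 3
    then show ?thesis unfolding monom_less_def using i j by (intro exI[of _ j]) auto
  qed
qed

lemma monom_less_asym: "asymp monom_less"
proof (rule asympI)
  fix u v :: "'a monom" assume "monom_less u v"
  show "\<not> monom_less v u"
  proof
    assume "monom_less v u"
    with \<open>monom_less u v\<close> have "monom_less u u" by (rule transpD[OF monom_less_trans])
    then show False by (auto simp: monom_less_def)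
  qed
qed

lemma monom_less_total:
  assumes "u \<noteq> v"
  shows "monom_less u v \<or> monom_less v u"
proof -
  obtain k where k: "lookup u k \<noteq> lookup v k" using assms poly_mapping_eqI by metis
  define i where "i = arg_min (to_nat_on UNIV) (\<lambda>i. lookup u i \<noteq> lookup v i)"
  have "lookup u i \<noteq> lookup v i" unfolding i_def 
    by (rule arg_min_natI[of "\<lambda>i. lookup u i \<noteq> lookup v i" k, OF k])
  moreover have "lookup u j = lookup v j" if "to_nat_on UNIV j < to_nat_on UNIV i" for j
    using that arg_min_nat_le[of "\<lambda>i. lookup u i \<noteq> lookup v i" j "to_nat_on UNIV"]
    unfolding i_def by (metis leD)
  ultimately show ?thesis unfolding monom_less_def by (metis nat_neq_iff)
qed

text \<open>Compatibility with multiplication keeps a leading monomial leading after a shift; this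
  is what makes the sets of leading monomials upward closed.\<close>

lemma monom_less_add_right: "monom_less (u + m) (v + m) \<longleftrightarrow> monom_less u v"
  by (simp add: monom_less_def lookup_add)

section \<open>Coefficient vectors of a tropical ideal\<close>

lemma in_keys_tropical: "u \<in> keys f \<longleftrightarrow> lookup f u \<noteq> (Infty :: tropical)"
  by (simp add: in_keys_iff zero_tropical_def)

lemma lookup_add_tropical: "lookup (f + g) u = min (lookup f u) (lookup g u :: tropical)"
  by (simp add: lookup_add plus_tropical_def)

lemma lookup_single_times:
  "lookup (Poly_Mapping.single m c * f) (m + u) = c * lookup f (u :: 'n monom)" for f :: "'n tpoly"
proof -
  have "(\<Sum>q. lookup f q when m + u = m + q) = (\<Sum>q. lookup f q when u = q)" by simp
  also have "\<dots> = lookup f u" by simp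
  finally have *: "(\<Sum>q. lookup f q when m + u = m + q) = lookup f u" .
  have "lookup (Poly_Mapping.single m c * f) (m + u) =
      (\<Sum>l. (c when m = l) * (\<Sum>q. lookup f q when m + u = l + q))"
    by (simp add: lookup_mult lookup_single)
  also have "\<dots> = (\<Sum>l. c * (\<Sum>q. lookup f q when m + u = l + q) when m = l)"
    by (simp only: when_mult)
  also have "\<dots> = c * lookup f u" by (simp only: Sum_any_when_equal' *)
  finally show ?thesis .
qed

lemma keys_single_times_subset:
  "keys (Poly_Mapping.single m c * f) \<subseteq> (+) m ` keys f" for f :: "'n tpoly"
  using keys_mult[of "Poly_Mapping.single m c" f] by (auto split: if_splits)

lemma lookup_single_times_outside:
  "v \<notin> range ((+) m) \<Longrightarrow> lookup (Poly_Mapping.single m c * f) v = Infty" for f :: "'n tpoly"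
  using keys_single_times_subset[of m c f] by (auto simp: in_keys_tropical)

lemma poly_eq_sum_singles: "f = (\<Sum>u\<in>keys f. Poly_Mapping.single u (lookup f u))"
proof (rule poly_mapping_eqI)
  fix v
  have "lookup (\<Sum>u\<in>keys f. Poly_Mapping.single u (lookup f u)) v =
      (\<Sum>u\<in>keys f. lookup f u when u = v)"
    by (simp add: lookup_sum lookup_single)
  also have "\<dots> = (\<Sum>u\<in>keys f. if v = u then lookup f u else 0)"
    by (intro sum.cong) (auto simp: when_def)
  also have "\<dots> = lookup f v" by (simp add: in_keys_iff)
  finally show "lookup f v = lookup (\<Sum>u\<in>keys f. Poly_Mapping.single u (lookup f u)) v" ..
qed

lemma semiring_idealD:
  assumes "semiring_ideal R J"
  shows "x \<in> J \<Longrightarrow> y \<in> J \<Longrightarrow> x + y \<in> J" "r \<in> R \<Longrightarrow> x \<in> J \<Longrightarrow> r * x \<in> J" "J \<subseteq> R" "J \<noteq> {}"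
  using assms by (auto simp: semiring_ideal_def)

lemma semiring_ideal_zero:
  assumes "semiring_ideal R J" "0 \<in> R"
  shows "0 \<in> J"
proof -
  obtain x where "x \<in> J" using semiring_idealD(4)[OF assms(1)] by blast
  then have "0 * x \<in> J" using semiring_idealD(2)[OF assms(1)] assms(2) by blast
  then show ?thesis by simp
qed

lemma ideal_generated_subset:
  "semiring_ideal R J \<Longrightarrow> S \<subseteq> J \<Longrightarrow> ideal_generated R S \<subseteq> J"
  by (auto simp: ideal_generated_def)

lemma subset_ideal_generated: "S \<subseteq> ideal_generated R S"
  by (auto simp: ideal_generated_def)

lemma semiring_ideal_ideal_generated:
  assumes "semiring_ideal R R" "S \<subseteq> R" "0 \<in> R"
  shows "semiring_ideal R (ideal_generated R S)"
  unfolding semiring_ideal_def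
proof (intro conjI ballI)
  show "ideal_generated R S \<subseteq> R" by (rule ideal_generated_subset[OF assms(1,2)])
  have "0 \<in> ideal_generated R S"
    unfolding ideal_generated_def using semiring_ideal_zero[OF _ assms(3)] by blast
  then show "ideal_generated R S \<noteq> {}" by blast
qed (auto simp: ideal_generated_def dest: semiring_idealD)

definition restrict_poly :: "'n monom set \<Rightarrow> 'n tpoly \<Rightarrow> 'n tpoly" where
  "restrict_poly S f = Abs_poly_mapping (\<lambda>u. if u \<in> S then lookup f u else 0)"

lemma lookup_restrict_poly: "lookup (restrict_poly S f) u = (if u \<in> S then lookup f u else Infty)"
proof -
  have "finite {u. (if u \<in> S then lookup f u else 0) \<noteq> 0}"
    by (rule finite_subset[of _ "keys f"]) (auto simp: in_keys_iff)
  then show ?thesis by (simp add: restrict_poly_def zero_tropical_def)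
qed

lemma restrict_poly_add: "restrict_poly S (f + g) = restrict_poly S f + restrict_poly S g"
  by (rule poly_mapping_eqI) (simp add: lookup_restrict_poly lookup_add_tropical)

lemma restrict_poly_single_times:
  "restrict_poly S (Poly_Mapping.single m c * f) =
     Poly_Mapping.single m c * restrict_poly {u. m + u \<in> S} f"
proof (rule poly_mapping_eqI)
  fix v
  show "lookup (restrict_poly S (Poly_Mapping.single m c * f)) v =
      lookup (Poly_Mapping.single m c * restrict_poly {u. m + u \<in> S} f) v"
    by (cases "v \<in> range ((+) m)")
       (auto simp: lookup_restrict_poly lookup_single_times lookup_single_times_outside)
qed

text \<open>The polynomials with this property form an ideal, and it contains the homogeneous
  generators because restricting a homogeneous polynomial returns it or 0.\<close>

lemma homogeneous_ideal_restrict_degrees: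
  assumes I: "homogeneous_ideal I" and f: "f \<in> I"
  shows "restrict_poly {u. monom_degree u \<in> P} f \<in> I"
proof -
  obtain G where G: "\<And>g. g \<in> G \<Longrightarrow> \<exists>d. homogeneous_of_degree d g" "I = ideal_generated UNIV G"
    using I by (auto simp: homogeneous_ideal_def)
  have id: "semiring_ideal UNIV I" using I by (simp add: homogeneous_ideal_def)
  \<comment> \<open>All sets of degrees are quantified over at once, since multiplication by a
    monomial shifts the set of degrees.\<close>
  define J where "J = {f. \<forall>P. restrict_poly {u. monom_degree u \<in> P} f \<in> I}"
  have zero: "restrict_poly S 0 = 0" for S :: "'a monom set"
    by (rule poly_mapping_eqI) (simp add: lookup_restrict_poly zero_tropical_def)
  have 0: "0 \<in> J" using semiring_ideal_zero[OF id] by (simp add: J_def zero)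
  have add: "f + g \<in> J" if "f \<in> J" "g \<in> J" for f g
    using that semiring_idealD(1)[OF id] by (simp add: J_def restrict_poly_add)
  have single: "Poly_Mapping.single m c * f \<in> J" if "f \<in> J" for m c f
  proof -
    have "restrict_poly {u. monom_degree u \<in> P} (Poly_Mapping.single m c * f) \<in> I" for P
    proof -
      have "restrict_poly {u. monom_degree u \<in> {d. monom_degree m + d \<in> P}} f \<in> I"
        using that unfolding J_def by blast
      from semiring_idealD(2)[OF id UNIV_I this, of "Poly_Mapping.single m c"] show ?thesis
        by (simp add: restrict_poly_single_times monom_degree_add)
    qed
    then show ?thesis unfolding J_def by blast
  qed
  have mult: "r * f \<in> J" if "f \<in> J" for r f
  proof -
    have "(\<Sum>u\<in>A. Poly_Mapping.single u (lookup r u) * f) \<in> J" for A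
      by (induction A rule: infinite_finite_induct) (use that in \<open>auto intro: 0 add single\<close>)
    then show ?thesis
      by (subst poly_eq_sum_singles[of r]) (simp add: sum_distrib_right)
  qed
  have "G \<subseteq> J"
  proof
    fix g assume g: "g \<in> G"
    then obtain d where d: "homogeneous_of_degree d g" using G(1) by blast
    have gI: "g \<in> I" using g subset_ideal_generated[of G UNIV] unfolding G(2) by blast
    have "restrict_poly {u. monom_degree u \<in> P} g = (if d \<in> P then g else 0)" for P
      by (rule poly_mapping_eqI)
         (use d in \<open>auto simp: lookup_restrict_poly homogeneous_of_degree_def in_keys_tropical
           zero_tropical_def\<close>)
    then show "g \<in> J" using gI semiring_ideal_zero[OF id] by (simp add: J_def)
  qed
  moreover have "semiring_ideal UNIV J" using 0 add mult by (auto simp: semiring_ideal_def)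
  ultimately have "I \<subseteq> J" unfolding G(2) by (intro ideal_generated_subset)
  with f show ?thesis by (auto simp: J_def)
qed

locale tropical_ideal =
  fixes I :: "'n::finite tpoly set"
  assumes homogeneous_tropical_ideal: "homogeneous_tropical_ideal I"
begin

lemma ideal: "semiring_ideal UNIV I"
  using homogeneous_tropical_ideal
  by (simp add: homogeneous_tropical_ideal_def homogeneous_ideal_def)

lemma restrict_degrees: "f \<in> I \<Longrightarrow> restrict_poly {u. monom_degree u \<in> P} f \<in> I"
  using homogeneous_tropical_ideal homogeneous_ideal_restrict_degrees
  by (auto simp: homogeneous_tropical_ideal_def)

text \<open>A projection of the coefficient vectors of all of \<open>I\<close>, not the members of
  \<open>I\<close> supported in \<open>S\<close>. For \<open>S\<close> the monomials free of the
  variables in \<sigma>, it is the effect of setting these variables to infinity.\<close>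

definition restrictions :: "'n monom set \<Rightarrow> ('n monom \<Rightarrow> tropical) set" where
  "restrictions S = (\<lambda>f u. if u \<in> S then lookup f u else Infty) ` I"

lemma restrictionsI:
  "f \<in> I \<Longrightarrow> (\<And>u. h u = (if u \<in> S then lookup f u else Infty)) \<Longrightarrow> h \<in> restrictions S"
  unfolding restrictions_def by blast

lemma restrictionsE:
  assumes "h \<in> restrictions S"
  obtains f where "f \<in> I" "\<And>u. h u = (if u \<in> S then lookup f u else Infty)"
  using assms unfolding restrictions_def by blast

lemma restrictions_outside: "h \<in> restrictions S \<Longrightarrow> u \<notin> S \<Longrightarrow> h u = Infty"
  by (auto simp: restrictions_def)

lemma restrictions_restrict:
  assumes "h \<in> restrictions S" "T \<subseteq> S"
  shows "(\<lambda>u. if u \<in> T then h u else Infty) \<in> restrictions T"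
proof -
  obtain f where "f \<in> I" "\<And>u. h u = (if u \<in> S then lookup f u else Infty)"
    using assms(1) by (rule restrictionsE) blast
  then show ?thesis using assms(2) by (intro restrictionsI[of f]) auto
qed

lemma restrictions_extend:
  assumes "h \<in> restrictions T" "T \<subseteq> S"
  shows "\<exists>k\<in>restrictions S. \<forall>u. h u = (if u \<in> T then k u else Infty)"
proof -
  obtain f where f: "f \<in> I" "\<And>u. h u = (if u \<in> T then lookup f u else Infty)"
    using assms(1) by (rule restrictionsE) blast
  then have "(\<lambda>u. if u \<in> S then lookup f u else Infty) \<in> restrictions S"
    by (intro restrictionsI[of f]) auto
  then show ?thesis using f(2) assms(2) by (intro bexI) auto
qed

lemma restrictions_truncate:
  assumes "h \<in> restrictions S"
  shows "(\<lambda>u. if monom_degree u \<in> P then h u else Infty) \<in> restrictions S"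
proof -
  obtain f where f: "f \<in> I" "\<And>u. h u = (if u \<in> S then lookup f u else Infty)"
    using assms by (rule restrictionsE) blast
  show ?thesis
    by (rule restrictionsI[OF restrict_degrees[OF f(1), of P]]) (simp add: lookup_restrict_poly f(2))
qed

lemma restrictions_shift:
  assumes h: "h \<in> restrictions S" and S: "\<And>u. m + u \<in> S \<longleftrightarrow> u \<in> S"
  shows "\<exists>k\<in>restrictions S. (\<forall>u. k (m + u) = h u) \<and> (\<forall>v. v \<notin> range ((+) m) \<longrightarrow> k v = Infty)"
proof -
  obtain f where f: "f \<in> I" "\<And>u. h u = (if u \<in> S then lookup f u else Infty)"
    using h by (rule restrictionsE) blast
  have "Poly_Mapping.single m 1 * f \<in> I" using f(1) semiring_idealD(2)[OF ideal] by blast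
  then have "(\<lambda>u. if u \<in> S then lookup (Poly_Mapping.single m 1 * f) u else Infty) \<in> restrictions S"
    unfolding restrictions_def by (rule imageI)
  then show ?thesis
    by (rule rev_bexI)
       (auto simp: f(2) S lookup_single_times lookup_single_times_outside)
qed

sublocale tropical_module "restrictions S" for S
proof
  show "(\<lambda>_. Infty) \<in> restrictions S"
    using semiring_ideal_zero[OF ideal] by (intro restrictionsI[of 0]) (auto simp: zero_tropical_def)
next
  fix f c assume "f \<in> restrictions S"
  then obtain g where g: "g \<in> I" "\<And>u. f u = (if u \<in> S then lookup g u else Infty)"
    by (rule restrictionsE) blast
  have "Poly_Mapping.single 0 (Fin c) * g \<in> I" using g(1) semiring_idealD(2)[OF ideal] by blast
  moreover have "lookup (Poly_Mapping.single 0 (Fin c) * g) u = Fin c * lookup g u" for u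
    using lookup_single_times[of 0 "Fin c" g u] by simp
  ultimately show "(\<lambda>x. Fin c * f x) \<in> restrictions S"
    by (intro restrictionsI) (auto simp: g(2))
next
  fix f g assume "f \<in> restrictions S" "g \<in> restrictions S"
  then obtain p q where p: "p \<in> I" "\<And>u. f u = (if u \<in> S then lookup p u else Infty)"
    and q: "q \<in> I" "\<And>u. g u = (if u \<in> S then lookup q u else Infty)"
    by (elim restrictionsE) blast
  show "(\<lambda>x. min (f x) (g x)) \<in> restrictions S"
    using semiring_idealD(1)[OF ideal p(1) q(1)]
    by (rule restrictionsI) (simp add: lookup_add_tropical p(2) q(2))
qed

text \<open>The axiom is available only within one degree, so it is applied to the components in the
  degree of \<open>u\<close>.\<close>

lemma restrictions_elim:
  assumes f: "f \<in> restrictions S" and g: "g \<in> restrictions S" and u: "f u = g u" "f u \<noteq> Infty"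
  shows "\<exists>h\<in>restrictions S. h u = Infty \<and>
    (\<forall>x. min (f x) (g x) \<le> h x \<and> (f x \<noteq> g x \<longrightarrow> h x = min (f x) (g x)))"
proof -
  obtain p where p: "p \<in> I" "\<And>u. f u = (if u \<in> S then lookup p u else Infty)"
    using f by (rule restrictionsE) blast
  obtain q where q: "q \<in> I" "\<And>u. g u = (if u \<in> S then lookup q u else Infty)"
    using g by (rule restrictionsE) blast
  define d where "d = monom_degree u"
  define part where "part r = restrict_poly {u. monom_degree u \<in> {d}} r" for r :: "'n tpoly"
  define rest where "rest r = restrict_poly {u. monom_degree u \<in> - {d}} r" for r :: "'n tpoly"
  have part: "part r \<in> degree_part I d" if "r \<in> I" for r
    using restrict_degrees[OF that, of "{d}"]
    by (auto simp: degree_part_def homogeneous_of_degree_def part_def in_keys_tropical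
      lookup_restrict_poly split: if_splits)
  have uS: "u \<in> S" using u(2) p(2)[of u] by (auto split: if_splits)
  have "lookup (part p) u = lookup (part q) u" "lookup (part p) u \<noteq> Infty"
    using u uS by (auto simp: p(2) q(2) part_def lookup_restrict_poly d_def)
  moreover have "monomial_elimination (degree_part I d)"
    using homogeneous_tropical_ideal by (simp add: homogeneous_tropical_ideal_def)
  ultimately obtain r where r: "r \<in> degree_part I d" "lookup r u = Infty"
    "\<And>v. min (lookup (part p) v) (lookup (part q) v) \<le> lookup r v"
    "\<And>v. lookup (part p) v \<noteq> lookup (part q) v \<Longrightarrow>
      lookup r v = min (lookup (part p) v) (lookup (part q) v)"
    using part[OF p(1)] part[OF q(1)] unfolding monomial_elimination_def by blast
  \<comment> \<open>In the remaining degrees nothing is to be cancelled, so the tropical sum already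
    has the required coefficients.\<close>
  define s where "s = r + (rest p + rest q)"
  have "rest p \<in> I" "rest q \<in> I" "r \<in> I"
    unfolding rest_def using r(1) restrict_degrees p(1) q(1) by (blast, blast, simp add: degree_part_def)
  then have "s \<in> I"
    unfolding s_def by (intro semiring_idealD(1)[OF ideal])
  have sv: "lookup s v = lookup r v" if "monom_degree v = d" for v
    using that by (simp add: s_def rest_def lookup_add_tropical lookup_restrict_poly min_absorb1)
  have sv': "lookup s v = min (lookup p v) (lookup q v)" if "monom_degree v \<noteq> d" for v
  proof -
    have "lookup r v = Infty"
      using r(1) that by (auto simp: degree_part_def homogeneous_of_degree_def in_keys_tropical)
    then show ?thesis
      using that by (simp add: s_def rest_def lookup_add_tropical lookup_restrict_poly min_absorb2)
  qed
  show ?thesis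
  proof (intro bexI conjI allI impI)
    show "(\<lambda>v. if v \<in> S then lookup s v else Infty) \<in> restrictions S"
      using \<open>s \<in> I\<close> by (intro restrictionsI) auto
    show "(if u \<in> S then lookup s u else Infty) = Infty"
      using sv[of u] r(2) by (simp add: d_def)
    fix x
    show "min (f x) (g x) \<le> (if x \<in> S then lookup s x else Infty)"
      using sv[of x] sv'[of x] r(3)[of x]
      by (cases "monom_degree x = d") (auto simp: p(2) q(2) part_def lookup_restrict_poly)
    assume "f x \<noteq> g x"
    then show "(if x \<in> S then lookup s x else Infty) = min (f x) (g x)"
      using sv[of x] sv'[of x] r(4)[of x]
      by (cases "monom_degree x = d")
         (auto simp: p(2) q(2) part_def lookup_restrict_poly split: if_splits)
  qed
qed

lemma ordered_tropical_linear_space_restrictions: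
  assumes "finite S"
  shows "ordered_tropical_linear_space (restrictions S) S monom_less"
proof unfold_locales
  show "finite S" by fact
  show "x \<in> S" if "f \<in> restrictions S" "f x \<noteq> Infty" for f x
    using restrictions_outside that by blast
qed (use restrictions_elim monom_less_asym monom_less_trans monom_less_total in blast)+

end

section \<open>Initial ideals on a stratum\<close>

definition exponent_vector :: "'n::finite monom \<Rightarrow> real ^ 'n" where
  "exponent_vector u = (\<chi> i. real (lookup u i))"

definition weight :: "real ^ 'n::finite \<Rightarrow> 'n monom \<Rightarrow> real" where
  "weight x u = exponent_vector u \<bullet> x"

lemma weight_altdef: "weight x u = (\<Sum>i\<in>UNIV. real (lookup u i) * x $ i)"
  by (simp add: weight_def exponent_vector_def inner_vec_def)

lemma weight_add: "weight x (u + v) = weight x u + weight x v"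
  by (simp add: weight_altdef lookup_add algebra_simps sum.distrib)

definition monoms_off :: "'n set \<Rightarrow> 'n monom set" where
  "monoms_off \<sigma> = {u. \<forall>i\<in>\<sigma>. lookup u i = 0}"

lemma add_mem_monoms_off_iff: "m + u \<in> monoms_off \<sigma> \<longleftrightarrow> m \<in> monoms_off \<sigma> \<and> u \<in> monoms_off \<sigma>"
  by (auto simp: monoms_off_def lookup_add)

lemma tropical_Fin_power: "Fin a ^ k = Fin (real k * a)"
  by (induction k) (simp_all add: one_tropical_def algebra_simps)

lemma tropical_prod_Fin: "(\<Prod>i\<in>A. Fin (g i)) = Fin (\<Sum>i\<in>A. g i)"
  by (induction A rule: infinite_finite_induct) (simp_all add: one_tropical_def)

lemma tropical_sum_eq_Fin_iff:
  "finite A \<Longrightarrow> (\<Sum>u\<in>A. g u) = Fin c \<longleftrightarrow> (\<forall>u\<in>A. Fin c \<le> g u) \<and> (\<exists>u\<in>A. g u = Fin c)"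
proof (induction A rule: finite_induct)
  case (insert a A)
  have "Fin c \<le> (\<Sum>u\<in>A. g u) \<longleftrightarrow> (\<forall>u\<in>A. Fin c \<le> g u)"
    using insert(1)
    by (induction A rule: finite_induct) (auto simp: zero_tropical_def plus_tropical_def)
  with insert show ?case
    by (auto simp: plus_tropical_def min_def)
qed (simp add: zero_tropical_def)

text \<open>A positive power of an infinite coordinate makes the term infinite, while the power 0
  contributes nothing. Hence only monomials free of \<sigma> matter.\<close>

lemma term_value_stratum_embed:
  "term_value f (stratum_embed \<sigma> x) u =
     (if u \<in> monoms_off \<sigma> then lookup f u * Fin (weight x u) else Infty)"
proof (cases "u \<in> monoms_off \<sigma>")
  case True
  have "(stratum_embed \<sigma> x $ i) ^ lookup u i = Fin (real (lookup u i) * x $ i)" for i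
    using True
    by (cases "i \<in> \<sigma>") (auto simp: stratum_embed_def monoms_off_def tropical_Fin_power one_tropical_def)
  then show ?thesis
    using True by (simp add: term_value_def tropical_prod_Fin weight_altdef)
next
  case False
  then obtain i where i: "i \<in> \<sigma>" "lookup u i \<noteq> 0" by (auto simp: monoms_off_def)
  then have "(stratum_embed \<sigma> x $ i) ^ lookup u i = 0"
    by (simp add: stratum_embed_def zero_tropical_def[symmetric] power_0_left)
  then have "(\<Prod>i\<in>UNIV. (stratum_embed \<sigma> x $ i) ^ lookup u i) = 0"
    by (intro prod_zero) auto
  then show ?thesis using False by (simp add: term_value_def zero_tropical_def)
qed

section \<open>Boolean polynomials as finite sets of exponents\<close>

definition bool_poly :: "'n monom set \<Rightarrow> 'n tpoly" where
  "bool_poly A = (\<Sum>u\<in>A. Poly_Mapping.single u 1)"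

lemma lookup_bool_poly:
  assumes "finite A"
  shows "lookup (bool_poly A) u = (if u \<in> A then Fin 0 else Infty)"
proof -
  have "lookup (bool_poly A) u = (\<Sum>v\<in>A. if u = v then 1 else 0)"
    unfolding bool_poly_def by (auto simp: lookup_sum lookup_single when_def intro!: sum.cong)
  then show ?thesis using assms by (simp add: one_tropical_def zero_tropical_def)
qed

lemma keys_bool_poly: "finite A \<Longrightarrow> keys (bool_poly A) = A"
  by (auto simp: in_keys_tropical lookup_bool_poly split: if_splits)

lemma bool_poly_keys: "g \<in> boolean_polys \<Longrightarrow> g = bool_poly (keys g)"
  by (rule poly_mapping_eqI) (auto simp: lookup_bool_poly in_keys_tropical boolean_polys_def)

lemma zero_in_boolean_polys: "0 \<in> boolean_polys"
  by (simp add: boolean_polys_def zero_tropical_def)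

lemma single_one_in_boolean_polys: "Poly_Mapping.single m 1 \<in> boolean_polys"
  by (auto simp: boolean_polys_def lookup_single when_def one_tropical_def zero_tropical_def)

lemma initial_form_stratum_embed:
  assumes "\<And>u. u \<in> monoms_off \<sigma> \<Longrightarrow> Fin (c - weight x u) \<le> lookup f u"
    and "v \<in> monoms_off \<sigma>" "lookup f v = Fin (c - weight x v)"
  shows "initial_form (stratum_embed \<sigma> x) f =
    bool_poly {u \<in> monoms_off \<sigma>. lookup f u = Fin (c - weight x u)}"
proof -
  have le: "Fin c \<le> term_value f (stratum_embed \<sigma> x) u" for u
    using assms(1)[of u] by (cases "lookup f u") (auto simp: term_value_stratum_embed)
  have eq: "term_value f (stratum_embed \<sigma> x) u = Fin c \<longleftrightarrow>
      u \<in> monoms_off \<sigma> \<and> lookup f u = Fin (c - weight x u)" for u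
    by (cases "lookup f u") (auto simp: term_value_stratum_embed)
  have "v \<in> keys f" using assms(3) by (simp add: in_keys_tropical)
  then have "poly_value f (stratum_embed \<sigma> x) = Fin c"
    unfolding poly_value_def using le eq assms(2,3) by (subst tropical_sum_eq_Fin_iff) auto
  moreover have "{u \<in> keys f. u \<in> monoms_off \<sigma> \<and> lookup f u = Fin (c - weight x u)} =
      {u \<in> monoms_off \<sigma>. lookup f u = Fin (c - weight x u)}"
    by (auto simp: in_keys_tropical)
  ultimately show ?thesis by (simp add: initial_form_def eq bool_poly_def)
qed

lemma initial_form_cases:
  obtains (zero) "initial_form (stratum_embed \<sigma> x) f = 0"
  | (nonzero) c v where "\<And>u. u \<in> monoms_off \<sigma> \<Longrightarrow> Fin (c - weight x u) \<le> lookup f u"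
    "v \<in> monoms_off \<sigma>" "lookup f v = Fin (c - weight x v)"
proof (cases "poly_value f (stratum_embed \<sigma> x)")
  case Infty
  then show ?thesis by (intro zero) (simp add: initial_form_def)
next
  case (Fin c)
  then have *: "\<And>u. u \<in> keys f \<Longrightarrow> Fin c \<le> term_value f (stratum_embed \<sigma> x) u"
    "\<exists>u\<in>keys f. term_value f (stratum_embed \<sigma> x) u = Fin c"
    by (auto simp: poly_value_def tropical_sum_eq_Fin_iff)
  then obtain v where v: "term_value f (stratum_embed \<sigma> x) v = Fin c" by blast
  show ?thesis
  proof (rule nonzero)
    show "Fin (c - weight x u) \<le> lookup f u" if "u \<in> monoms_off \<sigma>" for u
      using *(1)[of u] that
      by (cases "lookup f u") (auto simp: term_value_stratum_embed in_keys_tropical)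
    show "v \<in> monoms_off \<sigma>" "lookup f v = Fin (c - weight x v)"
      using v by (cases "lookup f v"; auto simp: term_value_stratum_embed split: if_splits)+
  qed
qed

context tropical_ideal
begin

abbreviation stratum_sets :: "'n set \<Rightarrow> real ^ 'n \<Rightarrow> 'n monom set set" where
  "stratum_sets \<sigma> x \<equiv> initial_sets (restrictions (monoms_off \<sigma>)) (weight x)"

lemma stratum_setsE:
  assumes "A \<in> stratum_sets \<sigma> x"
  obtains f where "f \<in> I" "\<And>u. u \<in> monoms_off \<sigma> \<Longrightarrow> Fin (- weight x u) \<le> lookup f u"
    "A = {u \<in> monoms_off \<sigma>. lookup f u = Fin (- weight x u)}"
proof -
  obtain h where h: "h \<in> restrictions (monoms_off \<sigma>)" "\<And>u. Fin (- weight x u) \<le> h u"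
    "A = {u. h u = Fin (- weight x u)}"
    using assms by (rule initial_setsE) blast
  obtain f where f: "f \<in> I" "\<And>u. h u = (if u \<in> monoms_off \<sigma> then lookup f u else Infty)"
    using h(1) by (rule restrictionsE) blast
  show ?thesis
  proof (rule that[OF f(1)])
    show "Fin (- weight x u) \<le> lookup f u" if "u \<in> monoms_off \<sigma>" for u
      using h(2)[of u] that by (simp add: f(2))
    show "A = {u \<in> monoms_off \<sigma>. lookup f u = Fin (- weight x u)}"
      by (auto simp: h(3) f(2) split: if_splits)
  qed
qed

lemma stratum_sets_level:
  assumes "f \<in> I" "\<And>u. u \<in> monoms_off \<sigma> \<Longrightarrow> Fin (c - weight x u) \<le> lookup f u"
  shows "{u \<in> monoms_off \<sigma>. lookup f u = Fin (c - weight x u)} \<in> stratum_sets \<sigma> x"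
proof -
  let ?h = "\<lambda>u. if u \<in> monoms_off \<sigma> then lookup f u else Infty"
  have "?h \<in> restrictions (monoms_off \<sigma>)" using assms(1) by (intro restrictionsI) auto
  then have "{u. ?h u = Fin (c - weight x u)} \<in> stratum_sets \<sigma> x"
    using assms(2) by (intro initial_sets_level) auto
  moreover have "{u. ?h u = Fin (c - weight x u)} =
      {u \<in> monoms_off \<sigma>. lookup f u = Fin (c - weight x u)}"
    by (auto split: if_splits)
  ultimately show ?thesis by simp
qed

lemma stratum_sets_finite:
  assumes "A \<in> stratum_sets \<sigma> x"
  shows "finite A" "A \<subseteq> monoms_off \<sigma>"
proof -
  obtain f where f: "A = {u \<in> monoms_off \<sigma>. lookup f u = Fin (- weight x u)}"
    using assms by (rule stratum_setsE) blast
  then have "A \<subseteq> keys f" by (auto simp: in_keys_tropical)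
  then show "finite A" by (rule finite_subset) simp
  show "A \<subseteq> monoms_off \<sigma>" using f by blast
qed

lemma stratum_sets_shift:
  assumes A: "A \<in> stratum_sets \<sigma> x" and m: "m \<in> monoms_off \<sigma>"
  shows "(+) m ` A \<in> stratum_sets \<sigma> x"
proof -
  obtain f where f: "f \<in> I" "\<And>u. u \<in> monoms_off \<sigma> \<Longrightarrow> Fin (- weight x u) \<le> lookup f u"
    "A = {u \<in> monoms_off \<sigma>. lookup f u = Fin (- weight x u)}"
    using A by (rule stratum_setsE) blast
  let ?g = "Poly_Mapping.single m 1 * f"
  have g: "lookup ?g (m + u) = lookup f u" for u by (simp add: lookup_single_times)
  have "?g \<in> I" using f(1) semiring_idealD(2)[OF ideal] by blast
  \<comment> \<open>Multiplication by the monomial raises the minimal level from 0 to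
    \<open>weight x m\<close>.\<close>
  moreover have "Fin (weight x m - weight x v) \<le> lookup ?g v" if "v \<in> monoms_off \<sigma>" for v
  proof (cases "v \<in> range ((+) m)")
    case True
    then obtain u where u: "v = m + u" by blast
    then have "u \<in> monoms_off \<sigma>" using that by (simp add: add_mem_monoms_off_iff)
    then show ?thesis using f(2) by (simp add: u g weight_add)
  qed (simp add: lookup_single_times_outside)
  ultimately have "{v \<in> monoms_off \<sigma>. lookup ?g v = Fin (weight x m - weight x v)} \<in> stratum_sets \<sigma> x"
    by (rule stratum_sets_level)
  moreover have "{v \<in> monoms_off \<sigma>. lookup ?g v = Fin (weight x m - weight x v)} = (+) m ` A"
  proof (intro set_eqI iffI)
    fix v assume v: "v \<in> {v \<in> monoms_off \<sigma>. lookup ?g v = Fin (weight x m - weight x v)}"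
    then have "v \<in> range ((+) m)" using lookup_single_times_outside[of v m 1 f] by auto
    then obtain u where u: "v = m + u" by blast
    then have "u \<in> A" using v by (simp add: f(3) g weight_add add_mem_monoms_off_iff)
    then show "v \<in> (+) m ` A" using u by blast
  next
    fix v assume "v \<in> (+) m ` A"
    then show "v \<in> {v \<in> monoms_off \<sigma>. lookup ?g v = Fin (weight x m - weight x v)}"
      using m by (auto simp: f(3) g weight_add add_mem_monoms_off_iff)
  qed
  ultimately show ?thesis by simp
qed

lemma initial_form_keys_in_stratum_sets:
  assumes "f \<in> I"
  shows "keys (initial_form (stratum_embed \<sigma> x) f) \<in> stratum_sets \<sigma> x"
proof (cases \<sigma> x f rule: initial_form_cases)
  case zero
  then show ?thesis by (simp add: initial_sets_empty)
next
  case (nonzero c v)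
  have "finite {u \<in> monoms_off \<sigma>. lookup f u = Fin (c - weight x u)}"
    by (rule finite_subset[of _ "keys f"]) (auto simp: in_keys_tropical)
  then show ?thesis
    using stratum_sets_level[OF assms nonzero(1)] initial_form_stratum_embed[OF nonzero]
    by (simp add: keys_bool_poly)
qed

lemma semiring_ideal_initial_ideal: "semiring_ideal boolean_polys (initial_ideal w I)"
  unfolding initial_ideal_def
  by (intro semiring_ideal_ideal_generated semiring_ideal_boolean_polys zero_in_boolean_polys)
     (use initial_form_in_boolean_polys in blast)

text \<open>An ideal to enclose the initial ideal from above. Only the part of the support free of
  \<sigma> is constrained, because multiplication by Boolean polynomials in all variables also
  produces monomials that involve \<sigma>.\<close>

lemma semiring_ideal_of_stratum_sets:
  "semiring_ideal boolean_polys {g \<in> boolean_polys. keys g \<inter> monoms_off \<sigma> \<in> stratum_sets \<sigma> x}"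
  (is "semiring_ideal _ ?J")
proof -
  note bool = semiring_idealD[OF semiring_ideal_boolean_polys]
  have 0: "0 \<in> ?J" by (simp add: zero_in_boolean_polys initial_sets_empty)
  have add: "f + g \<in> ?J" if "f \<in> ?J" "g \<in> ?J" for f g
  proof -
    have "keys (f + g) = keys f \<union> keys g"
      by (auto simp: in_keys_tropical lookup_add_tropical min_def)
    then have "keys (f + g) \<inter> monoms_off \<sigma> = keys f \<inter> monoms_off \<sigma> \<union> keys g \<inter> monoms_off \<sigma>"
      by blast
    then show ?thesis using that bool(1)[of f g] initial_sets_Un by auto
  qed
  have single: "Poly_Mapping.single m 1 * g \<in> ?J" if g: "g \<in> ?J" for m g
  proof -
    have "keys (Poly_Mapping.single m 1 * g) = (+) m ` keys g"
    proof
      show "(+) m ` keys g \<subseteq> keys (Poly_Mapping.single m 1 * g)"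
        by (auto simp: in_keys_tropical lookup_single_times)
    qed (rule keys_single_times_subset)
    then have "keys (Poly_Mapping.single m 1 * g) \<inter> monoms_off \<sigma> =
        (if m \<in> monoms_off \<sigma> then (+) m ` (keys g \<inter> monoms_off \<sigma>) else {})"
      by (auto simp: add_mem_monoms_off_iff)
    then show ?thesis
      using g stratum_sets_shift bool(2)[OF single_one_in_boolean_polys, of g m]
      by (auto simp: initial_sets_empty)
  qed
  have mult: "r * g \<in> ?J" if r: "r \<in> boolean_polys" and g: "g \<in> ?J" for r g
  proof -
    have "(\<Sum>u\<in>A. Poly_Mapping.single u 1 * g) \<in> ?J" for A
      by (induction A rule: infinite_finite_induct) (use g 0 in \<open>auto intro!: add[simplified] single[simplified]\<close>)
    then show ?thesis
      by (subst bool_poly_keys[OF r]) (simp add: bool_poly_def sum_distrib_right)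
  qed
  show ?thesis using 0 add mult unfolding semiring_ideal_def by blast
qed

text \<open>The members of the initial ideal free of \<sigma> are themselves initial forms; since
  these generate it, they determine it.\<close>

lemma bool_poly_in_initial_ideal_iff:
  assumes "finite A" "A \<subseteq> monoms_off \<sigma>"
  shows "bool_poly A \<in> initial_ideal (stratum_embed \<sigma> x) I \<longleftrightarrow> A \<in> stratum_sets \<sigma> x"
proof
  assume A: "A \<in> stratum_sets \<sigma> x"
  show "bool_poly A \<in> initial_ideal (stratum_embed \<sigma> x) I"
  proof (cases "A = {}")
    case True
    then show ?thesis
      using semiring_ideal_zero[OF semiring_ideal_initial_ideal zero_in_boolean_polys]
      by (simp add: bool_poly_def)
  next
    case False
    obtain f where f: "f \<in> I" "\<And>u. u \<in> monoms_off \<sigma> \<Longrightarrow> Fin (- weight x u) \<le> lookup f u"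
      "A = {u \<in> monoms_off \<sigma>. lookup f u = Fin (- weight x u)}"
      using A by (rule stratum_setsE) blast
    obtain v where "v \<in> monoms_off \<sigma>" "lookup f v = Fin (- weight x v)" using False f(3) by blast
    then have "initial_form (stratum_embed \<sigma> x) f = bool_poly A"
      using initial_form_stratum_embed[of \<sigma> 0 x f v] f(2,3) by simp
    then show ?thesis
      unfolding initial_ideal_def using subset_ideal_generated f(1) by (metis imageI subsetD)
  qed
next
  assume "bool_poly A \<in> initial_ideal (stratum_embed \<sigma> x) I"
  moreover have "initial_form (stratum_embed \<sigma> x) f \<in>
      {g \<in> boolean_polys. keys g \<inter> monoms_off \<sigma> \<in> stratum_sets \<sigma> x}" if "f \<in> I" for f
    using initial_form_keys_in_stratum_sets[OF that, of \<sigma> x] stratum_sets_finite(2)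
      initial_form_in_boolean_polys by (auto simp: Int_absorb2)
  ultimately have "bool_poly A \<in> {g \<in> boolean_polys. keys g \<inter> monoms_off \<sigma> \<in> stratum_sets \<sigma> x}"
    using ideal_generated_subset[OF semiring_ideal_of_stratum_sets]
    unfolding initial_ideal_def by blast
  then show "A \<in> stratum_sets \<sigma> x" using assms by (simp add: keys_bool_poly Int_absorb2)
qed

lemma initial_ideal_eq_iff:
  "initial_ideal (stratum_embed \<sigma> x) I = initial_ideal (stratum_embed \<sigma> y) I \<longleftrightarrow>
     stratum_sets \<sigma> x = stratum_sets \<sigma> y"
proof
  assume eq: "initial_ideal (stratum_embed \<sigma> x) I = initial_ideal (stratum_embed \<sigma> y) I"
  have "A \<in> stratum_sets \<sigma> x \<longleftrightarrow> A \<in> stratum_sets \<sigma> y" for A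
  proof (cases "finite A \<and> A \<subseteq> monoms_off \<sigma>")
    case True
    then show ?thesis
      using eq bool_poly_in_initial_ideal_iff[of A \<sigma> x] bool_poly_in_initial_ideal_iff[of A \<sigma> y]
      by simp
  next
    case False
    then show ?thesis using stratum_sets_finite[of A] by metis
  qed
  then show "stratum_sets \<sigma> x = stratum_sets \<sigma> y" by blast
next
  have "initial_ideal (stratum_embed \<sigma> x) I \<subseteq> initial_ideal (stratum_embed \<sigma> y) I"
    if eq: "stratum_sets \<sigma> x = stratum_sets \<sigma> y" for x y
    unfolding initial_ideal_def[of "stratum_embed \<sigma> x"]
  proof (intro ideal_generated_subset semiring_ideal_initial_ideal image_subsetI)
    fix f assume f: "f \<in> I"
    let ?A = "keys (initial_form (stratum_embed \<sigma> x) f)"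
    have A: "?A \<in> stratum_sets \<sigma> x" by (rule initial_form_keys_in_stratum_sets[OF f])
    have "bool_poly ?A \<in> initial_ideal (stratum_embed \<sigma> y) I"
      using A eq bool_poly_in_initial_ideal_iff[OF stratum_sets_finite[OF A]] by simp
    then show "initial_form (stratum_embed \<sigma> x) f \<in> initial_ideal (stratum_embed \<sigma> y) I"
      using bool_poly_keys[OF initial_form_in_boolean_polys, of "stratum_embed \<sigma> x" f] by simp
  qed
  then show "initial_ideal (stratum_embed \<sigma> x) I = initial_ideal (stratum_embed \<sigma> y) I"
    if "stratum_sets \<sigma> x = stratum_sets \<sigma> y" using that by blast
qed

section \<open>Truncation to bounded degree and the determining degree\<close>

definition truncated_monoms :: "'n set \<Rightarrow> nat \<Rightarrow> 'n monom set" where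
  "truncated_monoms \<sigma> D = {u \<in> monoms_off \<sigma>. monom_degree u \<le> D}"

abbreviation truncation :: "'n set \<Rightarrow> nat \<Rightarrow> ('n monom \<Rightarrow> tropical) set" where
  "truncation \<sigma> D \<equiv> restrictions (truncated_monoms \<sigma> D)"

lemma finite_truncated_monoms: "finite (truncated_monoms \<sigma> D)"
  by (rule finite_subset[OF _ finite_monoms_degree_le[of D]]) (auto simp: truncated_monoms_def)

lemmas truncation_space = ordered_tropical_linear_space_restrictions[OF finite_truncated_monoms]

text \<open>As homogeneous components stay in the ideal, a truncated vector is itself a vector on
  all monomials free of \<sigma>, so truncation creates no new initial sets.\<close>

lemma initial_sets_truncation:
  "initial_sets (truncation \<sigma> D) (weight x) = {A \<in> stratum_sets \<sigma> x. A \<subseteq> {u. monom_degree u \<le> D}}"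
  (is "?L = ?R")
proof
  have sub: "truncation \<sigma> D \<subseteq> restrictions (monoms_off \<sigma>)"
  proof
    fix h assume "h \<in> truncation \<sigma> D"
    from restrictions_extend[OF this, of "monoms_off \<sigma>"] obtain k
      where k: "k \<in> restrictions (monoms_off \<sigma>)" "\<And>u. h u = (if u \<in> truncated_monoms \<sigma> D then k u else Infty)"
      by (auto simp: truncated_monoms_def)
    have "h = (\<lambda>u. if monom_degree u \<in> {..D} then k u else Infty)"
      using restrictions_outside[OF k(1)] by (auto simp: k(2) truncated_monoms_def)
    then show "h \<in> restrictions (monoms_off \<sigma>)" using restrictions_truncate[OF k(1), of "{..D}"] by simp
  qed
  show "?L \<subseteq> ?R"
  proof
    fix A assume A: "A \<in> ?L"
    then obtain h where h: "h \<in> truncation \<sigma> D" "A = {u. h u = Fin (- weight x u)}"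
      by (rule initial_setsE) blast
    have "A \<subseteq> truncated_monoms \<sigma> D" using restrictions_outside[OF h(1)] h(2) by fastforce
    then show "A \<in> ?R" using initial_sets_mono[OF sub] A by (auto simp: truncated_monoms_def)
  qed
  show "?R \<subseteq> ?L"
  proof
    fix A assume A: "A \<in> ?R"
    then obtain h where h: "h \<in> restrictions (monoms_off \<sigma>)" "\<And>u. Fin (- weight x u) \<le> h u"
      "A = {u. h u = Fin (- weight x u)}"
      by (auto elim: initial_setsE)
    have "A \<subseteq> truncated_monoms \<sigma> D"
      using A stratum_sets_finite(2) by (auto simp: truncated_monoms_def)
    then show "A \<in> ?L"
      using h(2,3)
      by (intro initial_setsI[OF restrictions_restrict[OF h(1), of "truncated_monoms \<sigma> D"]])
         (auto simp: truncated_monoms_def)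
  qed
qed

lemma stratum_sets_truncate:
  assumes "A \<in> stratum_sets \<sigma> x"
  shows "{u \<in> A. monom_degree u \<le> D} \<in> initial_sets (truncation \<sigma> D) (weight x)"
proof -
  obtain h where h: "h \<in> restrictions (monoms_off \<sigma>)" "\<And>u. Fin (- weight x u) \<le> h u"
    "A = {u. h u = Fin (- weight x u)}"
    using assms by (auto elim: initial_setsE)
  show ?thesis
    using h(2,3) stratum_sets_finite(2)[OF assms]
    by (intro initial_setsI[OF restrictions_restrict[OF h(1), of "truncated_monoms \<sigma> D"]])
       (auto simp: truncated_monoms_def)
qed

abbreviation leading_monoms :: "'n set \<Rightarrow> real ^ 'n \<Rightarrow> 'n monom set" where
  "leading_monoms \<sigma> x \<equiv> leading_set monom_less (restrictions (monoms_off \<sigma>)) (weight x)"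

lemma leading_set_truncation:
  "leading_set monom_less (truncation \<sigma> D) (weight x) =
     {u \<in> leading_monoms \<sigma> x. monom_degree u \<le> D}"
proof (intro set_eqI iffI)
  fix e assume "e \<in> leading_set monom_less (truncation \<sigma> D) (weight x)"
  then show "e \<in> {u \<in> leading_monoms \<sigma> x. monom_degree u \<le> D}"
    unfolding leading_set_def initial_sets_truncation by blast
next
  fix e assume e: "e \<in> {u \<in> leading_monoms \<sigma> x. monom_degree u \<le> D}"
  then obtain A where A: "A \<in> stratum_sets \<sigma> x" "e \<in> A" "\<And>u. u \<in> A \<Longrightarrow> u = e \<or> monom_less e u"
    by (auto simp: leading_set_def)
  show "e \<in> leading_set monom_less (truncation \<sigma> D) (weight x)"
    unfolding leading_set_def
    using stratum_sets_truncate[OF A(1), of D] A(2,3) e by (intro CollectI bexI conjI) auto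
qed

lemma up_closed_leading_monoms: "up_closed (monoms_off \<sigma>) (leading_monoms \<sigma> x)"
  unfolding up_closed_def
proof (intro conjI ballI impI subsetI)
  fix u assume "u \<in> leading_monoms \<sigma> x"
  then show "u \<in> monoms_off \<sigma>" using stratum_sets_finite(2) by (auto simp: leading_set_def)
next
  fix u v assume u: "u \<in> leading_monoms \<sigma> x" and v: "v \<in> monoms_off \<sigma>" and uv: "monom_dvd u v"
  obtain A where A: "A \<in> stratum_sets \<sigma> x" "u \<in> A" "\<And>a. a \<in> A \<Longrightarrow> a = u \<or> monom_less u a"
    using u by (auto simp: leading_set_def)
  define m where "m = v - u"
  have vm: "v = m + u" using monom_dvd_imp_add[OF uv] by (simp add: m_def add.commute)
  then have "m \<in> monoms_off \<sigma>" using v by (simp add: add_mem_monoms_off_iff)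
  then have "(+) m ` A \<in> stratum_sets \<sigma> x" by (rule stratum_sets_shift[OF A(1)])
  moreover have "b = v \<or> monom_less v b" if b: "b \<in> (+) m ` A" for b
  proof -
    obtain a where a: "a \<in> A" "b = m + a" using b by blast
    with A(3)[OF a(1)] monom_less_add_right[of u m a] show ?thesis
      by (auto simp: vm add.commute[of m])
  qed
  ultimately show "v \<in> leading_monoms \<sigma> x"
    unfolding leading_set_def using A(2) vm by blast
qed

text \<open>The antichain condition in degrees up to \<open>d\<close> holds because, for all
  weights, the leading monomials of these degrees are complements of bases of one linear space.
  Summing over the finitely many \<sigma> makes the bound common to all strata.\<close>

lemma ex_generation_degree: "\<exists>D. \<forall>\<sigma> x. generated_up_to D (leading_monoms \<sigma> x)"
proof -
  have "\<exists>D. \<forall>M\<in>range (leading_monoms \<sigma>). {} \<subseteq> M \<longrightarrow> generated_up_to D M" for \<sigma>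
  proof (rule uniform_generation_degree_above)
    show "up_closed (monoms_off \<sigma>) M" if "M \<in> range (leading_monoms \<sigma>)" for M
      using that up_closed_leading_monoms by blast
    show "up_closed (monoms_off \<sigma>) {}" by (simp add: up_closed_def)
    fix M M' d assume M: "M \<in> range (leading_monoms \<sigma>)" "M' \<in> range (leading_monoms \<sigma>)"
      "{u \<in> M. monom_degree u \<le> d} \<subseteq> M'"
    then obtain x y where xy: "M = leading_monoms \<sigma> x" "M' = leading_monoms \<sigma> y" by blast
    interpret ordered_tropical_linear_space "truncation \<sigma> d" "truncated_monoms \<sigma> d" monom_less
      by (rule truncation_space)
    show "{u \<in> M'. monom_degree u \<le> d} \<subseteq> M"
      using leading_set_antichain[of "weight x" "weight y"] M(3)
      unfolding leading_set_truncation xy by blast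
  qed
  then obtain D where D: "\<And>\<sigma> x. generated_up_to (D \<sigma>) (leading_monoms \<sigma> x)"
    by (metis empty_subsetI rangeI)
  have "D \<sigma> \<le> (\<Sum>\<tau>\<in>UNIV. D \<tau>)" for \<sigma> using member_le_sum[of \<sigma> UNIV D] by simp
  then show ?thesis using generated_up_to_mono[OF D] by blast
qed

text \<open>A shift by \<open>m\<close> changes no difference of weights, so minimal terms and ties
  of both weights move along with the form; truncation only replaces values by \<open>Infty\<close>,
  which is never a minimal term.\<close>

lemma leading_form_shift_truncate:
  assumes f: "f \<in> truncation \<sigma> D" "leading_form monom_less (weight x) (weight y) e f"
    and m: "m \<in> monoms_off \<sigma>" "monom_degree (m + e) \<le> D'"
  shows "\<exists>g\<in>truncation \<sigma> D'. leading_form monom_less (weight x) (weight y) (m + e) g"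
proof -
  obtain p where p: "p \<in> restrictions (monoms_off \<sigma>)"
    "\<And>u. f u = (if u \<in> truncated_monoms \<sigma> D then p u else Infty)"
    using restrictions_extend[OF f(1), of "monoms_off \<sigma>"] by (auto simp: truncated_monoms_def)
  have "f = (\<lambda>u. if monom_degree u \<in> {..D} then p u else Infty)"
    using restrictions_outside[OF p(1)] by (auto simp: p(2) truncated_monoms_def)
  then have "f \<in> restrictions (monoms_off \<sigma>)" using restrictions_truncate[OF p(1), of "{..D}"] by simp
  from restrictions_shift[OF this, of m] m(1)
  obtain k where k: "k \<in> restrictions (monoms_off \<sigma>)" "\<And>u. k (m + u) = f u"
    "\<And>v. v \<notin> range ((+) m) \<Longrightarrow> k v = Infty"
    by (auto simp: add_mem_monoms_off_iff)
  define g where "g = (\<lambda>u. if u \<in> truncated_monoms \<sigma> D' then k u else Infty)"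
  note lf = leading_formD[OF f(2)]
  have gk: "g u = k u \<or> g u = Infty" for u by (simp add: g_def)
  have e: "e \<in> monoms_off \<sigma>"
    using lf(1) restrictions_outside[OF f(1), of e] by (force simp: truncated_monoms_def)
  have ge: "g (m + e) = Fin 0"
    using e m lf(1) by (simp add: g_def truncated_monoms_def add_mem_monoms_off_iff k(2))
  have k_forms: "Fin (weight x (m + e) - weight x v) \<le> k v \<and>
      Fin (weight y (m + e) - weight y v) \<le> k v \<and>
      (k v = Fin (weight x (m + e) - weight x v) \<longleftrightarrow> k v = Fin (weight y (m + e) - weight y v)) \<and>
      (k v = Fin (weight x (m + e) - weight x v) \<longrightarrow> v = m + e \<or> monom_less (m + e) v)" for v
  proof (cases "v \<in> range ((+) m)")
    case True
    then obtain u where "v = m + u" by blast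
    moreover have "monom_less (m + e) (m + u) \<longleftrightarrow> monom_less e u"
      unfolding add.commute[of m] by (rule monom_less_add_right)
    ultimately show ?thesis using lf(2-5)[of u] by (auto simp: k(2) weight_add)
  next
    case False
    then show ?thesis using k(3) by simp
  qed
  have "leading_form monom_less (weight x) (weight y) (m + e) g"
  proof (rule leading_formI)
    fix v
    show "g (m + e) = Fin 0" by (rule ge)
    show "Fin (weight x (m + e) - weight x v) \<le> g v" using k_forms[of v] gk[of v] by auto
    show "Fin (weight y (m + e) - weight y v) \<le> g v" using k_forms[of v] gk[of v] by auto
    show "g v = Fin (weight x (m + e) - weight x v) \<longleftrightarrow> g v = Fin (weight y (m + e) - weight y v)"
      using k_forms[of v] gk[of v] by auto
    show "v = m + e \<or> monom_less (m + e) v" if "g v = Fin (weight x (m + e) - weight x v)"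
      using k_forms[of v] gk[of v] that by auto
  qed
  moreover have "g \<in> truncation \<sigma> D'"
    unfolding g_def by (rule restrictions_restrict[OF k(1)]) (auto simp: truncated_monoms_def)
  ultimately show ?thesis by blast
qed

text \<open>Every leading monomial for \<open>x\<close> is a multiple of one of degree at most
  \<open>D\<close>. Equality up to \<open>D\<close> supplies a form for the divisor that leads for
  both weights, and its shift serves the multiple, which gives equality in all degrees.\<close>

lemma stratum_sets_eq_of_truncation:
  assumes D: "generated_up_to D (leading_monoms \<sigma> x)"
    and eq: "initial_sets (truncation \<sigma> D) (weight x) = initial_sets (truncation \<sigma> D) (weight y)"
  shows "stratum_sets \<sigma> x = stratum_sets \<sigma> y"
proof -
  interpret T: ordered_tropical_linear_space "truncation \<sigma> D" "truncated_monoms \<sigma> D" monom_less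
    by (rule truncation_space)
  have all: "initial_sets (truncation \<sigma> D') (weight x) = initial_sets (truncation \<sigma> D') (weight y)" for D'
  proof -
    interpret T': ordered_tropical_linear_space "truncation \<sigma> D'" "truncated_monoms \<sigma> D'" monom_less
      by (rule truncation_space)
    show ?thesis
    proof (rule T'.initial_sets_eq_of_leading_forms)
      fix e assume "e \<in> leading_set monom_less (truncation \<sigma> D') (weight x)"
      then have e: "e \<in> leading_monoms \<sigma> x" "monom_degree e \<le> D'"
        by (simp_all add: leading_set_truncation)
      obtain a where a: "a \<in> leading_monoms \<sigma> x" "monom_degree a \<le> D" "monom_dvd a e"
        using D e(1) by (auto simp: generated_up_to_def)
      then have "a \<in> leading_set monom_less (truncation \<sigma> D) (weight x)"
        by (simp add: leading_set_truncation)
      from T.leading_forms_of_initial_sets_eq[OF eq this]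
      obtain f where f: "f \<in> truncation \<sigma> D" "leading_form monom_less (weight x) (weight y) a f"
        by blast
      have em: "e = (e - a) + a" using monom_dvd_imp_add[OF a(3)] by (simp add: add.commute)
      moreover have "e \<in> monoms_off \<sigma>"
        using up_closed_leading_monoms e(1) by (auto simp: up_closed_def)
      ultimately have "e - a \<in> monoms_off \<sigma>" by (metis add_mem_monoms_off_iff)
      from leading_form_shift_truncate[OF f this] em e(2)
      show "\<exists>f\<in>truncation \<sigma> D'. leading_form monom_less (weight x) (weight y) e f" by metis
    qed
  qed
  have "stratum_sets \<sigma> a \<subseteq> stratum_sets \<sigma> b"
    if ab: "\<And>D. initial_sets (truncation \<sigma> D) (weight a) = initial_sets (truncation \<sigma> D) (weight b)"
    for a b
  proof
    fix A assume A: "A \<in> stratum_sets \<sigma> a"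
    \<comment> \<open>An initial set is finite, so its degrees are bounded; the sum is a convenient
      bound.\<close>
    define D' where "D' = (\<Sum>u\<in>A. monom_degree u)"
    have "monom_degree u \<le> D'" if "u \<in> A" for u
      unfolding D'_def using that stratum_sets_finite(1)[OF A] by (intro member_le_sum) auto
    then have "A \<in> initial_sets (truncation \<sigma> D') (weight a)"
      using A by (auto simp: initial_sets_truncation)
    then show "A \<in> stratum_sets \<sigma> b" unfolding ab by (simp add: initial_sets_truncation)
  qed
  from this[OF all] this[OF all[symmetric]] show ?thesis by blast
qed

lemma ex_determining_degree:
  "\<exists>D. \<forall>\<sigma> x y. initial_ideal (stratum_embed \<sigma> x) I = initial_ideal (stratum_embed \<sigma> y) I \<longleftrightarrow>
     initial_sets (truncation \<sigma> D) (weight x) = initial_sets (truncation \<sigma> D) (weight y)"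
proof -
  obtain D where "\<And>\<sigma> x. generated_up_to D (leading_monoms \<sigma> x)"
    using ex_generation_degree by blast
  then have "stratum_sets \<sigma> x = stratum_sets \<sigma> y \<longleftrightarrow>
      initial_sets (truncation \<sigma> D) (weight x) = initial_sets (truncation \<sigma> D) (weight y)" for \<sigma> x y
    using stratum_sets_eq_of_truncation[of D \<sigma> x y] by (auto simp: initial_sets_truncation)
  then show ?thesis unfolding initial_ideal_eq_iff by blast
qed

end

section \<open>The complex\<close>

lemma subspace_coord_subspace: "subspace (coord_subspace \<sigma>)"
  by (auto simp: subspace_def coord_subspace_def)

text \<open>The inequalities of \<open>optimal\<close> as pairs of normal and bound; infinite
  coefficients impose no condition. The normals are differences of exponents, hence
  integral.\<close>

definition tie_system ::
    "'n::finite monom set \<Rightarrow> ('n monom \<Rightarrow> 'n monom \<Rightarrow> tropical) \<Rightarrow> ((real ^ 'n) \<times> real) set" where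
  "tie_system M C =
     {(exponent_vector e - exponent_vector u, r) | e u r. e \<in> M \<and> C e u = Fin r}"

lemma mem_ineq_polyhedron_tie_system:
  "x \<in> ineq_polyhedron X (tie_system M C) \<longleftrightarrow>
     x \<in> X \<and> (\<forall>e\<in>M. \<forall>u. Fin (weight x e - weight x u) \<le> C e u)"
proof -
  have "Fin (weight x e - weight x u) \<le> C e u \<longleftrightarrow>
      (\<forall>r. C e u = Fin r \<longrightarrow> (exponent_vector e - exponent_vector u) \<bullet> x \<le> r)" for e u
    by (cases "C e u") (auto simp: weight_def inner_diff_left)
  then show ?thesis
    unfolding ineq_polyhedron_def tie_system_def by blast
qed

lemma tight_tie_system:
  "tight (tie_system M C) x =
     {(exponent_vector e - exponent_vector u, r) | e u r.
        e \<in> M \<and> C e u = Fin r \<and> weight x e - weight x u = r}"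
proof -
  have "(exponent_vector e - exponent_vector u) \<bullet> x = weight x e - weight x u" for e u
    by (simp add: weight_def inner_diff_left)
  then show ?thesis unfolding tight_def tie_system_def by force
qed

lemma tight_tie_system_eq_iff:
  "tight (tie_system M C) y = tight (tie_system M C) x \<longleftrightarrow>
     (\<forall>e\<in>M. \<forall>u. C e u = Fin (weight x e - weight x u) \<longleftrightarrow> C e u = Fin (weight y e - weight y u))"
proof
  assume eq: "tight (tie_system M C) y = tight (tie_system M C) x"
  have "C e u = Fin (weight b e - weight b u)"
    if "tight (tie_system M C) a = tight (tie_system M C) b" "e \<in> M"
      "C e u = Fin (weight a e - weight a u)" for a b e u
  proof -
    \<comment> \<open>The same pair may arise from other monomials, but tightness depends only on
      normal and bound, so it still gives the equation for \<open>e\<close> and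
      \<open>u\<close>.\<close>
    have "(exponent_vector e - exponent_vector u, weight a e - weight a u) \<in> tight (tie_system M C) b"
      using that unfolding that(1)[symmetric] unfolding tight_tie_system by blast
    then have "weight b e - weight b u = weight a e - weight a u"
      by (simp add: tight_def weight_def inner_diff_left)
    then show ?thesis using that(3) by simp
  qed
  with eq show "\<forall>e\<in>M. \<forall>u. C e u = Fin (weight x e - weight x u) \<longleftrightarrow> C e u = Fin (weight y e - weight y u)"
    by metis
next
  assume eq: "\<forall>e\<in>M. \<forall>u. C e u = Fin (weight x e - weight x u) \<longleftrightarrow> C e u = Fin (weight y e - weight y u)"
  then have "e \<in> M \<and> C e u = Fin r \<and> weight y e - weight y u = r \<longleftrightarrow>
      e \<in> M \<and> C e u = Fin r \<and> weight x e - weight x u = r" for e u r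
    by (metis tropical.inject)
  then show "tight (tie_system M C) y = tight (tie_system M C) x"
    unfolding tight_tie_system by simp
qed

lemma rational_tie_system: "(a, b) \<in> tie_system M C \<Longrightarrow> a $ i \<in> \<rat>"
  by (auto simp: tie_system_def exponent_vector_def)

section \<open>Limits of cells at points of smaller strata\<close>

lemma closure_stratum_embed_approx:
  assumes z: "stratum_embed \<sigma> z \<in> closure (stratum_embed \<tau> ` P)" and sub: "\<tau> \<subseteq> \<sigma>" and "\<epsilon> > 0"
  shows "\<exists>y\<in>P. (\<forall>i. i \<notin> \<sigma> \<longrightarrow> \<bar>y $ i - z $ i\<bar> < \<epsilon>) \<and> (\<forall>i\<in>\<sigma> - \<tau>. K < y $ i)"
proof -
  \<comment> \<open>A basic neighbourhood: a small interval around each finite coordinate, a ray up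
    to infinity for coordinates in \<sigma> - \<tau>, no condition where both points are
    infinite.\<close>
  define U where "U i = (if i \<in> \<tau> then UNIV else if i \<in> \<sigma> then insert Infty (Fin ` {K<..})
    else Fin ` {z $ i - \<epsilon><..<z $ i + \<epsilon>})" for i
  have "open (insert Infty (Fin ` {a<..}))" "open (Fin ` {a<..<b})" for a b
    unfolding open_tropical_def by (rule generate_topology.Basis; auto)+
  then have U: "open (U i)" for i by (simp add: U_def)
  define S where "S = {w. \<forall>i. w $ i \<in> U i}"
  have "open S" unfolding open_vec_def S_def using U by blast
  moreover have "stratum_embed \<sigma> z \<in> S"
    using sub \<open>\<epsilon> > 0\<close> by (auto simp: S_def U_def stratum_embed_def)
  ultimately have "S \<inter> stratum_embed \<tau> ` P \<noteq> {}"
    using z open_Int_closure_eq_empty by blast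
  then obtain y where y: "y \<in> P" "stratum_embed \<tau> y \<in> S" by blast
  have "stratum_embed \<tau> y $ i \<in> U i" for i using y(2) by (simp add: S_def)
  then have *: "(if i \<in> \<tau> then Infty else Fin (y $ i)) \<in> U i" for i by (simp add: stratum_embed_def)
  have "\<bar>y $ i - z $ i\<bar> < \<epsilon>" if "i \<notin> \<sigma>" for i
    using *[of i] that sub by (auto simp: U_def split: if_splits)
  moreover have "K < y $ i" if "i \<in> \<sigma> - \<tau>" for i
    using *[of i] that by (auto simp: U_def)
  ultimately show ?thesis using y(1) by blast
qed

lemma weight_approx:
  assumes u: "u \<in> monoms_off \<sigma>" and y: "\<And>i. i \<notin> \<sigma> \<Longrightarrow> \<bar>y $ i - z $ i\<bar> < \<epsilon>" and "\<epsilon> > 0"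
  shows "\<bar>weight y u - weight z u\<bar> \<le> \<epsilon> * real (monom_degree u)"
proof -
  have "\<bar>weight y u - weight z u\<bar> = \<bar>\<Sum>i\<in>UNIV. real (lookup u i) * (y $ i - z $ i)\<bar>"
    by (simp add: weight_altdef sum_subtractf algebra_simps)
  also have "\<dots> \<le> (\<Sum>i\<in>UNIV. \<bar>real (lookup u i) * (y $ i - z $ i)\<bar>)" by (rule sum_abs)
  also have "\<dots> \<le> (\<Sum>i\<in>UNIV. \<epsilon> * real (lookup u i))"
  proof (rule sum_mono)
    fix i
    show "\<bar>real (lookup u i) * (y $ i - z $ i)\<bar> \<le> \<epsilon> * real (lookup u i)"
    proof (cases "i \<in> \<sigma>")
      case True
      then show ?thesis using u by (simp add: monoms_off_def)
    next
      case False
      then show ?thesis using mult_right_mono[of "\<bar>y $ i - z $ i\<bar>" \<epsilon> "real (lookup u i)"] y[OF False]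
        by (simp add: abs_mult mult.commute)
    qed
  qed
  also have "\<dots> = \<epsilon> * real (monom_degree u)" by (simp add: monom_degree_def sum_distrib_left)
  finally show ?thesis .
qed

text \<open>Both monomials are free of \<sigma>, so their weights depend only on the coordinates
  that converge to finite limits, and the bound passes to the limit.\<close>

lemma weight_diff_le_closure:
  assumes z: "stratum_embed \<sigma> z \<in> closure (stratum_embed \<tau> ` P)" and sub: "\<tau> \<subseteq> \<sigma>"
    and e: "e \<in> monoms_off \<sigma>" "u \<in> monoms_off \<sigma>"
    and P: "\<And>y. y \<in> P \<Longrightarrow> weight y e - weight y u \<le> r"
  shows "weight z e - weight z u \<le> r"
proof (rule field_le_epsilon)
  fix \<delta> :: real assume "\<delta> > 0"
  define n where "n = real (monom_degree e) + real (monom_degree u) + 1"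
  define \<epsilon> where "\<epsilon> = \<delta> / n"
  have n: "n > 0" by (simp add: n_def add_nonneg_pos)
  then have \<epsilon>: "\<epsilon> > 0" "\<epsilon> * n = \<delta>" using \<open>\<delta> > 0\<close> by (simp_all add: \<epsilon>_def)
  obtain y where y: "y \<in> P" "\<And>i. i \<notin> \<sigma> \<Longrightarrow> \<bar>y $ i - z $ i\<bar> < \<epsilon>"
    using closure_stratum_embed_approx[OF z sub \<epsilon>(1)] by blast
  have "\<bar>weight y e - weight z e\<bar> \<le> \<epsilon> * real (monom_degree e)"
    "\<bar>weight y u - weight z u\<bar> \<le> \<epsilon> * real (monom_degree u)"
    using weight_approx[OF _ y(2) \<epsilon>(1)] e by blast+
  moreover have "\<delta> = \<epsilon> * real (monom_degree e) + \<epsilon> * real (monom_degree u) + \<epsilon>"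
    using \<epsilon>(2) by (simp add: n_def algebra_simps)
  ultimately show "weight z e - weight z u \<le> r + \<delta>" using P[OF y(1)] \<epsilon>(1) by linarith
qed

text \<open>The monomial \<open>e\<close> contains a variable whose coordinate tends to infinity,
  while the weight of \<open>u\<close> stays bounded.\<close>

lemma weight_diff_unbounded_closure:
  assumes z: "stratum_embed \<sigma> z \<in> closure (stratum_embed \<tau> ` P)" and sub: "\<tau> \<subseteq> \<sigma>"
    and e: "e \<in> monoms_off \<tau>" "e \<notin> monoms_off \<sigma>" and u: "u \<in> monoms_off \<sigma>"
  shows "\<exists>y\<in>P. c < weight y e - weight y u"
proof -
  obtain i where i: "i \<in> \<sigma> - \<tau>" "lookup e i \<noteq> 0"
    using e unfolding monoms_off_def by blast
  \<comment> \<open>The constant \<open>b\<close> bounds the negative contributions to the weight of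
    \<open>e\<close>, and 1 is the tolerance in the finite coordinates. \<open>K\<close> is
    nonnegative so that the other escaping coordinates cannot lower the weight.\<close>
  define b where "b = (\<Sum>j\<in>UNIV. real (lookup e j) * (\<bar>z $ j\<bar> + 1))"
  define K where "K = max 0 (c + b + weight z u + real (monom_degree u) + 1)"
  obtain y where y: "y \<in> P" "\<And>j. j \<notin> \<sigma> \<Longrightarrow> \<bar>y $ j - z $ j\<bar> < 1" "\<And>j. j \<in> \<sigma> - \<tau> \<Longrightarrow> K < y $ j"
    using closure_stratum_embed_approx[OF z sub zero_less_one, of K] by blast
  have term_le: "(if j = i then K else 0) - real (lookup e j) * (\<bar>z $ j\<bar> + 1) \<le> real (lookup e j) * y $ j"
    for j
  proof -
    consider "j \<in> \<tau>" | "j \<in> \<sigma> - \<tau>" | "j \<notin> \<sigma>" by blast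
    then show ?thesis
    proof cases
      case 1
      then show ?thesis using e(1) i(1) by (auto simp: monoms_off_def)
    next
      case 2
      then have "K < y $ j" "0 \<le> K" using y(3) by (auto simp: K_def)
      moreover have "(if j = i then K else 0) \<le> real (lookup e j) * K"
        using i(2) \<open>0 \<le> K\<close> by (auto simp: mult_le_cancel_right1)
      moreover have "real (lookup e j) * K \<le> real (lookup e j) * y $ j"
        using \<open>K < y $ j\<close> by (intro mult_left_mono) auto
      moreover have "0 \<le> real (lookup e j) * (\<bar>z $ j\<bar> + 1)" by simp
      ultimately show ?thesis by linarith
    next
      case 3
      then have "- (\<bar>z $ j\<bar> + 1) \<le> y $ j" using y(2)[OF 3] by linarith
      then have "real (lookup e j) * - (\<bar>z $ j\<bar> + 1) \<le> real (lookup e j) * y $ j"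
        by (rule mult_left_mono) simp
      moreover have "j \<noteq> i" using 3 i(1) by blast
      ultimately show ?thesis by (simp add: algebra_simps)
    qed
  qed
  have "K - b = (\<Sum>j\<in>UNIV. (if j = i then K else 0) - real (lookup e j) * (\<bar>z $ j\<bar> + 1))"
    by (simp add: b_def sum_subtractf)
  also have "\<dots> \<le> weight y e" unfolding weight_altdef using term_le by (rule sum_mono)
  finally have "K - b \<le> weight y e" .
  moreover have "\<bar>weight y u - weight z u\<bar> \<le> 1 * real (monom_degree u)"
    by (rule weight_approx[OF u y(2)]) auto
  ultimately have "c < weight y e - weight y u" unfolding K_def by linarith
  with y(1) show ?thesis by blast
qed

lemma stratum_eq_image: "stratum \<sigma> = stratum_embed \<sigma> ` coord_subspace \<sigma>"
  using bij_betw_imp_surj_on[OF bij_betw_stratum_embed] by blast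

lemma stratum_embed_mem_image_iff:
  assumes "x \<in> coord_subspace \<sigma>" "S \<subseteq> coord_subspace \<sigma>"
  shows "stratum_embed \<sigma> x \<in> stratum_embed \<sigma> ` S \<longleftrightarrow> x \<in> S"
  using inj_on_image_mem_iff[OF bij_betw_imp_inj_on[OF bij_betw_stratum_embed] assms] .

context tropical_ideal
begin

definition systems :: "nat \<Rightarrow> 'n set \<Rightarrow> ((real ^ 'n) \<times> real) set set" where
  "systems D \<sigma> = {tie_system M C | M C. tropical_linear_space.basis (truncation \<sigma> D) M C}"

definition cells :: "nat \<Rightarrow> 'n set \<Rightarrow> (real ^ 'n) set set" where
  "cells D \<sigma> = tight_partition.faces (coord_subspace \<sigma>) (systems D \<sigma>)"

text \<open>A basis determines its circuits, so there are at most as many systems as subsets of the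
  finite ground set, although the circuit functions are arbitrary outside \<open>M\<close>.\<close>

lemma finite_systems: "finite (systems D \<sigma>)"
proof -
  interpret ordered_tropical_linear_space "truncation \<sigma> D" "truncated_monoms \<sigma> D" monom_less
    by (rule truncation_space)
  have "tie_system M C = tie_system M (SOME C. basis M C)" if b: "basis M C" for M C
  proof -
    have b': "basis M (SOME C. basis M C)" using b by (rule someI[of "basis M"])
    have "C e = (SOME C. basis M C) e" if "e \<in> M" for e
      using basisD(1-3)[OF b that] by (intro basis_unique[OF b' that]) auto
    then show ?thesis unfolding tie_system_def by (metis (no_types, lifting))
  qed
  then have "systems D \<sigma> \<subseteq> (\<lambda>M. tie_system M (SOME C. basis M C)) ` Pow (truncated_monoms \<sigma> D)"
    unfolding systems_def using basis_subset by blast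
  then show ?thesis by (rule finite_subset) (simp add: finite_truncated_monoms)
qed

lemma finite_system:
  assumes "J \<in> systems D \<sigma>"
  shows "finite J"
proof -
  interpret ordered_tropical_linear_space "truncation \<sigma> D" "truncated_monoms \<sigma> D" monom_less
    by (rule truncation_space)
  obtain M C where J: "J = tie_system M C" and b: "basis M C"
    using assms by (auto simp: systems_def)
  let ?f = "\<lambda>(e, u). (exponent_vector e - exponent_vector u,
    case C e u of Fin r \<Rightarrow> r | Infty \<Rightarrow> 0)"
  have "J \<subseteq> ?f ` (truncated_monoms \<sigma> D \<times> truncated_monoms \<sigma> D)"
  proof
    fix p assume "p \<in> J"
    then obtain e u r where p: "p = (exponent_vector e - exponent_vector u, r)" "e \<in> M" "C e u = Fin r"
      by (auto simp: J tie_system_def)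
    then have "u \<in> truncated_monoms \<sigma> D" "e \<in> truncated_monoms \<sigma> D"
      using support[OF basisD(1)[OF b p(2)], of u] basis_subset[OF b] by auto
    then show "p \<in> ?f ` (truncated_monoms \<sigma> D \<times> truncated_monoms \<sigma> D)"
      using p by (intro image_eqI[of _ _ "(e, u)"]) auto
  qed
  then show ?thesis by (rule finite_subset) (simp add: finite_truncated_monoms)
qed

text \<open>Existence of an optimal basis gives the covering. Equality of initial spaces is
  characterised by ties of any basis optimal at \<open>x\<close>, which is the class
  condition.\<close>

lemma tight_partition_systems:
  "tight_partition (coord_subspace \<sigma>) (systems D \<sigma>)
     (\<lambda>x y. initial_sets (truncation \<sigma> D) (weight x) = initial_sets (truncation \<sigma> D) (weight y))"
proof
  interpret ordered_tropical_linear_space "truncation \<sigma> D" "truncated_monoms \<sigma> D" monom_less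
    by (rule truncation_space)
  show "subspace (coord_subspace \<sigma>)" by (rule subspace_coord_subspace)
  show "finite (systems D \<sigma>)" by (rule finite_systems)
  show "finite J" if "J \<in> systems D \<sigma>" for J using that by (rule finite_system)
  show "\<exists>J\<in>systems D \<sigma>. x \<in> ineq_polyhedron (coord_subspace \<sigma>) J" if x: "x \<in> coord_subspace \<sigma>" for x
  proof -
    obtain M C where "basis M C" "optimal M C (weight x)" using ex_optimal_basis by blast
    then show ?thesis
      using x by (intro bexI[of _ "tie_system M C"])
        (auto simp: mem_ineq_polyhedron_tie_system optimal_def systems_def)
  qed
  fix J x y
  assume J: "J \<in> systems D \<sigma>" and x: "x \<in> ineq_polyhedron (coord_subspace \<sigma>) J"
    and y: "y \<in> coord_subspace \<sigma>"
  obtain M C where JM: "J = tie_system M C" and b: "basis M C"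
    using J by (auto simp: systems_def)
  have ox: "optimal M C (weight x)"
    using x by (simp add: JM mem_ineq_polyhedron_tie_system optimal_def)
  have "y \<in> ineq_polyhedron (coord_subspace \<sigma>) J \<and> tight J y = tight J x \<longleftrightarrow>
      optimal M C (weight y) \<and> same_ties M C (weight x) (weight y)"
    using y by (simp add: JM mem_ineq_polyhedron_tie_system optimal_def tight_tie_system_eq_iff
      same_ties_def)
  also have "\<dots> \<longleftrightarrow> initial_sets (truncation \<sigma> D) (weight x) = initial_sets (truncation \<sigma> D) (weight y)"
  proof
    assume "optimal M C (weight y) \<and> same_ties M C (weight x) (weight y)"
    moreover from this have "same_ties M C (weight y) (weight x)" by (simp add: same_ties_def)
    ultimately show "initial_sets (truncation \<sigma> D) (weight x) = initial_sets (truncation \<sigma> D) (weight y)"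
      using initial_sets_subset_of_same_ties[OF b] ox by (meson subset_antisym)
  qed (use same_ties_of_initial_sets_eq[OF b ox] in blast)
  finally show "initial_sets (truncation \<sigma> D) (weight x) = initial_sets (truncation \<sigma> D) (weight y) \<longleftrightarrow>
      y \<in> ineq_polyhedron (coord_subspace \<sigma>) J \<and> tight J y = tight J x" ..
qed

text \<open>If points of a cell escape to infinity in the coordinates of \<open>\<sigma> - \<tau>\<close>, then a basis
  element \<open>e\<close> outside \<open>monoms_off \<sigma>\<close> still has minimal weight in its circuit, so the whole
  circuit lies outside \<open>monoms_off \<sigma>\<close>. Hence the remaining circuits restrict to a basis.\<close>

lemma basis_restrict:
  assumes b: "tropical_linear_space.basis (truncation \<tau> D) M C" and sub: "\<tau> \<subseteq> \<sigma>"
    and P: "P \<subseteq> ineq_polyhedron X (tie_system M C)"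
    and z: "stratum_embed \<sigma> z \<in> closure (stratum_embed \<tau> ` P)"
  shows "tropical_linear_space.basis (truncation \<sigma> D) (M \<inter> monoms_off \<sigma>)
    (\<lambda>e u. if u \<in> truncated_monoms \<sigma> D then C e u else Infty)"
proof -
  interpret T: ordered_tropical_linear_space "truncation \<tau> D" "truncated_monoms \<tau> D" monom_less
    by (rule truncation_space)
  interpret S: ordered_tropical_linear_space "truncation \<sigma> D" "truncated_monoms \<sigma> D" monom_less
    by (rule truncation_space)
  note b = b[unfolded T.basis_def[symmetric]]
  have MT: "M \<subseteq> truncated_monoms \<tau> D" by (rule T.basis_subset[OF b])
  have incl: "truncated_monoms \<sigma> D \<subseteq> truncated_monoms \<tau> D"
    using sub by (auto simp: truncated_monoms_def monoms_off_def)
  have outside: "u \<notin> monoms_off \<sigma>" if e: "e \<in> M" "e \<notin> monoms_off \<sigma>" and u: "C e u \<noteq> Infty" for e u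
  proof
    assume "u \<in> monoms_off \<sigma>"
    obtain c where c: "C e u = Fin c" using u by (cases "C e u") auto
    have "e \<in> monoms_off \<tau>" using e(1) MT by (auto simp: truncated_monoms_def)
    from weight_diff_unbounded_closure[OF z sub this e(2) \<open>u \<in> monoms_off \<sigma>\<close>, of c]
    obtain y where "y \<in> P" "c < weight y e - weight y u" by blast
    moreover from this(1) P have "Fin (weight y e - weight y u) \<le> C e u"
      using e(1) by (auto simp: mem_ineq_polyhedron_tie_system)
    ultimately show False by (simp add: c)
  qed
  show ?thesis
    unfolding S.basis_def
  proof (intro conjI ballI allI impI)
    fix e assume e: "e \<in> M \<inter> monoms_off \<sigma>"
    then have eM: "e \<in> M" "e \<in> truncated_monoms \<sigma> D" using MT by (auto simp: truncated_monoms_def)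
    show "(\<lambda>u. if u \<in> truncated_monoms \<sigma> D then C e u else Infty) \<in> truncation \<sigma> D"
      by (rule restrictions_restrict[OF T.basisD(1)[OF b eM(1)] incl])
    show "(if e \<in> truncated_monoms \<sigma> D then C e e else Infty) = Fin 0"
      using T.basisD(2)[OF b eM(1)] eM(2) by simp
    show "(if e' \<in> truncated_monoms \<sigma> D then C e e' else Infty) = Infty"
      if "e' \<in> M \<inter> monoms_off \<sigma>" "e' \<noteq> e" for e'
      using T.basisD(3)[OF b eM(1), of e'] that by simp
  next
    fix f u assume f: "f \<in> truncation \<sigma> D" and zero: "\<forall>e\<in>M \<inter> monoms_off \<sigma>. f e = Infty"
    obtain k where k: "k \<in> truncation \<tau> D"
      "\<And>u. f u = (if u \<in> truncated_monoms \<sigma> D then k u else Infty)"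
      using restrictions_extend[OF f incl] by blast
    show "f u = Infty"
    proof (rule ccontr)
      assume fu: "f u \<noteq> Infty"
      then have u: "u \<in> truncated_monoms \<sigma> D" "k u \<noteq> Infty" by (auto simp: k(2) split: if_splits)
      then have "u \<notin> M" using zero fu by (auto simp: truncated_monoms_def)
      then obtain e where e: "e \<in> M" "k e * C e u \<le> k u"
        using T.basis_dominates[OF b k(1) _ u(2)] by blast
      then have ne: "k e \<noteq> Infty" "C e u \<noteq> Infty" using u(2) by auto
      then have "e \<in> monoms_off \<sigma>" using outside[OF e(1)] u(1) by (auto simp: truncated_monoms_def)
      then have "f e = k e" using e(1) MT by (auto simp: k(2) truncated_monoms_def)
      then show False using zero e(1) \<open>e \<in> monoms_off \<sigma>\<close> ne(1) by auto
    qed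
  qed
qed

text \<open>The system bounding \<open>P\<close> restricts to the system of a basis in the smaller
  stratum. The inequalities and equations valid on \<open>P\<close> that involve only monomials free
  of \<sigma> persist in the limit, and together they describe one face.\<close>

lemma closure_of_cell:
  assumes sub: "\<tau> \<subseteq> \<sigma>" and P: "P \<in> cells D \<tau>"
  shows "\<exists>Q\<in>cells D \<sigma>. closure (stratum_embed \<tau> ` P) \<inter> stratum \<sigma> \<subseteq> stratum_embed \<sigma> ` Q"
proof -
  interpret T: tight_partition "coord_subspace \<tau>" "systems D \<tau>"
    "\<lambda>x y. initial_sets (truncation \<tau> D) (weight x) = initial_sets (truncation \<tau> D) (weight y)"
    by (rule tight_partition_systems)
  interpret S: tight_partition "coord_subspace \<sigma>" "systems D \<sigma>"
    "\<lambda>x y. initial_sets (truncation \<sigma> D) (weight x) = initial_sets (truncation \<sigma> D) (weight y)"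
    by (rule tight_partition_systems)
  define Z where "Z = {z \<in> coord_subspace \<sigma>. stratum_embed \<sigma> z \<in> closure (stratum_embed \<tau> ` P)}"
  have Z: "closure (stratum_embed \<tau> ` P) \<inter> stratum \<sigma> \<subseteq> stratum_embed \<sigma> ` Z"
    by (auto simp: stratum_eq_image Z_def)
  have "\<exists>Q\<in>cells D \<sigma>. Z \<subseteq> Q"
  proof (cases "Z = {}")
    case True
    \<comment> \<open>With no limit points any cell will do, but one must exist; the origin lies in
      some cell.\<close>
    have "(0 :: real ^ 'n) \<in> coord_subspace \<sigma>" by (simp add: coord_subspace_def)
    then show ?thesis using True S.Union_faces unfolding cells_def by blast
  next
    case False
    then obtain z0 where z0: "z0 \<in> Z" by blast
    obtain J p where J: "J \<in> systems D \<tau>" and p: "p \<in> ineq_polyhedron (coord_subspace \<tau>) J"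
      and PJ: "P = tight_face (coord_subspace \<tau>) J p"
      using P unfolding cells_def by (rule T.facesE)
    obtain M C where JM: "J = tie_system M C"
      and b: "tropical_linear_space.basis (truncation \<tau> D) M C"
      using J by (auto simp: systems_def)
    define C' where "C' e u = (if u \<in> truncated_monoms \<sigma> D then C e u else Infty)" for e u
    define J' where "J' = tie_system (M \<inter> monoms_off \<sigma>) C'"
    \<comment> \<open>The restricted inequalities that are tight at the relative interior point
      \<open>p\<close>, hence tight on all of \<open>P\<close>. The point \<open>p\<close> lies in
      the stratum of \<tau> and only serves to select them.\<close>
    define ties where "ties = tight J' p"
    have P_sub: "P \<subseteq> ineq_polyhedron (coord_subspace \<tau>) (tie_system M C)"
      by (auto simp: PJ JM tight_face_def)
    have "tropical_linear_space.basis (truncation \<sigma> D) (M \<inter> monoms_off \<sigma>) C'"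
      unfolding C'_def using basis_restrict[OF b sub P_sub, of z0] z0 by (simp add: Z_def)
    then have J'_mem: "J' \<in> systems D \<sigma>" unfolding systems_def J'_def by blast
    define Q where "Q = {y \<in> ineq_polyhedron (coord_subspace \<sigma>) J'. ties \<subseteq> tight J' y}"
    have "z \<in> Q" if z: "z \<in> Z" for z
    proof -
      have zc: "stratum_embed \<sigma> z \<in> closure (stratum_embed \<tau> ` P)" "z \<in> coord_subspace \<sigma>"
        using z by (auto simp: Z_def)
      note le = weight_diff_le_closure[OF zc(1) sub]
      have C'D: "u \<in> monoms_off \<sigma>" "C e u = Fin r" if "C' e u = Fin r" for e u r
        using that by (auto simp: C'_def truncated_monoms_def split: if_splits)
      have "Fin (weight z e - weight z u) \<le> C' e u" if e: "e \<in> M \<inter> monoms_off \<sigma>" for e u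
      proof (cases "C' e u")
        case (Fin r)
        have "weight y e - weight y u \<le> r" if "y \<in> P" for y
        proof -
          have "Fin (weight y e - weight y u) \<le> C e u"
            using that P_sub e by (auto simp: mem_ineq_polyhedron_tie_system)
          then show ?thesis using C'D(2)[OF Fin] by simp
        qed
        then have "weight z e - weight z u \<le> r" using le e C'D(1)[OF Fin] by blast
        then show ?thesis using Fin by simp
      qed simp
      then have "z \<in> ineq_polyhedron (coord_subspace \<sigma>) J'"
        unfolding J'_def mem_ineq_polyhedron_tie_system using zc(2) by blast
      moreover have "ties \<subseteq> tight J' z"
      proof
        fix q assume "q \<in> ties"
        then obtain e u r where q: "q = (exponent_vector e - exponent_vector u, r)"
          "e \<in> M \<inter> monoms_off \<sigma>" "C' e u = Fin r" "weight p e - weight p u = r"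
          unfolding ties_def J'_def tight_tie_system by blast
        then have "q \<in> tight J p" using C'D(2) unfolding JM tight_tie_system by blast
        then have "q \<in> tight J y" if "y \<in> P" for y using that by (auto simp: PJ tight_face_def)
        then have *: "weight y e - weight y u = r" if "y \<in> P" for y
          using that by (fastforce simp: tight_def q(1) weight_def inner_diff_left)
        \<comment> \<open>An equation valid on \<open>P\<close> passes to the limit as two opposite
          inequalities.\<close>
        have "weight z e - weight z u \<le> r" "weight z u - weight z e \<le> - r"
          using le[of e u r] le[of u e "- r"] q(2) C'D(1)[OF q(3)] * by force+
        then have "weight z e - weight z u = r" by simp
        then show "q \<in> tight J' z" unfolding J'_def tight_tie_system using q by blast
      qed
      ultimately show ?thesis by (simp add: Q_def)
    qed
    then have "Z \<subseteq> Q" by blast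
    moreover have "Q face_of ineq_polyhedron (coord_subspace \<sigma>) J'"
      unfolding Q_def
      by (rule tight_subset_face_of[OF subspace_imp_convex[OF subspace_coord_subspace]])
         (auto simp: ties_def tight_def)
    moreover have "Q \<noteq> {}" using \<open>Z \<subseteq> Q\<close> z0 by blast
    ultimately show ?thesis unfolding cells_def S.faces_def using J'_mem by blast
  qed
  then show ?thesis using Z by blast
qed

lemma R_rational_cells: "R_rational (cells D)"
  unfolding R_rational_def
proof (intro allI ballI)
  fix \<sigma> P assume P: "P \<in> cells D \<sigma>"
  interpret tight_partition "coord_subspace \<sigma>" "systems D \<sigma>"
    "\<lambda>x y. initial_sets (truncation \<sigma> D) (weight x) = initial_sets (truncation \<sigma> D) (weight y)"
    by (rule tight_partition_systems)
  obtain J x where J: "J \<in> systems D \<sigma>" "P = tight_face (coord_subspace \<sigma>) J x"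
    using P unfolding cells_def by (rule facesE)
  show "R_rational_polyhedron \<sigma> P"
    unfolding J(2)
  proof (rule R_rational_polyhedron_tight_face[OF finite_system[OF J(1)]])
    fix a b i assume "(a, b) \<in> J"
    then show "a $ i \<in> \<rat>" using J(1) rational_tie_system by (auto simp: systems_def)
  qed
qed

lemma tropical_polyhedral_complex_cells: "tropical_polyhedral_complex (cells D)"
  unfolding tropical_polyhedral_complex_def
  using closure_of_cell tight_partition.polyhedral_complex_faces[OF tight_partition_systems]
    tight_partition.faces_subset[OF tight_partition_systems]
  by (auto simp: cells_def)

lemma finite_complex_cells: "finite_complex (cells D)"
  unfolding finite_complex_def cells_def
  using tight_partition.finite_faces[OF tight_partition_systems] by blast

lemma complex_support_cells: "complex_support (cells D) = UNIV"
proof (intro set_eqI iffI UNIV_I)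
  fix w :: "tropical ^ 'n"
  have "w \<in> stratum {i. w $ i = Infty}" by (simp add: stratum_def)
  then obtain \<sigma> x where x: "x \<in> coord_subspace \<sigma>" "w = stratum_embed \<sigma> x"
    unfolding stratum_eq_image by blast
  obtain F where "F \<in> cells D \<sigma>" "x \<in> F"
    using x(1) tight_partition.Union_faces[OF tight_partition_systems, of \<sigma> D]
    unfolding cells_def by blast
  then show "w \<in> complex_support (cells D)" using x(2) by (auto simp: complex_support_def)
qed

lemma same_cell_cells_iff:
  assumes "x \<in> coord_subspace \<sigma>" "y \<in> coord_subspace \<sigma>"
  shows "same_cell (cells D) \<sigma> (stratum_embed \<sigma> x) (stratum_embed \<sigma> y) \<longleftrightarrow>
    initial_sets (truncation \<sigma> D) (weight x) = initial_sets (truncation \<sigma> D) (weight y)"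
proof -
  interpret tight_partition "coord_subspace \<sigma>" "systems D \<sigma>"
    "\<lambda>x y. initial_sets (truncation \<sigma> D) (weight x) = initial_sets (truncation \<sigma> D) (weight y)"
    by (rule tight_partition_systems)
  have "rel_interior F \<subseteq> coord_subspace \<sigma>" if "F \<in> cells D \<sigma>" for F
    using that faces_subset rel_interior_subset unfolding cells_def by blast
  then have "same_cell (cells D) \<sigma> (stratum_embed \<sigma> x) (stratum_embed \<sigma> y) \<longleftrightarrow>
      (\<exists>F\<in>cells D \<sigma>. x \<in> rel_interior F \<and> y \<in> rel_interior F)"
    unfolding same_cell_def using stratum_embed_mem_image_iff assms by (metis (no_types, lifting))
  also have "\<dots> \<longleftrightarrow> initial_sets (truncation \<sigma> D) (weight x) = initial_sets (truncation \<sigma> D) (weight y)"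
    unfolding cells_def by (rule same_rel_interior_iff[OF assms])
  finally show ?thesis .
qed

end

theorem theorem5p2:
  fixes I :: "'n::finite tpoly set"
  assumes "homogeneous_tropical_ideal I"
  shows "\<exists>\<Sigma> :: 'n set \<Rightarrow> (real ^ 'n) set set.
           tropical_polyhedral_complex \<Sigma> \<and> finite_complex \<Sigma> \<and> R_rational \<Sigma> \<and>
           complex_support \<Sigma> = UNIV \<and>
           (\<forall>\<sigma>. \<forall>w\<in>stratum \<sigma>. \<forall>w'\<in>stratum \<sigma>.
              same_cell \<Sigma> \<sigma> w w' \<longleftrightarrow> initial_ideal w I = initial_ideal w' I)"
proof -
  interpret tropical_ideal I by unfold_locales fact
  obtain D where D: "\<And>\<sigma> x y.
      initial_ideal (stratum_embed \<sigma> x) I = initial_ideal (stratum_embed \<sigma> y) I \<longleftrightarrow>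
      initial_sets (truncation \<sigma> D) (weight x) = initial_sets (truncation \<sigma> D) (weight y)"
    using ex_determining_degree by blast
  have "same_cell (cells D) \<sigma> w w' \<longleftrightarrow> initial_ideal w I = initial_ideal w' I"
    if "w \<in> stratum \<sigma>" and "w' \<in> stratum \<sigma>" for \<sigma> w w'
  proof -
    obtain x y where "x \<in> coord_subspace \<sigma>" "w = stratum_embed \<sigma> x"
      "y \<in> coord_subspace \<sigma>" "w' = stratum_embed \<sigma> y"
      using \<open>w \<in> stratum \<sigma>\<close> \<open>w' \<in> stratum \<sigma>\<close> unfolding stratum_eq_image by blast
    then show ?thesis using same_cell_cells_iff D by simp
  qed
  then show ?thesis
    using tropical_polyhedral_complex_cells finite_complex_cells R_rational_cells
      complex_support_cells by blast
qed

end
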